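(* Let $\mathbb{K}$ be a field of characteristic $0$. The operad $(\mathcal{FH},\{\circ_i\})$ of forests of rooted hypertrees, with partial compositions given by insertion, is isomorphic to the operad $\mathrm{ComPreLie}$. Moreover, the isomorphism is given by $x_2\mapsto x$ and $c_2\mapsto c$, where $x_2\in\mathcal{FH}(\{1,2\})$ is the rooted tree with root $1$ and with $2$ attached to $1$ by a simple edge, and $c_2\in\mathcal{FH}(\{1,2\})$ is the forest consisting of two one-vertex trees labeled $1$ and $2$.
   Context: **ComPreLie.** Operads are symmetric operads in $\mathbb{K}$-vector spaces; a transposition acts on an operation by exchanging the corresponding inputs; $\mathcal{T}\{\dots\}$ is the free operad on the given binary generators. $\mathrm{ComPreLie}$ is $$\mathcal{T}\{x,y,c\}/\langle (x\circ_1 x - x\circ_2 x) - (x\circ_1 x - x\circ_2 x).(2\;3),\; x\circ_1 c - (c\circ_1 x).(2\;3) - c\circ_2 x,\; c\circ_1 c - c\circ_2 c \rangle ,$$ with $x.(1\;2)=y$, $c.(1\;2)=c$. **Forests of rooted hypertrees.** A hypergraph is a pair $(\mathcal V,\mathcal E)$ with $\mathcal V$ a finite set and $\mathcal E$ a set of subsets of $\mathcal V$ of cardinality at least $2$ (edges). A cycle consists of $n\ge 2$ distinct vertices $v_1,\dots,v_n$ and $n$ distinct edges $e_1,\dots,e_n$ with $v_{i-1},v_i\in e_i$ (indices mod $n$). A rooted hypertree is a nonempty connected hypergraph without cycles with a distinguished vertex, the root. Every edge $e$ then has a unique vertex closest to the root, its parent vertex; the other vertices of $e$ are children of it via $e$;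 one calls $e$ an incoming edge of its parent vertex. A forest of rooted hypertrees labeled by a finite set $L$ is a nonempty finite set of rooted hypertrees on disjoint vertex sets, with a bijection between the set of all vertices and $L$. $\mathcal{FH}(L)$ is the $\mathbb{K}$-vector space with basis the set of such forests. **Insertion.** Let $S\in\mathcal{FH}(A\sqcup\{i\})$ and $T\in\mathcal{FH}(B)$ be forests, and $v_i$ the vertex of $S$ labeled $i$. Let $I$ be the set of incoming edges of $v_i$. Then $S\circ_i T=\sum_{f:I\to \mathcal V(T)} S\circ_i^f T$, where $S\circ_i^f T$ has vertex set $(\mathcal V(S)\setminus\{v_i\})\sqcup\mathcal V(T)$ and edges: all edges of $T$; all edges of $S$ not containing $v_i$; the edge $(e\setminus\{v_i\})\cup\{f(e)\}$ for each $e\in I$ (with parent vertex $f(e)$); and, if $v_i$ is not a root of $S$, the edge $(e_0\setminus\{v_i\})\cup\mathrm{roots}(T)$, where $e_0$ is the edge of $S$ in which $v_i$ is a child. The roots are those of $S$ if $v_i$ is not a root, and $(\mathrm{roots}(S)\setminus\{v_i\})\cup\mathrm{roots}(T)$ otherwise. *)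

theory Defs
  imports
    Complex_Main
    "HOL-Library.Poly_Mapping"
    "HOL-Library.Multiset"
    "HOL-Library.FuncSet"
    "HOL-Library.Disjoint_Sets"
    "HOL-Combinatorics.Permutations"
begin

section \<open>Symmetric operads in vector spaces\<close>

text \<open>
  We use the partial composition presentation. All the spaces \<open>P(n)\<close> are subspaces of one
  vector space; the operations carry the arities of their arguments explicitly, and
  \<open>pcomp P m n i\<close> is the operation \<open>\<circ>\<^sub>i : P(m) \<times> P(n) \<rightarrow> P(m + n - 1)\<close>. The values of the operations
  outside of the spaces \<open>P(n)\<close> are irrelevant. The symmetric groups act on the right.
\<close>

record ('k, 'v) operad_data =
  scale :: "'k \<Rightarrow> 'v \<Rightarrow> 'v"
  ops :: "nat \<Rightarrow> 'v set"
  act :: "nat \<Rightarrow> (nat \<Rightarrow> nat) \<Rightarrow> 'v \<Rightarrow> 'v"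
  pcomp :: "nat \<Rightarrow> nat \<Rightarrow> nat \<Rightarrow> 'v \<Rightarrow> 'v \<Rightarrow> 'v"
  ident :: 'v

text \<open>
  In \<open>p \<circ>\<^sub>i q\<close>, with \<open>q\<close> of arity \<open>n\<close>, the input \<open>j \<noteq> i\<close> of \<open>p\<close> becomes the input
  \<open>outer_label i n j\<close>, and the input \<open>j\<close> of \<open>q\<close> becomes the input \<open>inner_label i j\<close>.
\<close>

definition outer_label :: "nat \<Rightarrow> nat \<Rightarrow> nat \<Rightarrow> nat" where
  "outer_label i n j = (if j \<le> i then j else j + n - 1)"

definition inner_label :: "nat \<Rightarrow> nat \<Rightarrow> nat" where
  "inner_label i j = i + j - 1"

text \<open>
  The permutation \<open>\<rho>\<close> in the equivariance axiom is determined by \<open>\<sigma>\<close> and \<open>\<tau>\<close>: it permutes the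
  blocks of inputs as \<open>\<sigma>\<close> does, the \<open>i\<close>-th block having size \<open>n\<close> and being permuted by \<open>\<tau>\<close>.
\<close>

locale operad =
  fixes P :: "('k::field, 'v::ab_group_add) operad_data"
  assumes vector_space: "vector_space (scale P)"
    and subspace_ops: "module.subspace (scale P) (ops P n)"
    and act_closed:
      "\<lbrakk>\<sigma> permutes {1..n}; p \<in> ops P n\<rbrakk> \<Longrightarrow> act P n \<sigma> p \<in> ops P n"
    and act_add:
      "\<lbrakk>\<sigma> permutes {1..n}; p \<in> ops P n; p' \<in> ops P n\<rbrakk>
        \<Longrightarrow> act P n \<sigma> (p + p') = act P n \<sigma> p + act P n \<sigma> p'"
    and act_scale:
      "\<lbrakk>\<sigma> permutes {1..n}; p \<in> ops P n\<rbrakk>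
        \<Longrightarrow> act P n \<sigma> (scale P a p) = scale P a (act P n \<sigma> p)"
    and act_id: "p \<in> ops P n \<Longrightarrow> act P n id p = p"
    and act_comp:
      "\<lbrakk>\<sigma> permutes {1..n}; \<tau> permutes {1..n}; p \<in> ops P n\<rbrakk>
        \<Longrightarrow> act P n (\<sigma> \<circ> \<tau>) p = act P n \<tau> (act P n \<sigma> p)"
    and pcomp_closed:
      "\<lbrakk>i \<in> {1..m}; p \<in> ops P m; q \<in> ops P n\<rbrakk> \<Longrightarrow> pcomp P m n i p q \<in> ops P (m + n - 1)"
    and pcomp_add_left:
      "\<lbrakk>i \<in> {1..m}; p \<in> ops P m; p' \<in> ops P m; q \<in> ops P n\<rbrakk>
        \<Longrightarrow> pcomp P m n i (p + p') q = pcomp P m n i p q + pcomp P m n i p' q"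
    and pcomp_add_right:
      "\<lbrakk>i \<in> {1..m}; p \<in> ops P m; q \<in> ops P n; q' \<in> ops P n\<rbrakk>
        \<Longrightarrow> pcomp P m n i p (q + q') = pcomp P m n i p q + pcomp P m n i p q'"
    and pcomp_scale_left:
      "\<lbrakk>i \<in> {1..m}; p \<in> ops P m; q \<in> ops P n\<rbrakk>
        \<Longrightarrow> pcomp P m n i (scale P a p) q = scale P a (pcomp P m n i p q)"
    and pcomp_scale_right:
      "\<lbrakk>i \<in> {1..m}; p \<in> ops P m; q \<in> ops P n\<rbrakk>
        \<Longrightarrow> pcomp P m n i p (scale P a q) = scale P a (pcomp P m n i p q)"
    and ident_closed: "ident P \<in> ops P 1"
    and ident_left: "p \<in> ops P n \<Longrightarrow> pcomp P 1 n 1 (ident P) p = p"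
    and ident_right: "\<lbrakk>i \<in> {1..n}; p \<in> ops P n\<rbrakk> \<Longrightarrow> pcomp P n 1 i p (ident P) = p"
    and sequential:
      "\<lbrakk>i \<in> {1..l}; j \<in> {1..m}; p \<in> ops P l; q \<in> ops P m; r \<in> ops P n\<rbrakk>
        \<Longrightarrow> pcomp P (l + m - 1) n (i - 1 + j) (pcomp P l m i p q) r
            = pcomp P l (m + n - 1) i p (pcomp P m n j q r)"
    and parallel:
      "\<lbrakk>i \<in> {1..l}; k \<in> {1..l}; i < k; p \<in> ops P l; q \<in> ops P m; r \<in> ops P n\<rbrakk>
        \<Longrightarrow> pcomp P (l + m - 1) n (k - 1 + m) (pcomp P l m i p q) r
            = pcomp P (l + n - 1) m i (pcomp P l n k p r) q"
    and equivariance: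
      "\<lbrakk>i \<in> {1..m}; p \<in> ops P m; q \<in> ops P n;
        \<sigma> permutes {1..m}; \<tau> permutes {1..n}; \<rho> permutes {1..m + n - 1};
        \<And>j. j \<in> {1..m} - {i} \<Longrightarrow> \<rho> (outer_label i n j) = outer_label (\<sigma> i) n (\<sigma> j);
        \<And>j. j \<in> {1..n} \<Longrightarrow> \<rho> (inner_label i j) = inner_label (\<sigma> i) (\<tau> j)\<rbrakk>
        \<Longrightarrow> pcomp P m n i (act P m \<sigma> p) (act P n \<tau> q)
            = act P (m + n - 1) \<rho> (pcomp P m n (\<sigma> i) p q)"

locale operad_hom = P: operad P + Q: operad Q
  for P :: "('k::field, 'v::ab_group_add) operad_data"
    and Q :: "('k, 'w::ab_group_add) operad_data" +
  fixes \<phi> :: "nat \<Rightarrow> 'v \<Rightarrow> 'w"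
  assumes hom_closed: "p \<in> ops P n \<Longrightarrow> \<phi> n p \<in> ops Q n"
    and hom_add: "\<lbrakk>p \<in> ops P n; p' \<in> ops P n\<rbrakk> \<Longrightarrow> \<phi> n (p + p') = \<phi> n p + \<phi> n p'"
    and hom_scale: "p \<in> ops P n \<Longrightarrow> \<phi> n (scale P a p) = scale Q a (\<phi> n p)"
    and hom_act:
      "\<lbrakk>\<sigma> permutes {1..n}; p \<in> ops P n\<rbrakk> \<Longrightarrow> \<phi> n (act P n \<sigma> p) = act Q n \<sigma> (\<phi> n p)"
    and hom_pcomp:
      "\<lbrakk>i \<in> {1..m}; p \<in> ops P m; q \<in> ops P n\<rbrakk>
        \<Longrightarrow> \<phi> (m + n - 1) (pcomp P m n i p q) = pcomp Q m n i (\<phi> m p) (\<phi> n q)"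
    and hom_ident: "\<phi> 1 (ident P) = ident Q"

locale operad_iso = operad_hom +
  assumes bij: "bij_betw (\<phi> n) (ops P n) (ops Q n)"

text \<open>The operadic ideal generated by a family \<open>R\<close> of sets \<open>R(n) \<subseteq> P(n)\<close>.\<close>

inductive operad_ideal ::
    "('k, 'v::ab_group_add) operad_data \<Rightarrow> (nat \<Rightarrow> 'v set) \<Rightarrow> nat \<Rightarrow> 'v \<Rightarrow> bool"
  for P :: "('k, 'v) operad_data" and R :: "nat \<Rightarrow> 'v set" where
  "p \<in> R n \<Longrightarrow> operad_ideal P R n p"
| "operad_ideal P R n 0"
| "\<lbrakk>operad_ideal P R n p; operad_ideal P R n q\<rbrakk> \<Longrightarrow> operad_ideal P R n (p + q)"
| "operad_ideal P R n p \<Longrightarrow> operad_ideal P R n (scale P a p)"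
| "\<lbrakk>operad_ideal P R n p; \<sigma> permutes {1..n}\<rbrakk> \<Longrightarrow> operad_ideal P R n (act P n \<sigma> p)"
| "\<lbrakk>operad_ideal P R m p; q \<in> ops P n; i \<in> {1..m}\<rbrakk>
    \<Longrightarrow> operad_ideal P R (m + n - 1) (pcomp P m n i p q)"
| "\<lbrakk>p \<in> ops P m; operad_ideal P R n q; i \<in> {1..m}\<rbrakk>
    \<Longrightarrow> operad_ideal P R (m + n - 1) (pcomp P m n i p q)"


section \<open>Linear extension of maps defined on a basis\<close>

definition pm_scale :: "'k::field \<Rightarrow> ('a \<Rightarrow>\<^sub>0 'k) \<Rightarrow> ('a \<Rightarrow>\<^sub>0 'k)" where
  "pm_scale c = Poly_Mapping.map ((*) c)"

definition lin_ext :: "('a \<Rightarrow> ('b \<Rightarrow>\<^sub>0 'k)) \<Rightarrow> ('a \<Rightarrow>\<^sub>0 'k) \<Rightarrow> ('b \<Rightarrow>\<^sub>0 'k::field)" where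
  "lin_ext h u = (\<Sum>s\<in>Poly_Mapping.keys u. pm_scale (Poly_Mapping.lookup u s) (h s))"

definition bilin_ext ::
    "('a \<Rightarrow> 'b \<Rightarrow> ('c \<Rightarrow>\<^sub>0 'k)) \<Rightarrow> ('a \<Rightarrow>\<^sub>0 'k) \<Rightarrow> ('b \<Rightarrow>\<^sub>0 'k) \<Rightarrow> ('c \<Rightarrow>\<^sub>0 'k::field)" where
  "bilin_ext h u v = (\<Sum>s\<in>Poly_Mapping.keys u. \<Sum>t\<in>Poly_Mapping.keys v.
    pm_scale (Poly_Mapping.lookup u s * Poly_Mapping.lookup v t) (h s t))"

lemma lookup_pm_scale: "Poly_Mapping.lookup (pm_scale c u) s = c * Poly_Mapping.lookup u s"
  unfolding pm_scale_def by transfer (simp add: when_def)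

lemma vector_space_pm_scale: "vector_space (pm_scale :: 'k::field \<Rightarrow> ('a \<Rightarrow>\<^sub>0 'k) \<Rightarrow> _)"
  by unfold_locales
    (rule poly_mapping_eqI; simp add: lookup_pm_scale lookup_add algebra_simps)+


section \<open>The free operad on the generators x, y and c\<close>

datatype gen = Gen_x | Gen_y | Gen_c

text \<open>The action of \<open>(1 2)\<close> on the generators.\<close>

fun gen_swap :: "gen \<Rightarrow> gen" where
  "gen_swap Gen_x = Gen_y"
| "gen_swap Gen_y = Gen_x"
| "gen_swap Gen_c = Gen_c"

datatype 'a monomial = Input 'a | App gen "'a monomial" "'a monomial"

primrec inputs :: "'a monomial \<Rightarrow> 'a multiset" where
  "inputs (Input a) = {#a#}"
| "inputs (App g s t) = inputs s + inputs t"

primrec substitute :: "'a \<Rightarrow> 'a monomial \<Rightarrow> 'a monomial \<Rightarrow> 'a monomial" where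
  "substitute i (Input a) u = (if a = i then u else Input a)"
| "substitute i (App g s t) u = App g (substitute i s u) (substitute i t u)"

text \<open>
  Since \<open>g.(1 2)\<close> is the operation \<open>(a, b) \<mapsto> g(b, a)\<close>, the monomials \<open>g(s, t)\<close> and
  \<open>(g.(1 2))(t, s)\<close> are identified. As the set of generators is stable under \<open>(1 2)\<close>, the
  resulting classes are a basis of the free operad.
\<close>

inductive sym_equiv :: "'a monomial \<Rightarrow> 'a monomial \<Rightarrow> bool" where
  sym_equiv_refl: "sym_equiv s s"
| sym_equiv_sym: "sym_equiv s t \<Longrightarrow> sym_equiv t s"
| sym_equiv_trans: "sym_equiv s t \<Longrightarrow> sym_equiv t u \<Longrightarrow> sym_equiv s u"
| sym_equiv_App: "sym_equiv s s' \<Longrightarrow> sym_equiv t t' \<Longrightarrow> sym_equiv (App g s t) (App g s' t')"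
| sym_equiv_swap: "sym_equiv (App g s t) (App (gen_swap g) t s)"

quotient_type 'a tree = "'a monomial" / sym_equiv
  by (intro equivpI reflpI sympI transpI) (blast intro: sym_equiv.intros)+

lift_definition tree_inputs :: "'a tree \<Rightarrow> 'a multiset" is inputs
  subgoal for s t by (induction rule: sym_equiv.induct) auto
  done

lift_definition tree_relabel :: "('a \<Rightarrow> 'b) \<Rightarrow> 'a tree \<Rightarrow> 'b tree" is map_monomial
  subgoal for f s t by (induction rule: sym_equiv.induct) (auto intro: sym_equiv.intros)
  done

lemma sym_equiv_substitute_right: "sym_equiv u v \<Longrightarrow> sym_equiv (substitute i s u) (substitute i s v)"
  by (induction s) (auto intro: sym_equiv.intros)

lemma sym_equiv_substitute_left: "sym_equiv s t \<Longrightarrow> sym_equiv (substitute i s u) (substitute i t u)"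
  by (induction rule: sym_equiv.induct) (auto intro: sym_equiv.intros)

lift_definition tree_substitute :: "'a \<Rightarrow> 'a tree \<Rightarrow> 'a tree \<Rightarrow> 'a tree" is substitute
  by (blast intro: sym_equiv_trans sym_equiv_substitute_left sym_equiv_substitute_right)

lift_definition tree_input :: "'a \<Rightarrow> 'a tree" is Input .

lift_definition tree_app :: "gen \<Rightarrow> 'a tree \<Rightarrow> 'a tree \<Rightarrow> 'a tree" is App
  by (rule sym_equiv_App)

definition trees :: "nat \<Rightarrow> nat tree set" where
  "trees n = {t. tree_inputs t = mset_set {1..n}}"

text \<open>
  The right action is \<open>(p.\<sigma>)(a\<^sub>1, \<dots>, a\<^sub>n) = p(a\<^bsub>\<sigma>\<^sup>-\<^sup>1(1)\<^esub>, \<dots>, a\<^bsub>\<sigma>\<^sup>-\<^sup>1(n)\<^esub>)\<close>: it replaces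
  the label \<open>j\<close> of an input by \<open>\<sigma>\<^sup>-\<^sup>1(j)\<close>.
\<close>

definition free_operad :: "('k::field, nat tree \<Rightarrow>\<^sub>0 'k) operad_data" where
  "free_operad =
    \<lparr>scale = pm_scale,
     ops = (\<lambda>n. {u. Poly_Mapping.keys u \<subseteq> trees n}),
     act = (\<lambda>n \<sigma>. lin_ext (\<lambda>t. Poly_Mapping.single (tree_relabel (inv \<sigma>) t) 1)),
     pcomp = (\<lambda>m n i. bilin_ext (\<lambda>s t. Poly_Mapping.single
       (tree_substitute i (tree_relabel (outer_label i n) s) (tree_relabel (inner_label i) t)) 1)),
     ident = Poly_Mapping.single (tree_input 1) 1\<rparr>"

definition gen_op :: "gen \<Rightarrow> (nat tree \<Rightarrow>\<^sub>0 'k::field)" where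
  "gen_op g = Poly_Mapping.single (tree_app g (tree_input 1) (tree_input 2)) 1"


section \<open>The operad ComPreLie\<close>

definition comprelie_rels :: "nat \<Rightarrow> (nat tree \<Rightarrow>\<^sub>0 'k::field) set" where
  "comprelie_rels n =
    (let F = free_operad; x = gen_op Gen_x; c = gen_op Gen_c;
         xx = pcomp F 2 2 1 x x - pcomp F 2 2 2 x x
     in if n = 3 then
       {xx - act F 3 (transpose 2 3) xx,
        pcomp F 2 2 1 x c - act F 3 (transpose 2 3) (pcomp F 2 2 1 c x) - pcomp F 2 2 2 c x,
        pcomp F 2 2 1 c c - pcomp F 2 2 2 c c}
     else {})"

text \<open>
  The direct sum of the spaces of the ideal. As it is graded by the arity, \<open>T(n)/I(n)\<close> is
  identified with the image of \<open>T(n)\<close> in the quotient by this direct sum.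
\<close>

definition comprelie_ideal :: "(nat tree \<Rightarrow>\<^sub>0 'k::field) set" where
  "comprelie_ideal =
    module.span pm_scale (\<Union>n. {u. operad_ideal free_operad comprelie_rels n u})"

definition comprelie_cong :: "(nat tree \<Rightarrow>\<^sub>0 'k::field) \<Rightarrow> (nat tree \<Rightarrow>\<^sub>0 'k) \<Rightarrow> bool" where
  "comprelie_cong u v \<longleftrightarrow> u - v \<in> comprelie_ideal"

global_interpretation pm: vector_space "pm_scale :: 'k::field \<Rightarrow> ('a \<Rightarrow>\<^sub>0 'k) \<Rightarrow> ('a \<Rightarrow>\<^sub>0 'k)"
  by (rule vector_space_pm_scale)

lemma subspace_comprelie_ideal: "pm.subspace comprelie_ideal"
  unfolding comprelie_ideal_def by (rule pm.subspace_span)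

lemma equivp_comprelie_cong: "equivp comprelie_cong"
proof (intro equivpI reflpI sympI transpI)
  note sub = subspace_comprelie_ideal
  show "comprelie_cong u u" for u :: "nat tree \<Rightarrow>\<^sub>0 'k::field"
    using pm.subspace_0[OF sub] by (simp add: comprelie_cong_def)
  show "comprelie_cong v u" if "comprelie_cong u v" for u v :: "nat tree \<Rightarrow>\<^sub>0 'k::field"
    using pm.subspace_neg[OF sub, of "u - v"] that by (simp add: comprelie_cong_def)
  show "comprelie_cong u w" if "comprelie_cong u v" "comprelie_cong v w"
    for u v w :: "nat tree \<Rightarrow>\<^sub>0 'k::field"
    using pm.subspace_add[OF sub, of "u - v" "v - w"] that by (simp add: comprelie_cong_def)
qed

quotient_type (overloaded) 'k comprelie = "nat tree \<Rightarrow>\<^sub>0 'k::field" / comprelie_cong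
  morphisms rep_comprelie comprelie_class
  by (rule equivp_comprelie_cong)

instantiation comprelie :: (field) ab_group_add
begin

lift_definition zero_comprelie :: "'a comprelie" is 0 .

lift_definition plus_comprelie :: "'a comprelie \<Rightarrow> 'a comprelie \<Rightarrow> 'a comprelie" is "(+)"
proof -
  fix u u' v v' :: "nat tree \<Rightarrow>\<^sub>0 'a"
  assume "comprelie_cong u u'" "comprelie_cong v v'"
  then show "comprelie_cong (u + v) (u' + v')"
    using pm.subspace_add[OF subspace_comprelie_ideal, of "u - u'" "v - v'"]
    by (simp add: comprelie_cong_def algebra_simps)
qed

lift_definition uminus_comprelie :: "'a comprelie \<Rightarrow> 'a comprelie" is uminus
proof -
  fix u u' :: "nat tree \<Rightarrow>\<^sub>0 'a"
  assume "comprelie_cong u u'"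
  then show "comprelie_cong (- u) (- u')"
    using pm.subspace_neg[OF subspace_comprelie_ideal, of "u - u'"]
    by (simp add: comprelie_cong_def algebra_simps)
qed

lift_definition minus_comprelie :: "'a comprelie \<Rightarrow> 'a comprelie \<Rightarrow> 'a comprelie" is "(-)"
proof -
  fix u u' v v' :: "nat tree \<Rightarrow>\<^sub>0 'a"
  assume "comprelie_cong u u'" "comprelie_cong v v'"
  then show "comprelie_cong (u - v) (u' - v')"
    using pm.subspace_diff[OF subspace_comprelie_ideal, of "u - u'" "v - v'"]
    by (simp add: comprelie_cong_def algebra_simps)
qed

instance
proof
  fix a b c :: "'a comprelie"
  have refl: "comprelie_cong u u" for u :: "nat tree \<Rightarrow>\<^sub>0 'a"
    using equivp_comprelie_cong by (rule equivp_reflp)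
  show "a + b + c = a + (b + c)" by transfer (simp add: add.assoc refl)
  show "a + b = b + a" by transfer (simp add: add.commute refl)
  show "0 + a = a" by transfer (simp add: refl)
  show "- a + a = 0" by transfer (simp add: refl)
  show "a - b = a + - b" by transfer (simp add: refl)
qed

end

lift_definition comprelie_scale :: "'k::field \<Rightarrow> 'k comprelie \<Rightarrow> 'k comprelie" is pm_scale
proof -
  fix c :: 'k and u u' :: "nat tree \<Rightarrow>\<^sub>0 'k"
  assume "comprelie_cong u u'"
  then show "comprelie_cong (pm_scale c u) (pm_scale c u')"
    using pm.subspace_scale[OF subspace_comprelie_ideal, of "u - u'" c]
    by (simp add: comprelie_cong_def pm.scale_right_diff_distrib)
qed

text \<open>
  Representatives are taken in the given arity; the operations of the quotient do not depend on
  them.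
\<close>

definition comprelie_rep :: "nat \<Rightarrow> 'k::field comprelie \<Rightarrow> (nat tree \<Rightarrow>\<^sub>0 'k)" where
  "comprelie_rep n a = (SOME u. u \<in> ops free_operad n \<and> comprelie_class u = a)"

definition ComPreLie :: "('k::field, 'k comprelie) operad_data" where
  "ComPreLie =
    \<lparr>scale = comprelie_scale,
     ops = (\<lambda>n. comprelie_class ` ops free_operad n),
     act = (\<lambda>n \<sigma> a. comprelie_class (act free_operad n \<sigma> (comprelie_rep n a))),
     pcomp = (\<lambda>m n i a b.
       comprelie_class (pcomp free_operad m n i (comprelie_rep m a) (comprelie_rep n b))),
     ident = comprelie_class (ident free_operad)\<rparr>"

definition comprelie_x :: "'k::field comprelie" where
  "comprelie_x = comprelie_class (gen_op Gen_x)"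

definition comprelie_c :: "'k::field comprelie" where
  "comprelie_c = comprelie_class (gen_op Gen_c)"


section \<open>Forests of rooted hypertrees\<close>

record 'a rooted_hypergraph =
  verts :: "'a set"
  edges :: "'a set set"
  roots :: "'a set"

definition hypergraph :: "'a set \<Rightarrow> 'a set set \<Rightarrow> bool" where
  "hypergraph V E \<longleftrightarrow> finite V \<and> (\<forall>e\<in>E. e \<subseteq> V \<and> card e \<ge> 2)"

definition adjacency :: "'a set set \<Rightarrow> 'a rel" where
  "adjacency E = {(u, v). \<exists>e\<in>E. u \<in> e \<and> v \<in> e}"

definition hyper_connected :: "'a set \<Rightarrow> 'a set set \<Rightarrow> bool" where
  "hyper_connected V E \<longleftrightarrow> (\<forall>u\<in>V. \<forall>v\<in>V. (u, v) \<in> (adjacency E)\<^sup>*)"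

definition hyper_cycle :: "'a set \<Rightarrow> 'a set set \<Rightarrow> 'a list \<Rightarrow> 'a set list \<Rightarrow> bool" where
  "hyper_cycle V E vs es \<longleftrightarrow>
    length vs \<ge> 2 \<and> length es = length vs \<and>
    set vs \<subseteq> V \<and> set es \<subseteq> E \<and> distinct vs \<and> distinct es \<and>
    (\<forall>i < length vs. vs ! i \<in> es ! (Suc i mod length vs) \<and>
      vs ! (Suc i mod length vs) \<in> es ! (Suc i mod length vs))"

definition rooted_hypertree :: "'a rooted_hypergraph \<Rightarrow> bool" where
  "rooted_hypertree H \<longleftrightarrow>
    hypergraph (verts H) (edges H) \<and> verts H \<noteq> {} \<and>
    hyper_connected (verts H) (edges H) \<and>
    (\<nexists>vs es. hyper_cycle (verts H) (edges H) vs es) \<and>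
    (\<exists>r\<in>verts H. roots H = {r})"

text \<open>
  A forest is encoded by the union of its hypertrees, which are recovered as the connected
  components; a forest labeled by \<open>L\<close> has \<open>L\<close> itself as vertex set.
\<close>

definition forests :: "'a set \<Rightarrow> 'a rooted_hypergraph set" where
  "forests L =
    {S. verts S = L \<and>
      (\<exists>F. finite F \<and> F \<noteq> {} \<and> (\<forall>H\<in>F. rooted_hypertree H) \<and> disjoint_family_on verts F \<and>
        S = \<lparr>verts = \<Union>(verts ` F), edges = \<Union>(edges ` F), roots = \<Union>(roots ` F)\<rparr>)}"

text \<open>In a forest, the distance to the root of the hypertree containing the vertex.\<close>

definition root_dist :: "'a rooted_hypergraph \<Rightarrow> 'a \<Rightarrow> nat" where
  "root_dist S v = (LEAST n. \<exists>r\<in>roots S. (r, v) \<in> adjacency (edges S) ^^ n)"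

definition parent_of :: "'a rooted_hypergraph \<Rightarrow> 'a \<Rightarrow> 'a set \<Rightarrow> bool" where
  "parent_of S v e \<longleftrightarrow>
    e \<in> edges S \<and> v \<in> e \<and> (\<forall>w\<in>e - {v}. root_dist S v < root_dist S w)"

definition child_via :: "'a rooted_hypergraph \<Rightarrow> 'a \<Rightarrow> 'a set \<Rightarrow> bool" where
  "child_via S v e \<longleftrightarrow> v \<in> e \<and> (\<exists>u. u \<noteq> v \<and> parent_of S u e)"

definition incoming :: "'a rooted_hypergraph \<Rightarrow> 'a \<Rightarrow> 'a set set" where
  "incoming S v = {e. parent_of S v e}"

text \<open>
  The label \<open>i\<close> of the vertex of \<open>S\<close> which is removed is allowed to occur among the labels of \<open>T\<close>.
\<close>

definition insert_along ::
    "'a \<Rightarrow> 'a rooted_hypergraph \<Rightarrow> ('a set \<Rightarrow> 'a) \<Rightarrow> 'a rooted_hypergraph \<Rightarrow> 'a rooted_hypergraph" where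
  "insert_along i S f T =
    \<lparr>verts = (verts S - {i}) \<union> verts T,
     edges = edges T \<union> {e \<in> edges S. i \<notin> e} \<union> {(e - {i}) \<union> {f e} |e. e \<in> incoming S i} \<union>
       (if i \<in> roots S then {} else {(e - {i}) \<union> roots T |e. child_via S i e}),
     roots = (if i \<in> roots S then (roots S - {i}) \<union> roots T else roots S)\<rparr>"

definition insertion ::
    "'a \<Rightarrow> 'a rooted_hypergraph \<Rightarrow> 'a rooted_hypergraph \<Rightarrow> ('a rooted_hypergraph \<Rightarrow>\<^sub>0 'k::field)" where
  "insertion i S T =
    (\<Sum>f \<in> incoming S i \<rightarrow>\<^sub>E verts T. Poly_Mapping.single (insert_along i S f T) 1)"

definition forest_relabel :: "('a \<Rightarrow> 'b) \<Rightarrow> 'a rooted_hypergraph \<Rightarrow> 'b rooted_hypergraph" where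
  "forest_relabel f S =
    \<lparr>verts = f ` verts S, edges = (`) f ` edges S, roots = f ` roots S\<rparr>"

definition FH_space :: "'a set \<Rightarrow> ('a rooted_hypergraph \<Rightarrow>\<^sub>0 'k::field) set" where
  "FH_space L = {u. Poly_Mapping.keys u \<subseteq> forests L}"

definition FH :: "('k::field, nat rooted_hypergraph \<Rightarrow>\<^sub>0 'k) operad_data" where
  "FH =
    \<lparr>scale = pm_scale,
     ops = (\<lambda>n. FH_space {1..n}),
     act = (\<lambda>n \<sigma>. lin_ext (\<lambda>S. Poly_Mapping.single (forest_relabel (inv \<sigma>) S) 1)),
     pcomp = (\<lambda>m n i. bilin_ext (\<lambda>S T.
       insertion i (forest_relabel (outer_label i n) S) (forest_relabel (inner_label i) T))),
     ident = Poly_Mapping.single \<lparr>verts = {1}, edges = {}, roots = {1}\<rparr> 1\<rparr>"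

definition FH_x2 :: "nat rooted_hypergraph \<Rightarrow>\<^sub>0 'k::field" where
  "FH_x2 = Poly_Mapping.single \<lparr>verts = {1, 2}, edges = {{1, 2}}, roots = {1}\<rparr> 1"

definition FH_c2 :: "nat rooted_hypergraph \<Rightarrow>\<^sub>0 'k::field" where
  "FH_c2 = Poly_Mapping.single \<lparr>verts = {1, 2}, edges = {}, roots = {1, 2}\<rparr> 1"

end

(*
  Every operation of the free operad on x, y, c is evaluated on forests: c becomes the disjoint
  union, and x becomes the sum over all vertices v of S of the forests obtained from S and T by
  adding an edge with parent v whose children are the roots of T. Insertion at a vertex commutes
  with both operations, so this is a morphism of operads; it kills the relations of ComPreLie, and it
  is onto by induction on the size of a forest and on the number of edges at its root.

  For injectivity, the symmetric braces of a pre-Lie algebra attach a family of elements to one root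
  independently of the order. Hence a forest has a value in every ComPreLie algebra, and the Leibniz
  rule makes the value turn disjoint unions and the sums above into the two products. In the algebra
  of all trees modulo the relations this recovers the class of a tree from its image. As the
  relations are homogeneous, the kernel in arity n is the operadic ideal. Finally FH and ComPreLie
  are images of the free operad with the same kernel, from which they inherit the operad axioms.

  Since cycles are excluded, a forest is encoded by its arcs (p, B): the parent vertex of an edge and
  the set of its children.
*)
theory Submission
  imports Defs
begin

section \<open>Linear and bilinear extension\<close>

text \<open>Surjectivity comes from solving for one summand of a graft, but injectivity has no such
  direct route: the free operad modulo the relations comes without a normal form, and a tree is sent
  to a sum of many forests. The way out is a map back from forests that is defined without reference
  to trees. A vertex is given the brace of its label with one argument per edge, the argument being
  the product of the values of the children. The sum over all places where t can be attached then
  splits: attaching at the vertex adds an argument to the brace, attaching below an edge changes the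
  argument of this edge, and these two kinds of terms are what the recursion of the brace relates.
  Values must be multiplied without regard to labels, so they are taken in a quotient of all trees,
  with repeated labels allowed. Only afterwards is it cut down to trees with labels 1, ..., n, and
  there each instance of a relation has to be rebuilt from the three generating ones by
  compositions. For this, substitution along arbitrary label sets is compared with the numbered
  partial compositions.\<close>

abbreviation basis :: "'a \<Rightarrow> ('a \<Rightarrow>\<^sub>0 'k::field)" where
  "basis x \<equiv> Poly_Mapping.single x 1"

text \<open>The keys of a sum or a multiple may shrink by cancellation; over a common finite
  superset of keys the sums can be compared term by term.\<close>

lemma lin_ext_superset:
  assumes "finite S" "Poly_Mapping.keys u \<subseteq> S"
  shows "lin_ext h u = (\<Sum>s\<in>S. pm_scale (Poly_Mapping.lookup u s) (h s))"
  unfolding lin_ext_def using assms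
  by (intro sum.mono_neutral_left) (auto simp: in_keys_iff)

lemma lin_ext_0 [simp]: "lin_ext h 0 = 0"
  by (simp add: lin_ext_def)

lemma lin_ext_add: "lin_ext h (u + v) = lin_ext h u + lin_ext h v"
proof -
  let ?S = "Poly_Mapping.keys u \<union> Poly_Mapping.keys v"
  have fin: "finite ?S" by simp
  have "lin_ext h (u + v) = (\<Sum>s\<in>?S. pm_scale (Poly_Mapping.lookup (u + v) s) (h s))"
    by (rule lin_ext_superset[OF fin]) (rule Poly_Mapping.keys_add)
  also have "\<dots> = (\<Sum>s\<in>?S. pm_scale (Poly_Mapping.lookup u s) (h s)) +
      (\<Sum>s\<in>?S. pm_scale (Poly_Mapping.lookup v s) (h s))"
    by (simp add: lookup_add pm.scale_left_distrib sum.distrib)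
  also have "\<dots> = lin_ext h u + lin_ext h v"
    by (simp add: lin_ext_superset[OF fin])
  finally show ?thesis .
qed

lemma keys_pm_scale: "Poly_Mapping.keys (pm_scale a u) \<subseteq> Poly_Mapping.keys u"
  by (auto simp: in_keys_iff lookup_pm_scale)

lemma lin_ext_scale: "lin_ext h (pm_scale a u) = pm_scale a (lin_ext h u)"
proof -
  have "lin_ext h (pm_scale a u) =
      (\<Sum>s\<in>Poly_Mapping.keys u. pm_scale (Poly_Mapping.lookup (pm_scale a u) s) (h s))"
    by (rule lin_ext_superset) (simp_all add: keys_pm_scale)
  then show ?thesis
    by (simp add: lookup_pm_scale lin_ext_def pm.scale_sum_right)
qed

lemma lin_ext_minus: "lin_ext h (- u) = - lin_ext h u"
  using lin_ext_add[of h u "- u"] by (simp add: eq_neg_iff_add_eq_0 add.commute)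

lemma lin_ext_diff: "lin_ext h (u - v) = lin_ext h u - lin_ext h v"
  using lin_ext_add[of h u "- v"] by (simp add: lin_ext_minus)

lemma lin_ext_sum: "lin_ext h (\<Sum>x\<in>X. f x) = (\<Sum>x\<in>X. lin_ext h (f x))"
  by (induction X rule: infinite_finite_induct) (simp_all add: lin_ext_add)

lemma lin_ext_single [simp]: "lin_ext h (Poly_Mapping.single s a) = pm_scale a (h s)"
  by (subst lin_ext_superset[of "{s}"]) auto

lemma lin_ext_cong:
  "(\<And>s. s \<in> Poly_Mapping.keys u \<Longrightarrow> h s = h' s) \<Longrightarrow> lin_ext h u = lin_ext h' u"
  by (simp add: lin_ext_def)

lemma lin_ext_singles [simp]: "lin_ext (\<lambda>s. basis s) u = u"
proof -
  have "Poly_Mapping.lookup (lin_ext (\<lambda>s. basis s) u) k = Poly_Mapping.lookup u k" for k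
    by (simp add: lin_ext_def lookup_sum lookup_pm_scale lookup_single when_def in_keys_iff
        if_distrib sum.delta cong: if_cong)
  then show ?thesis by (rule poly_mapping_eqI)
qed

lemma lin_ext_lin_ext: "lin_ext h (lin_ext g u) = lin_ext (\<lambda>s. lin_ext h (g s)) u"
  unfolding lin_ext_def[of g] lin_ext_sum lin_ext_scale
  by (simp add: lin_ext_def[of _ u])

lemma lin_ext_fun_add: "lin_ext (\<lambda>s. f s + g s) u = lin_ext f u + lin_ext g u"
  by (simp add: lin_ext_def pm.scale_right_distrib sum.distrib)

lemma lin_ext_fun_diff: "lin_ext (\<lambda>s. f s - g s) u = lin_ext f u - lin_ext g u"
  by (simp add: lin_ext_def pm.scale_right_diff_distrib sum_subtractf)

lemma bilin_ext_left: "bilin_ext h u v = lin_ext (\<lambda>s. lin_ext (h s) v) u"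
  by (simp add: bilin_ext_def lin_ext_def pm.scale_sum_right)

lemma bilin_ext_right: "bilin_ext h u v = lin_ext (\<lambda>t. lin_ext (\<lambda>s. h s t) u) v"
  unfolding bilin_ext_def by (subst sum.swap) (simp add: lin_ext_def pm.scale_sum_right mult.commute)

text \<open>Fubini for linear extensions. Multilinear identities are brought into the form of nested
  \<open>lin_ext\<close> with the same order of variables, after which \<open>lin_ext_cong\<close>
  leaves an identity between basis elements.\<close>

lemma lin_ext_swap:
  "lin_ext (\<lambda>s. lin_ext (h s) v) u = lin_ext (\<lambda>t. lin_ext (\<lambda>s. h s t) u) v"
  by (metis bilin_ext_left bilin_ext_right)

lemma bilin_ext_add_left: "bilin_ext h (u + u') v = bilin_ext h u v + bilin_ext h u' v"
  by (simp add: bilin_ext_left lin_ext_add)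

lemma bilin_ext_add_right: "bilin_ext h u (v + v') = bilin_ext h u v + bilin_ext h u v'"
  by (simp add: bilin_ext_right lin_ext_add)

lemma bilin_ext_diff_left: "bilin_ext h (u - u') v = bilin_ext h u v - bilin_ext h u' v"
  by (simp add: bilin_ext_left lin_ext_diff)

lemma bilin_ext_diff_right: "bilin_ext h u (v - v') = bilin_ext h u v - bilin_ext h u v'"
  by (simp add: bilin_ext_right lin_ext_diff)

lemma bilin_ext_scale_left: "bilin_ext h (pm_scale a u) v = pm_scale a (bilin_ext h u v)"
  by (simp add: bilin_ext_left lin_ext_scale)

lemma bilin_ext_scale_right: "bilin_ext h u (pm_scale a v) = pm_scale a (bilin_ext h u v)"
  by (simp add: bilin_ext_right lin_ext_scale)

lemma bilin_ext_0_left [simp]: "bilin_ext h 0 v = 0"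
  by (simp add: bilin_ext_left)

lemma bilin_ext_0_right [simp]: "bilin_ext h u 0 = 0"
  by (simp add: bilin_ext_right)

lemma bilin_ext_single_left: "bilin_ext h (basis s) v = lin_ext (h s) v"
  by (simp add: bilin_ext_left)

lemma bilin_ext_single_right: "bilin_ext h u (basis t) = lin_ext (\<lambda>s. h s t) u"
  by (simp add: bilin_ext_right)

lemma bilin_ext_lin_ext_left:
  "bilin_ext h (lin_ext g u) v = lin_ext (\<lambda>s. bilin_ext h (g s) v) u"
  by (simp add: bilin_ext_left lin_ext_lin_ext)

lemma bilin_ext_lin_ext_right:
  "bilin_ext h u (lin_ext g v) = lin_ext (\<lambda>t. bilin_ext h u (g t)) v"
  by (simp add: bilin_ext_right lin_ext_lin_ext)

lemma bilin_ext_flip: "bilin_ext h u v = bilin_ext (\<lambda>t s. h s t) v u"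
  by (metis bilin_ext_left bilin_ext_right)

section \<open>Subspaces spanned by a part of the basis\<close>

definition supported :: "'a set \<Rightarrow> ('a \<Rightarrow>\<^sub>0 'k::field) set" where
  "supported B = {u. Poly_Mapping.keys u \<subseteq> B}"

lemma subspace_supported: "pm.subspace (supported B)"
  unfolding pm.subspace_def supported_def
  by (auto dest!: subsetD[OF Poly_Mapping.keys_add] subsetD[OF keys_pm_scale])

lemma supported_single [simp]:
  "Poly_Mapping.single s (1 :: 'k::field) \<in> supported B \<longleftrightarrow> s \<in> B"
  by (simp add: supported_def)

lemma subspace_lin_ext:
  assumes "pm.subspace U" "\<And>s. s \<in> Poly_Mapping.keys u \<Longrightarrow> h s \<in> U"
  shows "lin_ext h u \<in> U"
  unfolding lin_ext_def
  by (intro pm.subspace_sum[OF assms(1)] pm.subspace_scale[OF assms(1)] assms(2))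

lemma supported_lin_ext:
  assumes "u \<in> supported B" "\<And>s. s \<in> B \<Longrightarrow> h s \<in> supported C"
  shows "lin_ext h u \<in> supported C"
  using assms by (intro subspace_lin_ext subspace_supported) (auto simp: supported_def)

lemma supported_bilin_ext:
  assumes "u \<in> supported A" "v \<in> supported B"
    "\<And>s t. s \<in> A \<Longrightarrow> t \<in> B \<Longrightarrow> h s t \<in> supported C"
  shows "bilin_ext h u v \<in> supported C"
  unfolding bilin_ext_left using assms by (intro supported_lin_ext) auto

lemma supported_in_subspace:
  assumes "pm.subspace U" "u \<in> supported B" "\<And>s. s \<in> B \<Longrightarrow> basis s \<in> U"
  shows "u \<in> U"
  using subspace_lin_ext[OF assms(1), of u "\<lambda>s. basis s"] assms(2,3)
  by (auto simp: supported_def)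

section \<open>Images of operads\<close>

text \<open>Every axiom equates expressions in elements of Q, which lift along the surjections
  \<pi>, so it is the image of the axiom in P. In particular no axiom has to be checked on forests
  or on chosen representatives of classes.\<close>

lemma operad_image:
  fixes P :: "('k::field, 'v::ab_group_add) operad_data"
    and Q :: "('k, 'w::ab_group_add) operad_data"
  assumes "operad P" and vsQ: "vector_space (scale Q)"
    and surj: "\<And>n. \<pi> n ` ops P n = ops Q n"
    and add: "\<And>n p p'. p \<in> ops P n \<Longrightarrow> p' \<in> ops P n \<Longrightarrow> \<pi> n (p + p') = \<pi> n p + \<pi> n p'"
    and scl: "\<And>n p a. p \<in> ops P n \<Longrightarrow> \<pi> n (scale P a p) = scale Q a (\<pi> n p)"
    and act: "\<And>n \<sigma> p. \<sigma> permutes {1..n} \<Longrightarrow> p \<in> ops P n \<Longrightarrow> act Q n \<sigma> (\<pi> n p) = \<pi> n (act P n \<sigma> p)"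
    and pcomp: "\<And>m n i p q. i \<in> {1..m} \<Longrightarrow> p \<in> ops P m \<Longrightarrow> q \<in> ops P n \<Longrightarrow>
      pcomp Q m n i (\<pi> m p) (\<pi> n q) = \<pi> (m + n - 1) (pcomp P m n i p q)"
    and ident: "\<pi> 1 (ident P) = ident Q"
  shows "operad_hom P Q \<pi>"
proof -
  interpret P: operad P by fact
  interpret VP: vector_space "scale P" by (rule P.vector_space)
  interpret VQ: vector_space "scale Q" by fact
  have scl_closed: "scale P a p \<in> ops P n" if "p \<in> ops P n" for a p n
    using VP.subspace_scale[OF P.subspace_ops] that .
  have add_closed: "p + p' \<in> ops P n" if "p \<in> ops P n" "p' \<in> ops P n" for p p' n
    using VP.subspace_add[OF P.subspace_ops] that .
  have zero: "\<pi> n 0 = 0" "0 \<in> ops P n" for n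
    using add[OF VP.subspace_0[OF P.subspace_ops] VP.subspace_0[OF P.subspace_ops]]
    by (auto simp: VP.subspace_0[OF P.subspace_ops])
  note closed = P.act_closed P.pcomp_closed scl_closed add_closed P.ident_closed
  have im: "\<pi> n p \<in> ops Q n" if "p \<in> ops P n" for n p using surj that by blast
  have lift: "\<exists>p'\<in>ops P n. p = \<pi> n p'" if "p \<in> ops Q n" for p n using surj that by blast
  have sub: "VQ.subspace (ops Q n)" for n
    unfolding VQ.subspace_def surj[symmetric]
    by (safe; (simp add: add[symmetric] scl[symmetric])?)
      (metis zero image_eqI, blast intro: closed, blast intro: closed)
  have Q: "operad Q"
  proof
    fix n \<sigma> p assume "\<sigma> permutes {1..n}" "p \<in> ops Q n"
    then show "act Q n \<sigma> p \<in> ops Q n" by (auto dest!: lift simp: act closed im)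
  next
    fix n \<sigma> p p' assume "\<sigma> permutes {1..n}" "p \<in> ops Q n" "p' \<in> ops Q n"
    then show "act Q n \<sigma> (p + p') = act Q n \<sigma> p + act Q n \<sigma> p'"
      by (auto dest!: lift simp: act closed im add[symmetric] P.act_add)
  next
    fix n \<sigma> p a assume "\<sigma> permutes {1..n}" "p \<in> ops Q n"
    then show "act Q n \<sigma> (scale Q a p) = scale Q a (act Q n \<sigma> p)"
      by (auto dest!: lift simp: act closed im scl[symmetric] P.act_scale)
  next
    fix n p assume "p \<in> ops Q n"
    then show "act Q n id p = p"
      by (auto dest!: lift simp: act[OF permutes_id] P.act_id)
  next
    fix n \<sigma> \<tau> p assume "\<sigma> permutes {1..n}" "\<tau> permutes {1..n}" "p \<in> ops Q n"
    then show "act Q n (\<sigma> \<circ> \<tau>) p = act Q n \<tau> (act Q n \<sigma> p)"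
      by (auto dest!: lift simp: act closed permutes_compose P.act_comp)
  next
    fix i m n p q assume "i \<in> {1..m}" "p \<in> ops Q m" "q \<in> ops Q n"
    then show "pcomp Q m n i p q \<in> ops Q (m + n - 1)"
      by (auto dest!: lift simp del: atLeastAtMost_iff One_nat_def simp: pcomp closed im)
  next
    fix i m n p p' q assume "i \<in> {1..m}" "p \<in> ops Q m" "p' \<in> ops Q m" "q \<in> ops Q n"
    then show "pcomp Q m n i (p + p') q = pcomp Q m n i p q + pcomp Q m n i p' q"
      by (auto dest!: lift simp del: atLeastAtMost_iff One_nat_def
          simp: pcomp closed im add[symmetric] P.pcomp_add_left)
  next
    fix i m n p q q' assume "i \<in> {1..m}" "p \<in> ops Q m" "q \<in> ops Q n" "q' \<in> ops Q n"
    then show "pcomp Q m n i p (q + q') = pcomp Q m n i p q + pcomp Q m n i p q'"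
      by (auto dest!: lift simp del: atLeastAtMost_iff One_nat_def
          simp: pcomp closed im add[symmetric] P.pcomp_add_right)
  next
    fix i m n p q a assume "i \<in> {1..m}" "p \<in> ops Q m" "q \<in> ops Q n"
    then show "pcomp Q m n i (scale Q a p) q = scale Q a (pcomp Q m n i p q)"
      by (auto dest!: lift simp del: atLeastAtMost_iff One_nat_def
          simp: pcomp closed im scl[symmetric] P.pcomp_scale_left)
  next
    fix i m n p q a assume "i \<in> {1..m}" "p \<in> ops Q m" "q \<in> ops Q n"
    then show "pcomp Q m n i p (scale Q a q) = scale Q a (pcomp Q m n i p q)"
      by (auto dest!: lift simp del: atLeastAtMost_iff One_nat_def
          simp: pcomp closed im scl[symmetric] P.pcomp_scale_right)
  next
    show "ident Q \<in> ops Q 1" using im[OF P.ident_closed] unfolding ident .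
  next
    fix n p assume "p \<in> ops Q n"
    then obtain p' where p: "p' \<in> ops P n" "p = \<pi> n p'" by (auto dest!: lift)
    show "pcomp Q 1 n 1 (ident Q) p = p"
      using pcomp[of 1 1 "ident P" p' n] p by (simp add: ident[symmetric] P.ident_closed[simplified] P.ident_left[simplified])
  next
    fix i n p assume i: "i \<in> {1..n}" "p \<in> ops Q n"
    then obtain p' where p: "p' \<in> ops P n" "p = \<pi> n p'" by (auto dest!: lift)
    show "pcomp Q n 1 i p (ident Q) = p"
      using pcomp[OF i(1) p(1) P.ident_closed] p(2) P.ident_right[OF i(1) p(1)]
      by (simp add: ident[symmetric])
  next
    fix i l j m n p q r
    assume *: "i \<in> {1..l}" "j \<in> {1..m}" "p \<in> ops Q l" "q \<in> ops Q m" "r \<in> ops Q n"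
    then obtain p' q' r' where p: "p' \<in> ops P l" "p = \<pi> l p'" "q' \<in> ops P m" "q = \<pi> m q'"
      "r' \<in> ops P n" "r = \<pi> n r'" by (meson lift)
    have i: "i - 1 + j \<in> {1..l + m - 1}" using * by auto
    \<comment> \<open>Subtraction is truncated; the two arities agree because i and j force l and m
      to be positive.\<close>
    have e: "l + m - 1 + n - 1 = l + (m + n - 1) - 1" using * by auto
    show "pcomp Q (l + m - 1) n (i - 1 + j) (pcomp Q l m i p q) r
            = pcomp Q l (m + n - 1) i p (pcomp Q m n j q r)"
      by (simp only: p(2,4,6) pcomp[OF *(1) p(1,3)] pcomp[OF *(2) p(3,5)]
          pcomp[OF i P.pcomp_closed[OF *(1) p(1,3)] p(5)]
          pcomp[OF *(1) p(1) P.pcomp_closed[OF *(2) p(3,5)]] P.sequential[OF *(1,2) p(1,3,5)] e)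
  next
    fix i l k m n p q r
    assume *: "i \<in> {1..l}" "k \<in> {1..l}" "i < k" "p \<in> ops Q l" "q \<in> ops Q m" "r \<in> ops Q n"
    then obtain p' q' r' where p: "p' \<in> ops P l" "p = \<pi> l p'" "q' \<in> ops P m" "q = \<pi> m q'"
      "r' \<in> ops P n" "r = \<pi> n r'" by (meson lift)
    have i: "k - 1 + m \<in> {1..l + m - 1}" "i \<in> {1..l + n - 1}" using * by auto
    have e: "l + m - 1 + n - 1 = l + n - 1 + m - 1" using * by auto
    show "pcomp Q (l + m - 1) n (k - 1 + m) (pcomp Q l m i p q) r
            = pcomp Q (l + n - 1) m i (pcomp Q l n k p r) q"
      by (simp only: p(2,4,6) pcomp[OF *(1) p(1,3)] pcomp[OF *(2) p(1,5)]
          pcomp[OF i(1) P.pcomp_closed[OF *(1) p(1,3)] p(5)]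
          pcomp[OF i(2) P.pcomp_closed[OF *(2) p(1,5)] p(3)] P.parallel[OF *(1-3) p(1,3,5)] e)
  next
    fix i m n p q \<sigma> \<tau> \<rho>
    assume *: "i \<in> {1..m}" "p \<in> ops Q m" "q \<in> ops Q n"
        "\<sigma> permutes {1..m}" "\<tau> permutes {1..n}" "\<rho> permutes {1..m + n - 1}"
      and \<rho>: "\<And>j. j \<in> {1..m} - {i} \<Longrightarrow> \<rho> (outer_label i n j) = outer_label (\<sigma> i) n (\<sigma> j)"
        "\<And>j. j \<in> {1..n} \<Longrightarrow> \<rho> (inner_label i j) = inner_label (\<sigma> i) (\<tau> j)"
    then obtain p' q' where p: "p' \<in> ops P m" "p = \<pi> m p'" "q' \<in> ops P n" "q = \<pi> n q'"
      by (meson lift)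
    have i: "\<sigma> i \<in> {1..m}" using *(1,4) permutes_in_image by metis
    show "pcomp Q m n i (act Q m \<sigma> p) (act Q n \<tau> q)
            = act Q (m + n - 1) \<rho> (pcomp Q m n (\<sigma> i) p q)"
      using * i p P.equivariance[OF *(1) p(1,3) *(4-6) \<rho>]
      by (simp del: atLeastAtMost_iff One_nat_def add: pcomp act closed)
  qed (use sub vsQ in auto)
  show ?thesis
    by (intro operad_hom.intro operad_hom_axioms.intro \<open>operad P\<close> Q)
      (auto simp del: atLeastAtMost_iff One_nat_def simp: im add scl act pcomp ident[simplified])
qed

text \<open>Both operads are quotients of P by the same ideal. The isomorphism sends \<pi> p to
  \<rho> p; it is well defined and injective because differences of operations with the same image
  lie in the common kernel.\<close>

lemma operad_iso_of_same_kernel: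
  fixes P :: "('k::field, 'v::ab_group_add) operad_data"
    and Q :: "('k, 'w::ab_group_add) operad_data"
    and R :: "('k, 'x::ab_group_add) operad_data"
  assumes "operad_hom P Q \<pi>" "operad_hom P R \<rho>"
    and surj: "\<And>n. \<pi> n ` ops P n = ops Q n" "\<And>n. \<rho> n ` ops P n = ops R n"
    and kernel: "\<And>n p. p \<in> ops P n \<Longrightarrow> \<pi> n p = 0 \<longleftrightarrow> \<rho> n p = 0"
  shows "\<exists>\<phi>. operad_iso Q R \<phi> \<and> (\<forall>n. \<forall>p\<in>ops P n. \<phi> n (\<pi> n p) = \<rho> n p)"
proof -
  interpret Q: operad_hom P Q \<pi> by fact
  interpret R: operad_hom P R \<rho> by fact
  interpret VP: vector_space "scale P" by (rule Q.P.vector_space)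
  have diff: "p - q \<in> ops P n" "\<pi> n (p - q) = \<pi> n p - \<pi> n q" "\<rho> n (p - q) = \<rho> n p - \<rho> n q"
    if "p \<in> ops P n" "q \<in> ops P n" for n p q
  proof -
    show *: "p - q \<in> ops P n" using VP.subspace_diff[OF Q.P.subspace_ops] that .
    show "\<pi> n (p - q) = \<pi> n p - \<pi> n q" "\<rho> n (p - q) = \<rho> n p - \<rho> n q"
      using Q.hom_add[OF * that(2)] R.hom_add[OF * that(2)] by (auto simp: algebra_simps)
  qed
  have same: "\<pi> n p = \<pi> n q \<longleftrightarrow> \<rho> n p = \<rho> n q" if "p \<in> ops P n" "q \<in> ops P n" for n p q
    using kernel[OF diff(1)[OF that]] diff(2,3)[OF that] by simp
  \<comment> \<open>A preimage under \<pi> is chosen; by \<open>same\<close> the value does not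
    depend on the choice.\<close>
  define \<phi> where "\<phi> n a = \<rho> n (SOME p. p \<in> ops P n \<and> \<pi> n p = a)" for n a
  have \<phi>: "\<phi> n (\<pi> n p) = \<rho> n p" if "p \<in> ops P n" for n p
  proof -
    have "(SOME q. q \<in> ops P n \<and> \<pi> n q = \<pi> n p) \<in> ops P n \<and>
        \<pi> n (SOME q. q \<in> ops P n \<and> \<pi> n q = \<pi> n p) = \<pi> n p"
      by (rule someI[of _ p]) (simp add: that)
    then show ?thesis using same that unfolding \<phi>_def by metis
  qed
  have lift: "\<exists>p'\<in>ops P n. p = \<pi> n p'" if "p \<in> ops Q n" for p n using surj that by blast
  note closed = Q.P.act_closed Q.P.pcomp_closed VP.subspace_scale[OF Q.P.subspace_ops]
    VP.subspace_add[OF Q.P.subspace_ops] Q.P.ident_closed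
  have "operad_hom Q R \<phi>"
  proof (intro operad_hom.intro operad_hom_axioms.intro Q.Q.operad_axioms R.Q.operad_axioms)
    fix p n assume "p \<in> ops Q n"
    then show "\<phi> n p \<in> ops R n" by (auto dest!: lift simp: \<phi> R.hom_closed)
  next
    fix p n p' assume "p \<in> ops Q n" "p' \<in> ops Q n"
    then show "\<phi> n (p + p') = \<phi> n p + \<phi> n p'"
      by (auto dest!: lift simp: \<phi> closed Q.hom_add[symmetric] R.hom_add)
  next
    fix p n a assume "p \<in> ops Q n"
    then show "\<phi> n (scale Q a p) = scale R a (\<phi> n p)"
      by (auto dest!: lift simp: \<phi> closed Q.hom_scale[symmetric] R.hom_scale)
  next
    fix p n \<sigma> assume "\<sigma> permutes {1..n}" "p \<in> ops Q n"
    then show "\<phi> n (act Q n \<sigma> p) = act R n \<sigma> (\<phi> n p)"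
      by (auto dest!: lift simp: \<phi> closed Q.hom_act[symmetric] R.hom_act)
  next
    fix i m n p q assume "i \<in> {1..m}" "p \<in> ops Q m" "q \<in> ops Q n"
    then show "\<phi> (m + n - 1) (pcomp Q m n i p q) = pcomp R m n i (\<phi> m p) (\<phi> n q)"
      by (auto dest!: lift simp del: atLeastAtMost_iff One_nat_def
          simp: \<phi> closed Q.hom_pcomp[symmetric] R.hom_pcomp)
  next
    show "\<phi> 1 (ident Q) = ident R"
      using \<phi>[OF Q.P.ident_closed] by (simp only: Q.hom_ident R.hom_ident)
  qed
  moreover have "bij_betw (\<phi> n) (ops Q n) (ops R n)" for n
    unfolding bij_betw_def inj_on_def
  proof (intro conjI ballI impI)
    fix p q assume "p \<in> ops Q n" "q \<in> ops Q n" "\<phi> n p = \<phi> n q"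
    then show "p = q" by (auto dest!: lift simp: \<phi> same)
  next
    show "\<phi> n ` ops Q n = ops R n"
      unfolding surj(1)[symmetric] surj(2)[symmetric] image_image by (simp add: \<phi>)
  qed
  ultimately have "operad_iso Q R \<phi>"
    by (intro operad_iso.intro operad_iso_axioms.intro)
  then show ?thesis using \<phi> by blast
qed

section \<open>Grafting of trees\<close>

text \<open>Substitution at all inputs at once. Relabelling and substitution at a single input are
  instances, so the associativity of this bind replaces separate inductions for the identities
  between them.\<close>

primrec monomial_bind :: "'a monomial \<Rightarrow> ('a \<Rightarrow> 'b monomial) \<Rightarrow> 'b monomial" where
  "monomial_bind (Input a) f = f a"
| "monomial_bind (App g s t) f = App g (monomial_bind s f) (monomial_bind t f)"

lift_definition tree_bind :: "'a tree \<Rightarrow> ('a \<Rightarrow> 'b tree) \<Rightarrow> 'b tree" is monomial_bind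
proof -
  fix s s' :: "'a monomial" and f f' :: "'a \<Rightarrow> 'b monomial"
  assume s: "sym_equiv s s'" and f: "\<And>a. sym_equiv (f a) (f' a)"
  have "sym_equiv (monomial_bind s f) (monomial_bind s f')"
    by (induction s) (auto intro: sym_equiv.intros f)
  moreover have "sym_equiv (monomial_bind s f') (monomial_bind s' f')"
    using s by (induction rule: sym_equiv.induct) (auto intro: sym_equiv.intros)
  ultimately show "sym_equiv (monomial_bind s f) (monomial_bind s' f')"
    by (rule sym_equiv_trans)
qed

lemma tree_induct [case_names input app]:
  assumes "\<And>a. P (tree_input a)" "\<And>g s t. P s \<Longrightarrow> P t \<Longrightarrow> P (tree_app g s t)"
  shows "P t"
proof -
  have "P (abs_tree m)" for m
    by (induction m) (use assms in \<open>auto simp: tree_input.abs_eq[symmetric] tree_app.abs_eq[symmetric]\<close>)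
  then show ?thesis by (metis Quotient3_abs_rep Quotient3_tree)
qed

lemma tree_bind_input [simp]: "tree_bind (tree_input a) f = f a"
  by transfer (simp add: sym_equiv_refl)

lemma tree_bind_app [simp]: "tree_bind (tree_app g s t) f = tree_app g (tree_bind s f) (tree_bind t f)"
  by transfer (simp add: sym_equiv_refl)

lemma tree_relabel_input [simp]: "tree_relabel f (tree_input a) = tree_input (f a)"
  by transfer (simp add: sym_equiv_refl)

lemma tree_relabel_app [simp]:
  "tree_relabel f (tree_app g s t) = tree_app g (tree_relabel f s) (tree_relabel f t)"
  by transfer (simp add: sym_equiv_refl)

lemma tree_substitute_input [simp]:
  "tree_substitute i (tree_input a) u = (if a = i then u else tree_input a)"
  by transfer (simp add: sym_equiv_refl)

lemma tree_substitute_app [simp]: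
  "tree_substitute i (tree_app g s t) u = tree_app g (tree_substitute i s u) (tree_substitute i t u)"
  by transfer (simp add: sym_equiv_refl)

lemma tree_inputs_input [simp]: "tree_inputs (tree_input a) = {#a#}"
  by transfer simp

lemma tree_inputs_app [simp]: "tree_inputs (tree_app g s t) = tree_inputs s + tree_inputs t"
  by transfer simp

lemma tree_app_swap: "tree_app g s t = tree_app (gen_swap g) t s"
  by transfer (rule sym_equiv_swap)

lemma tree_relabel_bind: "tree_relabel f t = tree_bind t (\<lambda>a. tree_input (f a))"
  by (induction t rule: tree_induct) auto

lemma tree_substitute_bind: "tree_substitute i s u = tree_bind s (\<lambda>a. if a = i then u else tree_input a)"
  by (induction s rule: tree_induct) auto

lemma tree_bind_bind: "tree_bind (tree_bind s f) g = tree_bind s (\<lambda>a. tree_bind (f a) g)"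
  by (induction s rule: tree_induct) auto

lemma tree_bind_cong:
  "(\<And>a. a \<in># tree_inputs s \<Longrightarrow> f a = g a) \<Longrightarrow> tree_bind s f = tree_bind s g"
  by (induction s rule: tree_induct) auto

lemma tree_bind_tree_input [simp]: "tree_bind s tree_input = s"
  by (induction s rule: tree_induct) auto

lemma tree_inputs_bind:
  "tree_inputs (tree_bind s f) = (\<Sum>a\<in>#tree_inputs s. tree_inputs (f a))"
  by (induction s rule: tree_induct) auto

lemma tree_inputs_relabel: "tree_inputs (tree_relabel f t) = image_mset f (tree_inputs t)"
  by (induction t rule: tree_induct) auto

lemma tree_inputs_nonempty: "tree_inputs t \<noteq> {#}"
  by (induction t rule: tree_induct) auto

text \<open>The free operad on a label set A instead of {1..n}. The subtrees of a tree are of this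
  kind as well, which permits induction on trees.\<close>

definition linear_trees :: "'a set \<Rightarrow> 'a tree set" where
  "linear_trees A = {t. tree_inputs t = mset_set A}"

lemma trees_linear_trees: "trees n = linear_trees {1..n}"
  by (simp add: trees_def linear_trees_def)

lemma linear_trees_nonempty: "t \<in> linear_trees A \<Longrightarrow> A \<noteq> {}"
  using tree_inputs_nonempty[of t] by (auto simp: linear_trees_def)

lemma linear_trees_relabel:
  "t \<in> linear_trees A \<Longrightarrow> inj_on f A \<Longrightarrow> tree_relabel f t \<in> linear_trees (f ` A)"
  by (simp add: linear_trees_def tree_inputs_relabel image_mset_mset_set)

lemma linear_trees_relabel_bij:
  "t \<in> linear_trees A \<Longrightarrow> bij_betw f A B \<Longrightarrow> tree_relabel f t \<in> linear_trees B"
  using linear_trees_relabel by (metis bij_betw_def)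

text \<open>A sum of multisets without repetitions has summands without repetitions and without
  common elements. For a product with distinct labels this yields the label sets of its
  factors.\<close>

lemma mset_set_unionD:
  assumes "M + N = mset_set A" "finite A"
  shows "M = mset_set (set_mset M)" "N = mset_set (set_mset N)"
    "A = set_mset M \<union> set_mset N" "set_mset M \<inter> set_mset N = {}"
proof -
  have count: "count M x + count N x \<le> 1" for x
    using arg_cong[OF assms(1), of "\<lambda>M. count M x"] by (auto simp: count_mset_set')
  have "M = mset_set (set_mset M)" if "\<And>x. count M x \<le> 1" for M :: "'a multiset"
  proof (rule multiset_eqI)
    show "count M x = count (mset_set (set_mset M)) x" for x
      using that[of x] by (cases "x \<in># M") (auto simp: count_mset_set' not_in_iff count_greater_zero_iff[symmetric]
          simp del: count_greater_zero_iff)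
  qed
  then show "M = mset_set (set_mset M)" "N = mset_set (set_mset N)"
    using count by (meson add_leD1 add_leD2)+
  show "A = set_mset M \<union> set_mset N"
    using assms by (metis finite_set_mset_mset_set set_mset_union)
  show "set_mset M \<inter> set_mset N = {}"
  proof (intro equals0I)
    fix x assume "x \<in> set_mset M \<inter> set_mset N"
    then have "count M x \<ge> 1" "count N x \<ge> 1" by auto
    then show False using count[of x] by linarith
  qed
qed

lemma linear_trees_appD:
  assumes "tree_app g s t \<in> linear_trees A" "finite A"
  obtains B C where "s \<in> linear_trees B" "t \<in> linear_trees C" "A = B \<union> C" "B \<inter> C = {}"
proof
  have "tree_inputs s + tree_inputs t = mset_set A" using assms(1) by (simp add: linear_trees_def)
  note eq = mset_set_unionD[OF this assms(2)]
  show "s \<in> linear_trees (set_mset (tree_inputs s))" "t \<in> linear_trees (set_mset (tree_inputs t))"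
    using eq(1,2) by (auto simp: linear_trees_def)
  show "A = set_mset (tree_inputs s) \<union> set_mset (tree_inputs t)"
    "set_mset (tree_inputs s) \<inter> set_mset (tree_inputs t) = {}" using eq(3,4) by auto
qed

lemma linear_trees_inputD:
  assumes "tree_input a \<in> linear_trees A" "finite A"
  shows "A = {a}"
proof -
  have "{#a#} = mset_set A" using assms(1) by (simp add: linear_trees_def)
  from arg_cong[OF this, of set_mset] show ?thesis using assms(2) by simp
qed

lemma linear_trees_app:
  "\<lbrakk>s \<in> linear_trees B; t \<in> linear_trees C; B \<inter> C = {}; finite B; finite C\<rbrakk>
    \<Longrightarrow> tree_app g s t \<in> linear_trees (B \<union> C)"
  by (simp add: linear_trees_def mset_set_Union)

lemma linear_trees_substitute:
  assumes "s \<in> linear_trees A" "t \<in> linear_trees B" "finite A" "finite B" "i \<in> A" "(A - {i}) \<inter> B = {}"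
  shows "tree_substitute i s t \<in> linear_trees ((A - {i}) \<union> B)"
proof -
  have "tree_inputs (tree_substitute i s t) =
      (\<Sum>a\<in>A. tree_inputs (if a = i then t else tree_input a))"
    using assms(1) by (simp add: tree_substitute_bind tree_inputs_bind linear_trees_def sum_unfold_sum_mset)
  also have "\<dots> = tree_inputs t + (\<Sum>a\<in>A - {i}. {#a#})"
    using assms by (subst sum.remove[of _ i]) (auto intro!: sum.cong)
  also have "(\<Sum>a\<in>A - {i}. {#a#}) = mset_set (A - {i})"
    by (simp add: sum_unfold_sum_mset)
  finally show ?thesis
    using assms by (simp add: linear_trees_def mset_set_Union ac_simps)
qed

section \<open>The free operad\<close>

text \<open>With n = 0 the input i + 1 would land on i as well. Trees have at least one input, so
  composites of trees avoid this collision.\<close>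

lemma outer_label_eq_iff: "n \<ge> 1 \<Longrightarrow> outer_label i n j = i \<longleftrightarrow> j = i"
  by (auto simp: outer_label_def)

lemma bij_betw_outer_label:
  assumes "i \<in> {1..m}" "n \<ge> 1"
  shows "bij_betw (outer_label i n) ({1..m} - {i}) ({1..m + n - 1} - {i..i + n - 1})"
proof (rule bij_betw_byWitness[where f' = "\<lambda>j. if j \<le> i then j else j + 1 - n"])
qed (use assms in \<open>auto simp: outer_label_def\<close>)

lemma bij_betw_inner_label:
  assumes "i \<ge> 1" "n \<ge> 1"
  shows "bij_betw (inner_label i) {1..n} {i..i + n - 1}"
  by (rule bij_betw_byWitness[where f' = "\<lambda>j. j + 1 - i"]) (use assms in \<open>auto simp: inner_label_def\<close>)

definition relabel :: "('a \<Rightarrow> 'b) \<Rightarrow> ('a tree \<Rightarrow>\<^sub>0 'k) \<Rightarrow> ('b tree \<Rightarrow>\<^sub>0 'k::field)" where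
  "relabel f = lin_ext (\<lambda>t. basis (tree_relabel f t))"

definition subst_at :: "'a \<Rightarrow> ('a tree \<Rightarrow>\<^sub>0 'k) \<Rightarrow> ('a tree \<Rightarrow>\<^sub>0 'k) \<Rightarrow> ('a tree \<Rightarrow>\<^sub>0 'k::field)" where
  "subst_at i = bilin_ext (\<lambda>s t. basis (tree_substitute i s t))"

abbreviation (input) tree_pcomp :: "nat \<Rightarrow> nat \<Rightarrow> nat tree \<Rightarrow> nat tree \<Rightarrow> nat tree" where
  "tree_pcomp n i s t \<equiv>
    tree_substitute i (tree_relabel (outer_label i n) s) (tree_relabel (inner_label i) t)"

text \<open>In this normal form an identity between composites of trees becomes, input by input, an
  identity between label functions, which is arithmetic on natural numbers.\<close>

lemma tree_pcomp_bind:
  "tree_pcomp n i s t = tree_bind s (\<lambda>a. if outer_label i n a = i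
     then tree_bind t (\<lambda>b. tree_input (inner_label i b)) else tree_input (outer_label i n a))"
  by (simp add: tree_substitute_bind tree_relabel_bind tree_bind_bind)

lemma trees_nonempty: "t \<in> trees n \<Longrightarrow> n \<ge> 1"
  using linear_trees_nonempty by (fastforce simp: trees_linear_trees)

lemma in_trees_inputs: "t \<in> trees n \<Longrightarrow> a \<in># tree_inputs t \<longleftrightarrow> a \<in> {1..n}"
  by (simp add: trees_def)

lemma tree_pcomp_closed:
  assumes "i \<in> {1..m}" "s \<in> trees m" "t \<in> trees n"
  shows "tree_pcomp n i s t \<in> trees (m + n - 1)"
proof -
  have n: "n \<ge> 1" using assms(3) by (rule trees_nonempty)
  have o: "outer_label i n ` ({1..m} - {i}) = {1..m + n - 1} - {i..i + n - 1}"
    using bij_betw_outer_label[OF assms(1) n] by (simp add: bij_betw_def)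
  have i: "outer_label i n i = i" using outer_label_eq_iff[OF n] by simp
  have "outer_label i n ` {1..m} = insert i (outer_label i n ` ({1..m} - {i}))"
    using assms(1) i by (metis image_insert insert_Diff)
  then have *: "outer_label i n ` {1..m} - {i} = {1..m + n - 1} - {i..i + n - 1}"
    using n unfolding o by auto
  have inj: "inj_on (outer_label i n) {1..m}" using n by (auto simp: inj_on_def outer_label_def)
  have s: "tree_relabel (outer_label i n) s \<in> linear_trees (outer_label i n ` {1..m})"
    using assms(2) inj by (simp add: trees_linear_trees linear_trees_relabel)
  have t: "tree_relabel (inner_label i) t \<in> linear_trees {i..i + n - 1}"
    using assms(1,3) n bij_betw_inner_label[of i n]
    by (auto simp: trees_linear_trees intro: linear_trees_relabel_bij)
  have "tree_pcomp n i s t \<in> linear_trees ((outer_label i n ` {1..m} - {i}) \<union> {i..i + n - 1})"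
  proof (rule linear_trees_substitute[OF s t])
    show "i \<in> outer_label i n ` {1..m}" using assms(1) i by (metis image_eqI)
    show "(outer_label i n ` {1..m} - {i}) \<inter> {i..i + n - 1} = {}" unfolding * by auto
  qed simp_all
  also have "(outer_label i n ` {1..m} - {i}) \<union> {i..i + n - 1} = {1..m + n - 1}"
    unfolding * using assms(1) n by auto
  finally show ?thesis by (simp add: trees_linear_trees)
qed

text \<open>Both sides are binds of s. The inputs of s other than i, the inputs of t other than j
  and those of u are renumbered in the same way on both sides.\<close>

lemma tree_pcomp_sequential:
  assumes "i \<in> {1..l}" "j \<in> {1..m}" "s \<in> trees l" "t \<in> trees m" "u \<in> trees n"
  shows "tree_pcomp n (i - 1 + j) (tree_pcomp m i s t) u =
    tree_pcomp (m + n - 1) i s (tree_pcomp n j t u)"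
proof -
  have mn: "m \<ge> 1" "n \<ge> 1" using assms trees_nonempty by auto
  have inner: "outer_label (i - 1 + j) n (inner_label i b) = (i - 1 + j) \<longleftrightarrow> b = j"
    "outer_label j n b = j \<longleftrightarrow> b = j"
    "b \<noteq> j \<Longrightarrow> outer_label (i - 1 + j) n (inner_label i b) = inner_label i (outer_label j n b)"
    "inner_label (i - 1 + j) c = inner_label i (inner_label j c)"
    if "b \<in> {1..m}" for b c
    using that assms(1,2) mn by (auto simp: outer_label_def inner_label_def)
  have outer: "outer_label (i - 1 + j) n (outer_label i m a) \<noteq> (i - 1 + j)"
    "outer_label (i - 1 + j) n (outer_label i m a) = outer_label i (m + n - 1) a"
    "outer_label i (m + n - 1) a \<noteq> (i - 1 + j)"
    if "a \<noteq> i" for a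
    using that assms(1,2) mn by (auto simp: outer_label_def)
  have i: "outer_label i m a = i \<longleftrightarrow> a = i" "outer_label i (m + n - 1) a = i \<longleftrightarrow> a = i" for a
    using mn by (auto intro!: outer_label_eq_iff simp del: One_nat_def)
  show ?thesis
    unfolding tree_pcomp_bind tree_bind_bind
    by (intro tree_bind_cong)
      (auto simp: i inner outer in_trees_inputs[OF assms(4)] tree_bind_bind
        simp del: One_nat_def atLeastAtMost_iff intro!: tree_bind_cong)
qed

lemma tree_pcomp_parallel:
  assumes "i \<in> {1..l}" "k \<in> {1..l}" "i < k" "s \<in> trees l" "t \<in> trees m" "u \<in> trees n"
  shows "tree_pcomp n (k - 1 + m) (tree_pcomp m i s t) u =
    tree_pcomp m i (tree_pcomp n k s u) t"
proof -
  have mn: "m \<ge> 1" "n \<ge> 1" using assms trees_nonempty by auto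
  \<comment> \<open>The position of the input k of s once t with its m inputs has been put at
    i.\<close>
  obtain K where K: "K = k - 1 + m" by blast
  have i: "inner_label i b \<noteq> K"
    "outer_label (K) n (inner_label i b) = inner_label i b" if "b \<in> {1..m}" for b
    using that assms(1-3) mn K by (auto simp: outer_label_def inner_label_def)
  have k: "inner_label K c \<noteq> i"
    "outer_label i m (inner_label k c) = inner_label K c" if "c \<in> {1..n}" for c
    using that assms(1-3) mn K by (auto simp: outer_label_def inner_label_def)
  have ik: "outer_label i m a = i \<longleftrightarrow> a = i" "outer_label k n a = k \<longleftrightarrow> a = k"
    "outer_label k n i = i" "outer_label (K) n (outer_label i m k) = K" "i \<noteq> k" for a
    using assms(1-3) mn K by (auto simp: outer_label_def)
  have other: "outer_label (K) n (outer_label i m a) \<noteq> K"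
    "outer_label i m (outer_label k n a) \<noteq> i"
    "outer_label (K) n (outer_label i m a) = outer_label i m (outer_label k n a)"
    if "a \<noteq> i" "a \<noteq> k" for a
    using that assms(1-3) mn K by (auto simp: outer_label_def)
  have fixed: "outer_label i m i = i" "outer_label k n k = k" "outer_label i m k = K" "outer_label K n K = K"
    using assms(1-3) mn K by (auto simp: outer_label_def)
  show ?thesis
    unfolding tree_pcomp_bind tree_bind_bind K[symmetric]
  proof (rule tree_bind_cong)
    fix a
    consider "a = i" | "a = k" | "a \<noteq> i" "a \<noteq> k" by blast
    then show "tree_bind
          (if outer_label i m a = i then tree_bind t (\<lambda>b. tree_input (inner_label i b))
           else tree_input (outer_label i m a))
          (\<lambda>a. if outer_label K n a = K then tree_bind u (\<lambda>b. tree_input (inner_label K b))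
            else tree_input (outer_label K n a)) =
        tree_bind
          (if outer_label k n a = k then tree_bind u (\<lambda>b. tree_input (inner_label k b))
           else tree_input (outer_label k n a))
          (\<lambda>a. if outer_label i m a = i then tree_bind t (\<lambda>b. tree_input (inner_label i b))
            else tree_input (outer_label i m a))"
    proof cases
      case 1
      then show ?thesis using ik(5)
        by (auto simp: fixed ik(3) i tree_bind_bind in_trees_inputs[OF assms(5)]
          simp del: atLeastAtMost_iff intro!: tree_bind_cong)
    next
      case 2
      then show ?thesis using ik(1)[of k] ik(5)
        by (auto simp: fixed k tree_bind_bind in_trees_inputs[OF assms(6)]
          simp del: atLeastAtMost_iff intro!: tree_bind_cong)
    next
      case 3
      then show ?thesis using other by (simp add: ik(1,2))
    qed
  qed
qed

lemma tree_pcomp_equivariance: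
  assumes "i \<in> {1..m}" "s \<in> trees m" "t \<in> trees n"
    and perm: "\<sigma> permutes {1..m}" "\<tau> permutes {1..n}" "\<rho> permutes {1..m + n - 1}"
    and outer: "\<And>j. j \<in> {1..m} - {i} \<Longrightarrow> \<rho> (outer_label i n j) = outer_label (\<sigma> i) n (\<sigma> j)"
    and inner: "\<And>j. j \<in> {1..n} \<Longrightarrow> \<rho> (inner_label i j) = inner_label (\<sigma> i) (\<tau> j)"
  shows "tree_pcomp n i (tree_relabel (inv \<sigma>) s) (tree_relabel (inv \<tau>) t) =
    tree_relabel (inv \<rho>) (tree_pcomp n (\<sigma> i) s t)"
proof -
  have n: "n \<ge> 1" using assms(3) trees_nonempty by auto
  have \<sigma>: "inv \<sigma> a = i \<longleftrightarrow> a = \<sigma> i" for a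
    using perm(1) by (metis permutes_inverses)
  have o: "inv \<rho> (outer_label (\<sigma> i) n a) = outer_label i n (inv \<sigma> a)"
    if "a \<in> {1..m}" "a \<noteq> \<sigma> i" for a
  proof -
    have "inv \<sigma> a \<in> {1..m} - {i}"
      using that perm(1) \<sigma> by (metis Diff_iff permutes_in_image permutes_inv singletonD)
    from outer[OF this] show ?thesis using perm by (metis permutes_inverses)
  qed
  have inn: "inv \<rho> (inner_label (\<sigma> i) a) = inner_label i (inv \<tau> a)" if "a \<in> {1..n}" for a
  proof -
    have "inv \<tau> a \<in> {1..n}" using that perm(2) by (metis permutes_in_image permutes_inv)
    from inner[OF this] show ?thesis using perm by (metis permutes_inverses)
  qed
  show ?thesis
    unfolding tree_pcomp_bind unfolding tree_relabel_bind tree_bind_bind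
    by (rule tree_bind_cong)
      (use o inn in \<open>auto simp: outer_label_eq_iff[OF n] \<sigma> tree_bind_bind
        in_trees_inputs[OF assms(2)] in_trees_inputs[OF assms(3)]
        simp del: One_nat_def atLeastAtMost_iff intro!: tree_bind_cong\<close>)
qed

lemma free_operad_simps:
  "scale free_operad = pm_scale"
  "ops free_operad n = supported (trees n)"
  "act free_operad n \<sigma> = relabel (inv \<sigma>)"
  "pcomp free_operad m n i = bilin_ext (\<lambda>s t. basis (tree_pcomp n i s t))"
  "ident free_operad = basis (tree_input 1)"
  by (simp_all add: free_operad_def supported_def relabel_def)

lemma relabel_comp: "relabel f (relabel g u) = relabel (f \<circ> g) u"
  by (simp add: relabel_def lin_ext_lin_ext tree_relabel_bind tree_bind_bind)

lemma relabel_cong: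
  assumes "u \<in> supported (linear_trees A)" "finite A" "\<And>a. a \<in> A \<Longrightarrow> f a = g a"
  shows "relabel f u = relabel g u"
  unfolding relabel_def tree_relabel_bind
  by (intro lin_ext_cong arg_cong[of _ _ "\<lambda>t. basis t"] tree_bind_cong)
    (use assms in \<open>auto simp: supported_def linear_trees_def\<close>)

lemma relabel_id: "relabel (\<lambda>a. a) u = u"
  by (simp add: relabel_def tree_relabel_bind)

lemma relabel_supported:
  assumes "u \<in> supported (linear_trees A)" "bij_betw f A B"
  shows "relabel f u \<in> supported (linear_trees B)"
  unfolding relabel_def
  by (rule supported_lin_ext[OF assms(1)]) (simp add: linear_trees_relabel_bij[OF _ assms(2)])

lemma operad_free_operad: "operad (free_operad :: ('k::field, nat tree \<Rightarrow>\<^sub>0 'k) operad_data)"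
proof (unfold_locales; (unfold free_operad_simps)?)
  fix n \<sigma> and p :: "nat tree \<Rightarrow>\<^sub>0 'k"
  assume "\<sigma> permutes {1..n}" "p \<in> supported (trees n)"
  then show "relabel (inv \<sigma>) p \<in> supported (trees n)"
    unfolding trees_linear_trees
    by (intro relabel_supported[of _ "{1..n}"]) (auto intro: permutes_imp_bij permutes_inv)
next
  fix n and \<sigma> \<tau> :: "nat \<Rightarrow> nat" and p :: "nat tree \<Rightarrow>\<^sub>0 'k"
  assume "\<sigma> permutes {1..n}" "\<tau> permutes {1..n}"
  then show "relabel (inv (\<sigma> \<circ> \<tau>)) p = relabel (inv \<tau>) (relabel (inv \<sigma>) p)"
    unfolding relabel_comp by (metis o_inv_distrib permutes_bij)
next
  fix i m n and p q :: "nat tree \<Rightarrow>\<^sub>0 'k"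
  assume "i \<in> {1..m}" "p \<in> supported (trees m)" "q \<in> supported (trees n)"
  then show "bilin_ext (\<lambda>s t. basis (tree_pcomp n i s t)) p q
      \<in> supported (trees (m + n - 1))"
    by (auto intro!: supported_bilin_ext tree_pcomp_closed simp del: One_nat_def)
next
  fix n and p :: "nat tree \<Rightarrow>\<^sub>0 'k"
  show "bilin_ext (\<lambda>s t. basis (tree_pcomp n 1 s t))
      (basis (tree_input 1)) p = p"
    by (simp add: bilin_ext_single_left outer_label_def inner_label_def tree_relabel_bind)
next
  fix i n and p :: "nat tree \<Rightarrow>\<^sub>0 'k"
  assume "i \<in> {1..n}" "p \<in> supported (trees n)"
  then have "outer_label i 1 a = a" "inner_label i 1 = i" for a
    by (auto simp: outer_label_def inner_label_def)
  then show "bilin_ext (\<lambda>s t. basis (tree_pcomp 1 i s t)) p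
      (basis (tree_input 1)) = p"
    by (simp add: bilin_ext_single_right tree_pcomp_bind if_distrib[of tree_input, symmetric]
        tree_substitute_bind tree_relabel_bind tree_bind_bind cong: if_cong)
next
  fix i l j m n and p q r :: "nat tree \<Rightarrow>\<^sub>0 'k"
  assume "i \<in> {1..l}" "j \<in> {1..m}"
    "p \<in> supported (trees l)" "q \<in> supported (trees m)" "r \<in> supported (trees n)"
  then show "bilin_ext (\<lambda>s t. basis (tree_pcomp n (i - 1 + j) s t))
        (bilin_ext (\<lambda>s t. basis (tree_pcomp m i s t)) p q) r
      = bilin_ext (\<lambda>s t. basis (tree_pcomp (m + n - 1) i s t)) p
        (bilin_ext (\<lambda>s t. basis (tree_pcomp n j s t)) q r)"
    unfolding bilin_ext_left lin_ext_lin_ext lin_ext_single pm.scale_one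
    by (intro lin_ext_cong arg_cong[of _ _ "\<lambda>t. basis t"] tree_pcomp_sequential)
      (auto simp: supported_def)
next
  fix i l k m n and p q r :: "nat tree \<Rightarrow>\<^sub>0 'k"
  assume *: "i \<in> {1..l}" "k \<in> {1..l}" "i < k"
    "p \<in> supported (trees l)" "q \<in> supported (trees m)" "r \<in> supported (trees n)"
  show "bilin_ext (\<lambda>s t. basis (tree_pcomp n (k - 1 + m) s t))
        (bilin_ext (\<lambda>s t. basis (tree_pcomp m i s t)) p q) r
      = bilin_ext (\<lambda>s t. basis (tree_pcomp m i s t))
        (bilin_ext (\<lambda>s t. basis (tree_pcomp n k s t)) p r) q"
    unfolding bilin_ext_left lin_ext_lin_ext lin_ext_single pm.scale_one
    \<comment> \<open>On the left side q is inserted before r, on the right side r before q;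
      exchanging the two sums aligns the variables.\<close>
    by (subst lin_ext_swap[of _ q],
        intro lin_ext_cong arg_cong[of _ _ "\<lambda>t. basis t"] tree_pcomp_parallel)
      (use * in \<open>auto simp: supported_def\<close>)
next
  fix i m n \<sigma> \<tau> \<rho> and p q :: "nat tree \<Rightarrow>\<^sub>0 'k"
  assume *: "i \<in> {1..m}" "p \<in> supported (trees m)" "q \<in> supported (trees n)"
    "\<sigma> permutes {1..m}" "\<tau> permutes {1..n}" "\<rho> permutes {1..m + n - 1}"
    "\<And>j. j \<in> {1..m} - {i} \<Longrightarrow> \<rho> (outer_label i n j) = outer_label (\<sigma> i) n (\<sigma> j)"
    "\<And>j. j \<in> {1..n} \<Longrightarrow> \<rho> (inner_label i j) = inner_label (\<sigma> i) (\<tau> j)"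
  show "bilin_ext (\<lambda>s t. basis (tree_pcomp n i s t))
        (relabel (inv \<sigma>) p) (relabel (inv \<tau>) q)
      = relabel (inv \<rho>) (bilin_ext (\<lambda>s t. basis (tree_pcomp n (\<sigma> i) s t)) p q)"
    unfolding bilin_ext_left lin_ext_lin_ext lin_ext_single pm.scale_one relabel_def
    by (intro lin_ext_cong arg_cong[of _ _ "\<lambda>t. basis t"] tree_pcomp_equivariance)
      (use * in \<open>auto simp: supported_def\<close>)
qed (simp_all add: vector_space_pm_scale subspace_supported relabel_def lin_ext_add lin_ext_scale
    bilin_ext_add_left bilin_ext_add_right bilin_ext_scale_left bilin_ext_scale_right
    trees_def tree_relabel_bind pm.scale_left_distrib pm.scale_right_distrib)

section \<open>Composition along arbitrary label sets\<close>

text \<open>The partial compositions number the inputs in a fixed way. On arbitrary labels,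
  substitution differs from them by a renumbering, so whatever is stable under compositions and
  permutations is stable under substitution.\<close>

lemma labelled_pcomp:
  fixes f :: "'a \<Rightarrow> nat"
  assumes i: "i \<in> A" and disj: "(A - {i}) \<inter> B = {}" and n: "n \<ge> 1"
    and \<alpha>: "bij_betw \<alpha> A {1..m}" and \<beta>: "bij_betw \<beta> B {1..n}"
    and f: "bij_betw f ((A - {i}) \<union> B) {1..m + n - 1}"
  obtains \<sigma> where "\<sigma> permutes {1..m + n - 1}"
    "\<And>u v. u \<in> supported (linear_trees A) \<Longrightarrow> v \<in> supported (linear_trees B) \<Longrightarrow>
      relabel f (subst_at i u v :: 'a tree \<Rightarrow>\<^sub>0 'k::field) =
        act free_operad (m + n - 1) \<sigma> (pcomp free_operad m n (\<alpha> i) (relabel \<alpha> u) (relabel \<beta> v))"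
proof
  define C where "C = (A - {i}) \<union> B"
  define N where "N = m + n - 1"
  have fin: "finite A" "finite B" using \<alpha> \<beta> by (auto simp: bij_betw_finite)
  have \<alpha>i: "\<alpha> i \<in> {1..m}" using \<alpha> i by (auto simp: bij_betw_def)
  \<comment> \<open>The numbering that the partial composition produces; \<kappa> below translates
    it into the numbering f.\<close>
  define \<gamma> where "\<gamma> c = (if c \<in> B then inner_label (\<alpha> i) (\<beta> c) else outer_label (\<alpha> i) n (\<alpha> c))" for c
  have "bij_betw \<alpha> (A - {i}) ({1..m} - {\<alpha> i})"
    using \<alpha> i by (auto simp: bij_betw_def inj_on_def)
  from bij_betw_trans[OF this bij_betw_outer_label[OF \<alpha>i n]]
  have "bij_betw \<gamma> (A - {i}) ({1..m + n - 1} - {\<alpha> i..\<alpha> i + n - 1})"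
    by (rule bij_betw_cong[THEN iffD1, rotated]) (use disj in \<open>auto simp: \<gamma>_def\<close>)
  moreover have "bij_betw \<gamma> B {\<alpha> i..\<alpha> i + n - 1}"
  proof -
    have "bij_betw (inner_label (\<alpha> i) \<circ> \<beta>) B {\<alpha> i..\<alpha> i + n - 1}"
      using \<alpha>i n by (intro bij_betw_trans[OF \<beta>] bij_betw_inner_label) auto
    then show ?thesis
      by (rule bij_betw_cong[THEN iffD1, rotated]) (auto simp: \<gamma>_def)
  qed
  ultimately have "bij_betw \<gamma> C (({1..m + n - 1} - {\<alpha> i..\<alpha> i + n - 1}) \<union> {\<alpha> i..\<alpha> i + n - 1})"
    unfolding C_def by (rule bij_betw_combine) auto
  also have "({1..m + n - 1} - {\<alpha> i..\<alpha> i + n - 1}) \<union> {\<alpha> i..\<alpha> i + n - 1} = {1..N}"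
    using \<alpha>i n by (auto simp: N_def)
  finally have \<gamma>: "bij_betw \<gamma> C {1..N}" .
  define \<kappa> where "\<kappa> x = (if x \<in> {1..N} then f (inv_into C \<gamma> x) else x)" for x
  have "bij_betw (f \<circ> inv_into C \<gamma>) {1..N} {1..N}"
    using bij_betw_trans[OF bij_betw_inv_into[OF \<gamma>]] f by (auto simp: C_def N_def)
  then have "bij_betw \<kappa> {1..N} {1..N}"
    by (rule bij_betw_cong[THEN iffD1, rotated]) (auto simp: \<kappa>_def)
  then have \<kappa>: "\<kappa> permutes {1..N}"
    by (rule bij_imp_permutes) (auto simp: \<kappa>_def)
  \<comment> \<open>The right action relabels by the inverse permutation, so \<kappa> has to enter
    through its inverse.\<close>
  then show "inv \<kappa> permutes {1..m + n - 1}" unfolding N_def by (rule permutes_inv)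
  have \<kappa>\<gamma>: "\<kappa> (\<gamma> c) = f c" if "c \<in> C" for c
    using that \<gamma> by (auto simp: \<kappa>_def bij_betw_def)
  fix u v :: "'a tree \<Rightarrow>\<^sub>0 'k"
  assume u: "u \<in> supported (linear_trees A)" and v: "v \<in> supported (linear_trees B)"
  have *: "tree_relabel f (tree_substitute i s t) =
      tree_relabel \<kappa> (tree_pcomp n (\<alpha> i) (tree_relabel \<alpha> s) (tree_relabel \<beta> t))"
    if "s \<in> linear_trees A" "t \<in> linear_trees B" for s t
  proof -
    have s: "a \<in># tree_inputs s \<Longrightarrow> a \<in> A" and t: "b \<in># tree_inputs t \<Longrightarrow> b \<in> B" for a b
      using that fin by (auto simp: linear_trees_def)
    have \<alpha>_eq: "outer_label (\<alpha> i) n (\<alpha> a) = \<alpha> i \<longleftrightarrow> a = i" if "a \<in> A" for a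
      unfolding outer_label_eq_iff[OF n] using \<alpha> i that by (auto simp: bij_betw_def inj_on_def)
    have "\<kappa> (outer_label (\<alpha> i) n (\<alpha> a)) = f a" if "a \<in> A" "a \<noteq> i" for a
    proof -
      have "a \<notin> B" using that disj by blast
      then show ?thesis using \<kappa>\<gamma>[of a] that by (simp add: C_def \<gamma>_def)
    qed
    moreover have "\<kappa> (inner_label (\<alpha> i) (\<beta> b)) = f b" if "b \<in> B" for b
      using \<kappa>\<gamma>[of b] that by (auto simp: C_def \<gamma>_def)
    ultimately show ?thesis
      unfolding tree_pcomp_bind unfolding tree_relabel_bind tree_substitute_bind tree_bind_bind
      by (intro tree_bind_cong) (auto dest!: s t simp: \<alpha>_eq tree_bind_bind intro!: tree_bind_cong)
  qed
  have "inv (inv \<kappa>) = \<kappa>" using \<kappa> by (simp add: inv_inv_eq permutes_bij)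
  then show "relabel f (subst_at i u v) =
      act free_operad (m + n - 1) (inv \<kappa>) (pcomp free_operad m n (\<alpha> i) (relabel \<alpha> u) (relabel \<beta> v))"
    unfolding free_operad_simps relabel_def subst_at_def bilin_ext_left lin_ext_lin_ext lin_ext_single
      pm.scale_one
    by (intro lin_ext_cong arg_cong[of _ _ "\<lambda>t. basis t"])
      (use u v * in \<open>auto simp: supported_def\<close>)
qed

text \<open>
  The subspaces \<open>I n\<close> live on the labels \<open>{1..n}\<close>; they are transported to a finite set \<open>A\<close> of
  labels. If they are stable under the symmetric groups, one bijection is enough to test this.
\<close>

definition labelled :: "(nat \<Rightarrow> (nat tree \<Rightarrow>\<^sub>0 'k::field) set) \<Rightarrow> 'a set \<Rightarrow> ('a tree \<Rightarrow>\<^sub>0 'k) \<Rightarrow> bool" where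
  "labelled I A u \<longleftrightarrow> finite A \<and> u \<in> supported (linear_trees A) \<and>
    (\<forall>f. bij_betw f A {1..card A} \<longrightarrow> relabel f u \<in> I (card A))"

definition act_closed :: "(nat \<Rightarrow> (nat tree \<Rightarrow>\<^sub>0 'k::field) set) \<Rightarrow> bool" where
  "act_closed I \<longleftrightarrow>
    (\<forall>n \<sigma> u. \<sigma> permutes {1..n} \<longrightarrow> u \<in> I n \<longrightarrow> act free_operad n \<sigma> u \<in> I n)"

lemma labelledI:
  assumes I: "act_closed I" and u: "u \<in> supported (linear_trees A)"
    and f: "bij_betw f A {1..n}" "relabel f u \<in> I n"
  shows "labelled I A u"
  unfolding labelled_def
proof (intro conjI allI impI u)
  show fin: "finite A" using f(1) by (simp add: bij_betw_finite)
  have n: "n = card A" using f(1) bij_betw_same_card by fastforce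
  fix g assume g: "bij_betw g A {1..card A}"
  \<comment> \<open>Two numberings of A differ by a permutation of 1, ..., n, extended by the
    identity to all numbers.\<close>
  define \<kappa> where "\<kappa> x = (if x \<in> {1..n} then g (inv_into A f x) else x)" for x
  have "bij_betw (g \<circ> inv_into A f) {1..n} {1..n}"
    using bij_betw_trans[OF bij_betw_inv_into[OF f(1)]] g n by auto
  then have "bij_betw \<kappa> {1..n} {1..n}"
    by (rule bij_betw_cong[THEN iffD1, rotated]) (auto simp: \<kappa>_def)
  then have \<kappa>: "\<kappa> permutes {1..n}"
    by (rule bij_imp_permutes) (auto simp: \<kappa>_def)
  have "\<kappa> (f a) = g a" if "a \<in> A" for a
    using that f(1) by (auto simp: \<kappa>_def bij_betw_def)
  then have "relabel g u = relabel \<kappa> (relabel f u)"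
    unfolding relabel_comp by (intro relabel_cong[OF u fin]) simp
  also have "\<dots> = act free_operad n (inv \<kappa>) (relabel f u)"
    using \<kappa> by (simp add: free_operad_simps inv_inv_eq permutes_bij)
  finally show "relabel g u \<in> I (card A)"
    using I f(2) \<kappa> permutes_inv unfolding act_closed_def n by metis
qed

text \<open>Three families, so as to cover a suboperad (all of them equal) as well as the ideal,
  where one factor is arbitrary and the other one lies in the ideal.\<close>

lemma labelled_subst:
  fixes u :: "'a tree \<Rightarrow>\<^sub>0 'k::field"
  assumes L: "act_closed L"
    and comp: "\<And>i m n p q. i \<in> {1..m} \<Longrightarrow> p \<in> J m \<Longrightarrow> q \<in> K n \<Longrightarrow>
      pcomp free_operad m n i p q \<in> L (m + n - 1)"
    and u: "labelled J A u" and v: "labelled K B v"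
    and i: "i \<in> A" and disj: "(A - {i}) \<inter> B = {}" and B: "B \<noteq> {}"
  shows "labelled L ((A - {i}) \<union> B) (subst_at i u v)"
proof -
  have fin: "finite A" "finite B" using u v by (auto simp: labelled_def)
  obtain \<alpha> \<beta> where \<alpha>: "bij_betw \<alpha> A {1..card A}" and \<beta>: "bij_betw \<beta> B {1..card B}"
    using finite_same_card_bij[OF fin(1), of "{1..card A}"] finite_same_card_bij[OF fin(2), of "{1..card B}"]
    by auto
  define N where "N = card A + card B - 1"
  have "card ((A - {i}) \<union> B) = card (A - {i}) + card B"
    using fin disj by (intro card_Un_disjoint) auto
  then have "card ((A - {i}) \<union> B) = N"
    using i fin card_gt_0_iff[of A] by (auto simp: N_def)
  then obtain f where f: "bij_betw f ((A - {i}) \<union> B) {1..N}"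
    using fin finite_same_card_bij[of "(A - {i}) \<union> B" "{1..N}"] by auto
  have nB: "card B \<ge> 1" using B fin by (simp add: Suc_le_eq card_gt_0_iff)
  obtain \<sigma> where \<sigma>: "\<sigma> permutes {1..N}"
    "\<And>u v. u \<in> supported (linear_trees A) \<Longrightarrow> v \<in> supported (linear_trees B) \<Longrightarrow>
      relabel f (subst_at i u v :: 'a tree \<Rightarrow>\<^sub>0 'k) = act free_operad N \<sigma>
        (pcomp free_operad (card A) (card B) (\<alpha> i) (relabel \<alpha> u) (relabel \<beta> v))"
    using labelled_pcomp[OF i disj nB \<alpha> \<beta> f[unfolded N_def]] unfolding N_def by blast
  have "pcomp free_operad (card A) (card B) (\<alpha> i) (relabel \<alpha> u) (relabel \<beta> v) \<in> L N"
    unfolding N_def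
    by (rule comp) (use \<alpha> \<beta> i u v in \<open>auto simp: bij_betw_def labelled_def\<close>)
  then have "relabel f (subst_at i u v) \<in> L N"
    using \<sigma> u v L unfolding act_closed_def labelled_def by metis
  moreover have "subst_at i u v \<in> supported (linear_trees ((A - {i}) \<union> B))"
    unfolding subst_at_def
    by (rule supported_bilin_ext[of _ "linear_trees A" _ "linear_trees B"])
      (use u v fin i disj in \<open>auto simp: labelled_def intro: linear_trees_substitute\<close>)
  ultimately show ?thesis using labelledI[OF L _ f] by blast
qed

lemma labelled_supported:
  "finite A \<Longrightarrow> u \<in> supported (linear_trees A) \<Longrightarrow> labelled (\<lambda>n. supported (trees n)) A u"
  by (auto simp: labelled_def trees_linear_trees intro: relabel_supported)

lemma labelled_interval: "labelled I {1..n} u \<Longrightarrow> u \<in> I n"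
  using relabel_id[of u] by (auto simp: labelled_def bij_betw_def inj_on_def dest!: spec[of _ "\<lambda>a. a"])

lemma labelled_gen_op:
  assumes G: "act_closed G" "gen_op g \<in> G 2" and xy: "x \<noteq> y"
  shows "labelled G {x, y} (basis (tree_app g (tree_input x) (tree_input y)))"
proof (rule labelledI[OF G(1)])
  show "bij_betw (\<lambda>z. if z = x then 1 else 2::nat) {x, y} {1..2}"
    using xy by (auto simp: bij_betw_def)
qed (use xy G(2) in \<open>auto simp: gen_op_def relabel_def linear_trees_def mset_set.insert\<close>)

lemma fresh_labels:
  assumes "finite (X :: nat set)"
  obtains x y z where "x \<notin> X" "y \<notin> X" "z \<notin> X" "x \<noteq> y" "x \<noteq> z" "y \<noteq> z"
proof -
  obtain x where x: "x \<notin> X" using ex_new_if_finite[OF infinite_UNIV_nat assms] by blast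
  obtain y where y: "y \<notin> insert x X" using ex_new_if_finite[OF infinite_UNIV_nat, of "insert x X"] assms by auto
  obtain z where z: "z \<notin> insert y (insert x X)"
    using ex_new_if_finite[OF infinite_UNIV_nat, of "insert y (insert x X)"] assms by auto
  show thesis using that[of x y z] x y z by auto
qed

lemma tree_substitute_fresh:
  "x \<notin># tree_inputs s \<Longrightarrow> tree_substitute x s t = s"
  unfolding tree_substitute_bind
  by (subst (2) tree_bind_tree_input[symmetric], rule tree_bind_cong) auto

text \<open>A product g(s, t) is the generator with its two inputs replaced one after the other. As
  y is not a label of u, the second substitution leaves the first argument alone.\<close>

lemma tree_app_subst:
  fixes u :: "'a tree \<Rightarrow>\<^sub>0 'k::field"
  assumes "x \<noteq> y" "u \<in> supported (linear_trees A)" "finite A" "y \<notin> A"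
  shows "subst_at y (subst_at x (basis (tree_app g (tree_input x) (tree_input y))) u)
      (basis t) = lin_ext (\<lambda>s. basis (tree_app g s t)) u"
proof -
  have "tree_substitute y s t = s" if "s \<in> Poly_Mapping.keys u" for s
    by (rule tree_substitute_fresh) (use that assms in \<open>auto simp: supported_def linear_trees_def\<close>)
  then show ?thesis
    using assms(1)
    by (auto simp: subst_at_def bilin_ext_single_left bilin_ext_single_right lin_ext_lin_ext
        intro!: lin_ext_cong)
qed

text \<open>Builds a tree on an arbitrary label set from its subtrees, by composing a generator on
  two fresh labels with them. The uniqueness of the isomorphism applies this to the operations on
  which two homomorphisms agree.\<close>

lemma free_operad_generated:
  fixes G :: "nat \<Rightarrow> (nat tree \<Rightarrow>\<^sub>0 'k::field) set"
  assumes act: "act_closed G"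
    and comp: "\<And>i m n p q. i \<in> {1..m} \<Longrightarrow> p \<in> G m \<Longrightarrow> q \<in> G n \<Longrightarrow>
      pcomp free_operad m n i p q \<in> G (m + n - 1)"
    and sub: "\<And>n. pm.subspace (G n)"
    and ident: "ident free_operad \<in> G 1" and gen: "\<And>g. gen_op g \<in> G 2"
  shows "supported (trees n) \<subseteq> G n"
proof -
  have *: "labelled G A (basis t)" if "t \<in> linear_trees A" "finite A"
    for t :: "nat tree" and A
    using that
  proof (induction t arbitrary: A rule: tree_induct)
    case (input a)
    then have A: "A = {a}" by (rule linear_trees_inputD)
    show ?case
      by (rule labelledI[OF act, of _ _ "\<lambda>_. 1" 1])
        (use ident in \<open>auto simp: A linear_trees_def bij_betw_def relabel_def free_operad_simps\<close>)
  next
    case (app g s t)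
    obtain B C where BC: "s \<in> linear_trees B" "t \<in> linear_trees C" "A = B \<union> C" "B \<inter> C = {}"
      using linear_trees_appD[OF app.prems] .
    then have ne: "B \<noteq> {}" "C \<noteq> {}" and fin: "finite B" "finite C"
      using app.prems(2) by (auto dest: linear_trees_nonempty)
    obtain x y where xy: "x \<notin> B \<union> C" "y \<notin> B \<union> C" "x \<noteq> y"
      using fresh_labels[of "B \<union> C"] fin by blast
    have 1: "labelled G ({x, y} - {x} \<union> B)
        (subst_at x (basis (tree_app g (tree_input x) (tree_input y))) (basis s))"
      by (rule labelled_subst[OF act comp labelled_gen_op[OF act gen xy(3)] app.IH(1)[OF BC(1)]])
        (use fin ne xy in auto)
    have "labelled G (({x, y} - {x} \<union> B) - {y} \<union> C)
        (subst_at y (subst_at x (basis (tree_app g (tree_input x) (tree_input y)))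
          (basis s)) (basis t))"
      by (rule labelled_subst[OF act comp 1 app.IH(2)[OF BC(2)]])
        (use fin ne xy BC in auto)
    also have "({x, y} - {x} \<union> B) - {y} \<union> C = A"
      using xy BC by auto
    also have "subst_at y (subst_at x (basis (tree_app g (tree_input x) (tree_input y)))
          (basis s)) (basis t) =
        (basis (tree_app g s t) :: _ \<Rightarrow>\<^sub>0 'k)"
      using tree_app_subst[OF xy(3), of "basis s" B g t] fin BC xy by simp
    finally show ?case .
  qed
  have "basis t \<in> G n" if "t \<in> trees n" for t
    using *[of t "{1..n}"] that by (auto simp: trees_linear_trees simp del: One_nat_def intro: labelled_interval)
  then show ?thesis using supported_in_subspace[OF sub] by blast
qed

section \<open>The ideal of relations\<close>

definition prelie_rel :: "'a tree \<Rightarrow> 'a tree \<Rightarrow> 'a tree \<Rightarrow> ('a tree \<Rightarrow>\<^sub>0 'k::field)" where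
  "prelie_rel s t u =
    basis (tree_app Gen_x (tree_app Gen_x s t) u)
    - basis (tree_app Gen_x s (tree_app Gen_x t u))
    - (basis (tree_app Gen_x (tree_app Gen_x s u) t)
      - basis (tree_app Gen_x s (tree_app Gen_x u t)))"

definition leibniz_rel :: "'a tree \<Rightarrow> 'a tree \<Rightarrow> 'a tree \<Rightarrow> ('a tree \<Rightarrow>\<^sub>0 'k::field)" where
  "leibniz_rel s t u =
    basis (tree_app Gen_x (tree_app Gen_c s t) u)
    - basis (tree_app Gen_c (tree_app Gen_x s u) t)
    - basis (tree_app Gen_c s (tree_app Gen_x t u))"

definition assoc_rel :: "'a tree \<Rightarrow> 'a tree \<Rightarrow> 'a tree \<Rightarrow> ('a tree \<Rightarrow>\<^sub>0 'k::field)" where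
  "assoc_rel s t u =
    basis (tree_app Gen_c (tree_app Gen_c s t) u)
    - basis (tree_app Gen_c s (tree_app Gen_c t u))"

definition is_rel :: "('a tree \<Rightarrow> 'a tree \<Rightarrow> 'a tree \<Rightarrow> ('a tree \<Rightarrow>\<^sub>0 'k::field)) \<Rightarrow> bool" where
  "is_rel r \<longleftrightarrow> r = prelie_rel \<or> r = leibniz_rel \<or> r = assoc_rel"

text \<open>Expands the three defining relations on the inputs 1, 2, 3. The transposition of 2 and 3
  turns c(x(1, 2), 3) into c(x(1, 3), 2), which is where the second term of
  \<open>leibniz_rel\<close> comes from.\<close>

lemma comprelie_rels_eq:
  "(comprelie_rels n :: (nat tree \<Rightarrow>\<^sub>0 'k::field) set) = (if n = 3 then {r (tree_input 1) (tree_input 2) (tree_input 3) |r. is_rel r} else {})"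
proof -
  have inv: "inv (transpose 2 (3::nat)) = transpose 2 3" by simp
  have two: "Suc (Suc 0) = 2" by simp
  have t: "transpose 2 3 (Suc 0) = Suc 0" by (simp add: transpose_def)
  have eq: "{prelie_rel (tree_input 1) (tree_input 2) (tree_input (3::nat)) :: nat tree \<Rightarrow>\<^sub>0 'k,
      leibniz_rel (tree_input 1) (tree_input 2) (tree_input 3),
      assoc_rel (tree_input 1) (tree_input 2) (tree_input 3)} =
    {r (tree_input 1) (tree_input 2) (tree_input 3) |r. is_rel r}"
    by (auto simp: is_rel_def)
  show ?thesis
    unfolding comprelie_rels_def Let_def free_operad_simps gen_op_def inv eq[symmetric]
      prelie_rel_def leibniz_rel_def assoc_rel_def
    by (simp add: bilin_ext_single_left relabel_def lin_ext_diff t two outer_label_def inner_label_def)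
qed

lemma rel_supported:
  assumes "is_rel r" "s \<in> linear_trees A" "t \<in> linear_trees B" "u \<in> linear_trees C"
    "finite A" "finite B" "finite C" "A \<inter> B = {}" "A \<inter> C = {}" "B \<inter> C = {}"
  shows "r s t u \<in> supported (linear_trees (A \<union> B \<union> C))"
proof -
  have "A \<inter> (B \<union> C) = {}" "(A \<union> B) \<inter> C = {}" using assms by auto
  moreover have "tree_inputs s = mset_set A" "tree_inputs t = mset_set B" "tree_inputs u = mset_set C"
    using assms by (auto simp: linear_trees_def)
  ultimately show ?thesis
    using assms(1,5-10)
    by (auto simp: is_rel_def prelie_rel_def leibniz_rel_def assoc_rel_def linear_trees_def
        mset_set_Union ac_simps intro!: pm.subspace_diff[OF subspace_supported])
qed

abbreviation comprelie_ideal_at :: "nat \<Rightarrow> (nat tree \<Rightarrow>\<^sub>0 'k::field) set" where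
  "comprelie_ideal_at n \<equiv> {u. operad_ideal free_operad comprelie_rels n u}"

lemma subspace_comprelie_ideal_at: "pm.subspace (comprelie_ideal_at n)"
  unfolding pm.subspace_def
  using operad_ideal.intros(2-4)[where P = free_operad and R = comprelie_rels]
  by (auto simp: free_operad_simps)

lemma comprelie_ideal_at_supported: "(comprelie_ideal_at n :: (nat tree \<Rightarrow>\<^sub>0 'k::field) set) \<subseteq> supported (trees n)"
proof
  fix u :: "nat tree \<Rightarrow>\<^sub>0 'k" assume "u \<in> comprelie_ideal_at n"
  then have "operad_ideal free_operad comprelie_rels n u" by simp
  then show "u \<in> supported (trees n)"
  proof induction
    case (1 p n)
    then have n: "n = 3" and "\<exists>r. is_rel r \<and> p = r (tree_input 1) (tree_input 2) (tree_input 3)"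
      by (auto simp: comprelie_rels_eq split: if_splits)
    then obtain r where r: "is_rel r" "p = r (tree_input 1) (tree_input 2) (tree_input 3)" by blast
    have "p \<in> supported (linear_trees ({1} \<union> {2} \<union> {3}))"
      unfolding r(2) by (rule rel_supported[OF r(1)]) (auto simp: linear_trees_def)
    also have "{1} \<union> {2} \<union> {3} = {1..n}" unfolding n by auto
    finally show ?case by (simp add: trees_linear_trees)
  qed (use operad.act_closed[OF operad_free_operad] operad.pcomp_closed[OF operad_free_operad]
      pm.subspace_0[OF subspace_supported] pm.subspace_add[OF subspace_supported]
      pm.subspace_scale[OF subspace_supported]
      in \<open>auto simp: free_operad_simps simp del: One_nat_def atLeastAtMost_iff\<close>)
qed

lemma act_closed_comprelie_ideal_at: "act_closed comprelie_ideal_at"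
  unfolding act_closed_def by (auto intro: operad_ideal.intros(5))

lemma subst_comprelie_ideal_at:
  assumes "labelled comprelie_ideal_at A u" "t \<in> linear_trees B" "finite B"
    "i \<in> A" "(A - {i}) \<inter> B = {}"
  shows "labelled comprelie_ideal_at ((A - {i}) \<union> B) (subst_at i u (basis t))"
proof (rule labelled_subst[OF act_closed_comprelie_ideal_at _ assms(1) _ assms(4,5)])
  show "labelled (\<lambda>n. supported (trees n)) B (basis t)"
    by (rule labelled_supported) (use assms in auto)
  show "B \<noteq> {}" using assms(2) by (rule linear_trees_nonempty)
qed (auto simp: free_operad_simps(2)[symmetric] intro: operad_ideal.intros(6) simp del: One_nat_def)

text \<open>A relation with trees substituted for its inputs, placed in a context. The hole is
  always in the left argument; \<open>gen_swap\<close> exchanges the arguments of a generator, so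
  this covers all contexts. The multiset collects the inputs, which may be repeated.\<close>

inductive rel_context :: "'a multiset \<Rightarrow> ('a tree \<Rightarrow>\<^sub>0 'k::field) \<Rightarrow> bool" where
  rel: "is_rel r \<Longrightarrow> rel_context (tree_inputs s + tree_inputs t + tree_inputs u) (r s t u)"
| app: "rel_context M w \<Longrightarrow>
    rel_context (M + tree_inputs t) (lin_ext (\<lambda>s. basis (tree_app g s t)) w)"

lemma rel_context_nonempty: "rel_context M w \<Longrightarrow> M \<noteq> {#}"
  by (induction rule: rel_context.induct) (auto simp: tree_inputs_nonempty)

text \<open>Labels that occur once make the element reachable by operad compositions: a generating
  relation on fresh labels receives s, t and u one after another, and every layer of the context is
  a composition with a generator.\<close>

lemma rel_context_labelled:
  assumes "rel_context M w" "M = mset_set A" "finite A"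
  shows "labelled comprelie_ideal_at A (w :: nat tree \<Rightarrow>\<^sub>0 'k::field)"
  using assms
proof (induction arbitrary: A)
  case (rel r s t u)
  \<comment> \<open>The product with \<open>Gen_c\<close> serves to split A into the label sets of
    s, t and u by \<open>linear_trees_appD\<close>.\<close>
  have "tree_app Gen_c (tree_app Gen_c s t) u \<in> linear_trees A"
    using rel by (simp add: linear_trees_def)
  then obtain B A3 where B: "tree_app Gen_c s t \<in> linear_trees B" "u \<in> linear_trees A3"
    "A = B \<union> A3" "B \<inter> A3 = {}"
    using linear_trees_appD rel(3) by metis
  then obtain A1 A2 where A: "s \<in> linear_trees A1" "t \<in> linear_trees A2" "B = A1 \<union> A2" "A1 \<inter> A2 = {}"
    using linear_trees_appD rel(3) finite_Un by metis
  have fin: "finite A1" "finite A2" "finite A3" using rel(3) A B by auto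
  obtain x y z where xyz: "x \<notin> A" "y \<notin> A" "z \<notin> A" "x \<noteq> y" "x \<noteq> z" "y \<noteq> z"
    using fresh_labels[OF rel(3)] .
  let ?r = "r (tree_input x) (tree_input y) (tree_input z)"
  have "labelled comprelie_ideal_at {x, y, z} ?r"
  proof (rule labelledI[OF act_closed_comprelie_ideal_at])
    show "bij_betw (\<lambda>w. if w = x then 1 else if w = y then 2 else 3::nat) {x, y, z} {1..3}"
      using xyz by (auto simp: bij_betw_def)
    have "?r \<in> supported (linear_trees ({x} \<union> {y} \<union> {z}))"
      by (rule rel_supported[OF rel(1)]) (use xyz in \<open>auto simp: linear_trees_def\<close>)
    then show "?r \<in> supported (linear_trees {x, y, z})"
      by (simp add: insert_commute)
    have "relabel (\<lambda>w. if w = x then 1 else if w = y then 2 else 3) ?r =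
        r (tree_input 1) (tree_input 2) (tree_input 3)"
      using rel(1) xyz
      by (auto simp: is_rel_def prelie_rel_def leibniz_rel_def assoc_rel_def relabel_def lin_ext_diff)
    then show "relabel (\<lambda>w. if w = x then 1 else if w = y then 2 else 3) ?r \<in> comprelie_ideal_at 3"
      using rel(1) by (auto intro!: operad_ideal.intros(1) simp: comprelie_rels_eq)
  qed
  then have "labelled comprelie_ideal_at ((({x, y, z} - {x} \<union> A1) - {y} \<union> A2) - {z} \<union> A3)
      (subst_at z (subst_at y (subst_at x ?r (basis s)) (basis t))
        (basis u))"
    by (intro subst_comprelie_ideal_at A(1,2) B(2) fin) (use xyz A B in auto)
  also have "(({x, y, z} - {x} \<union> A1) - {y} \<union> A2) - {z} \<union> A3 = A"
    using xyz A B by auto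
  also have "subst_at z (subst_at y (subst_at x ?r (basis s)) (basis t))
        (basis u) = r s t u"
  proof -
    have "w \<notin> A \<Longrightarrow> tree_substitute w s v = s \<and> tree_substitute w t v = t" for w v
      by (intro conjI tree_substitute_fresh) (use A B fin in \<open>auto simp: linear_trees_def\<close>)
    then show ?thesis
      using rel(1) xyz
      by (auto simp: is_rel_def prelie_rel_def leibniz_rel_def assoc_rel_def subst_at_def
          bilin_ext_single_left bilin_ext_diff_left)
  qed
  finally show ?case .
next
  case (app M w t g)
  have sub: "M = mset_set (set_mset M)" "tree_inputs t = mset_set (set_mset (tree_inputs t))"
    and A: "A = set_mset M \<union> set_mset (tree_inputs t)" "set_mset M \<inter> set_mset (tree_inputs t) = {}"
    using mset_set_unionD[OF app.prems(1)] app.prems by auto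
  let ?B = "set_mset M" and ?C = "set_mset (tree_inputs t)"
  obtain x y where xy: "x \<notin> A" "y \<notin> A" "x \<noteq> y"
    using fresh_labels[OF app.prems(2)] by blast
  have w: "labelled comprelie_ideal_at ?B w" using app.IH[OF sub(1)] by simp
  \<comment> \<open>First the ideal element w is the right argument of a composition with the
    generator at x; then the result, again in the ideal, is the left argument of the composition
    with t at y.\<close>
  have "labelled comprelie_ideal_at ({x, y} - {x} \<union> ?B)
      (subst_at x (basis (tree_app g (tree_input x) (tree_input y))) w)"
  proof (rule labelled_subst[OF act_closed_comprelie_ideal_at _ _ w])
    show "labelled (\<lambda>n. supported (trees n)) {x, y}
        (basis (tree_app g (tree_input x) (tree_input y)))"
      by (rule labelled_supported) (use xy in \<open>auto simp: linear_trees_def mset_set.insert\<close>)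
    show "?B \<noteq> {}"
      using rel_context_nonempty[OF app.hyps] by simp
  qed (use xy A in \<open>auto simp: free_operad_simps(2)[symmetric] intro: operad_ideal.intros(7) simp del: One_nat_def\<close>)
  then have "labelled comprelie_ideal_at (({x, y} - {x} \<union> ?B) - {y} \<union> ?C)
      (subst_at y (subst_at x (basis (tree_app g (tree_input x) (tree_input y))) w)
        (basis t))"
    by (rule subst_comprelie_ideal_at) (use xy A sub in \<open>auto simp: linear_trees_def\<close>)
  also have "({x, y} - {x} \<union> ?B) - {y} \<union> ?C = A" using xy A by auto
  also have "subst_at y (subst_at x (basis (tree_app g (tree_input x) (tree_input y))) w)
        (basis t) = lin_ext (\<lambda>s. basis (tree_app g s t)) w"
    by (rule tree_app_subst[OF xy(3), of _ ?B]) (use w xy A in \<open>auto simp: labelled_def\<close>)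
  finally show ?case .
qed

section \<open>Homogeneous components\<close>

definition homogeneous_part :: "'a set \<Rightarrow> ('a \<Rightarrow>\<^sub>0 'k) \<Rightarrow> ('a \<Rightarrow>\<^sub>0 'k::field)" where
  "homogeneous_part B = lin_ext (\<lambda>t. if t \<in> B then basis t else 0)"

lemma homogeneous_part_id: "u \<in> supported B \<Longrightarrow> homogeneous_part B u = u"
  unfolding homogeneous_part_def
  by (subst (2) lin_ext_singles[symmetric], rule lin_ext_cong) (auto simp: supported_def)

lemma homogeneous_part_disjoint: "u \<in> supported C \<Longrightarrow> B \<inter> C = {} \<Longrightarrow> homogeneous_part B u = 0"
proof -
  assume "u \<in> supported C" "B \<inter> C = {}"
  then have "homogeneous_part B u = lin_ext (\<lambda>_. 0) u"
    unfolding homogeneous_part_def by (intro lin_ext_cong) (auto simp: supported_def)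
  then show ?thesis by (simp add: lin_ext_def)
qed

text \<open>The projection onto the span of B fixes u. It sends each generator into W, so a
  combination of generators of mixed degrees may be replaced by one inside W.\<close>

lemma span_homogeneous:
  assumes "u \<in> pm.span X" "u \<in> supported B" "pm.subspace W"
    and "\<And>x. x \<in> X \<Longrightarrow> homogeneous_part B x \<in> W"
  shows "u \<in> W"
proof -
  have "homogeneous_part B u \<in> W"
    using assms(1)
  proof (induction rule: pm.span_induct_alt)
    case base
    then show ?case using pm.subspace_0[OF assms(3)] by (simp add: homogeneous_part_def)
  next
    case (step c x y)
    then show ?case
      using assms(4) unfolding homogeneous_part_def lin_ext_add lin_ext_scale
      by (intro pm.subspace_add[OF assms(3)] pm.subspace_scale[OF assms(3)]) auto
  qed
  then show ?thesis using homogeneous_part_id[OF assms(2)] by simp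
qed

text \<open>In contrast to the operadic ideal, labels may be repeated, so the span is stable under
  all products of trees.\<close>

definition rel_span :: "('a tree \<Rightarrow>\<^sub>0 'k::field) set" where
  "rel_span = pm.span {w. \<exists>M. rel_context M w}"

lemma rel_context_supported: "rel_context M w \<Longrightarrow> w \<in> supported {t. tree_inputs t = M}"
proof (induction rule: rel_context.induct)
  case (rel r s t u)
  then show ?case
    by (auto simp: is_rel_def prelie_rel_def leibniz_rel_def assoc_rel_def ac_simps
        intro!: pm.subspace_diff[OF subspace_supported])
next
  case (app M w t g)
  then show ?case by (elim supported_lin_ext) auto
qed

text \<open>All trees of a relation in context have the same multiset of inputs. The projection to
  trees with inputs 1, ..., n therefore either kills it or keeps it, and in the second case it lies
  in the ideal.\<close>

lemma rel_span_imp_ideal: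
  assumes "u \<in> rel_span" "u \<in> supported (trees n)"
  shows "operad_ideal free_operad comprelie_rels n u"
proof -
  have "u \<in> comprelie_ideal_at n"
    using assms(1) unfolding rel_span_def
  proof (rule span_homogeneous[OF _ assms(2) subspace_comprelie_ideal_at])
    fix w :: "nat tree \<Rightarrow>\<^sub>0 'a" assume "w \<in> {w. \<exists>M. rel_context M w}"
    then obtain M where M: "rel_context M w" by blast
    show "homogeneous_part (trees n) w \<in> comprelie_ideal_at n"
    proof (cases "M = mset_set {1..n}")
      case True
      then have "labelled comprelie_ideal_at {1..n} w" using M by (intro rel_context_labelled) auto
      then have "w \<in> comprelie_ideal_at n" by (rule labelled_interval)
      moreover have "w \<in> supported (trees n)"
        using rel_context_supported[OF M] by (simp add: True trees_def)
      ultimately show ?thesis by (simp add: homogeneous_part_id)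
    next
      case False
      then have "homogeneous_part (trees n) w = 0"
        by (intro homogeneous_part_disjoint[OF rel_context_supported[OF M]]) (auto simp: trees_def)
      then show ?thesis using pm.subspace_0[OF subspace_comprelie_ideal_at] by metis
    qed
  qed
  then show ?thesis by simp
qed

text \<open>\<open>comprelie_ideal\<close> adds up all arities. Trees of different arities have
  different numbers of inputs, so the projection isolates the part of arity n.\<close>

lemma comprelie_ideal_homogeneous:
  assumes "u \<in> comprelie_ideal" "u \<in> supported (trees n)"
  shows "operad_ideal free_operad comprelie_rels n u"
proof -
  have "u \<in> comprelie_ideal_at n"
    using assms(1) unfolding comprelie_ideal_def
  proof (rule span_homogeneous[OF _ assms(2) subspace_comprelie_ideal_at])
    fix w :: "nat tree \<Rightarrow>\<^sub>0 'a" assume "w \<in> (\<Union>n. comprelie_ideal_at n)"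
    then obtain m where m: "w \<in> comprelie_ideal_at m" by blast
    then have w: "w \<in> supported (trees m)" using comprelie_ideal_at_supported by blast
    show "homogeneous_part (trees n) w \<in> comprelie_ideal_at n"
    proof (cases "m = n")
      case True
      then show ?thesis using m homogeneous_part_id[OF w] by simp
    next
      case False
      have "trees n \<inter> trees m = {}"
        using False arg_cong[of "mset_set {1..n}" "mset_set {1..m}" size] by (auto simp: trees_def)
      then have "homogeneous_part (trees n) w = 0"
        by (rule homogeneous_part_disjoint[OF w])
      then show ?thesis using pm.subspace_0[OF subspace_comprelie_ideal_at] by metis
    qed
  qed
  then show ?thesis by simp
qed

section \<open>The operad ComPreLie\<close>

lemma comprelie_class_eq_iff: "comprelie_class u = comprelie_class v \<longleftrightarrow> u - v \<in> comprelie_ideal"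
  by (simp add: comprelie.abs_eq_iff comprelie_cong_def)

lemma comprelie_class_eq_iff_ideal:
  assumes "u \<in> ops free_operad n" "v \<in> ops free_operad n"
  shows "comprelie_class u = comprelie_class v \<longleftrightarrow>
    operad_ideal free_operad comprelie_rels n (u - v)"
proof
  assume "comprelie_class u = comprelie_class v"
  then show "operad_ideal free_operad comprelie_rels n (u - v)"
    using assms by (intro comprelie_ideal_homogeneous)
      (auto simp: comprelie_class_eq_iff free_operad_simps intro: pm.subspace_diff[OF subspace_supported])
next
  assume "operad_ideal free_operad comprelie_rels n (u - v)"
  then show "comprelie_class u = comprelie_class v"
    unfolding comprelie_class_eq_iff comprelie_ideal_def by (blast intro: pm.span_base)
qed

lemma comprelie_class_ops:
  assumes "u \<in> ops free_operad n"
  obtains v where "comprelie_rep n (comprelie_class u) = v" "v \<in> ops free_operad n"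
    "operad_ideal free_operad comprelie_rels n (v - u)"
proof
  let ?v = "comprelie_rep n (comprelie_class u)"
  have *: "?v \<in> ops free_operad n \<and> comprelie_class ?v = comprelie_class u"
    unfolding comprelie_rep_def by (rule someI[of _ u]) (simp add: assms)
  then show "?v \<in> ops free_operad n" by simp
  show "operad_ideal free_operad comprelie_rels n (?v - u)"
    using * assms comprelie_class_eq_iff_ideal by blast
qed simp

lemma comprelie_vector_space: "vector_space (comprelie_scale :: 'k::field \<Rightarrow> 'k comprelie \<Rightarrow> _)"
proof
  have refl: "comprelie_cong u u" for u :: "nat tree \<Rightarrow>\<^sub>0 'k"
    using equivp_comprelie_cong by (rule equivp_reflp)
  fix a b :: 'k and x y :: "'k comprelie"
  show "comprelie_scale a (x + y) = comprelie_scale a x + comprelie_scale a y"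
    by transfer (simp add: refl pm.scale_right_distrib)
  show "comprelie_scale (a + b) x = comprelie_scale a x + comprelie_scale b x"
    by transfer (simp add: refl pm.scale_left_distrib)
  show "comprelie_scale a (comprelie_scale b x) = comprelie_scale (a * b) x"
    by transfer (simp add: refl)
  show "comprelie_scale 1 x = x"
    by transfer (simp add: refl)
qed

lemma comprelie_class_hom:
  "operad_hom free_operad (ComPreLie :: ('k::field, 'k comprelie) operad_data) (\<lambda>_. comprelie_class)"
proof (rule operad_image[OF operad_free_operad])
  interpret F: operad "free_operad :: ('k, nat tree \<Rightarrow>\<^sub>0 'k) operad_data"
    by (rule operad_free_operad)
  note ideal = operad_ideal.intros[where P = free_operad and R = comprelie_rels]
  have minus: "p - q \<in> ops free_operad n" if "p \<in> ops free_operad n" "q \<in> ops free_operad n"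
    for n and p q :: "nat tree \<Rightarrow>\<^sub>0 'k"
    using that pm.subspace_diff[OF subspace_supported] by (auto simp: free_operad_simps)
  show "vector_space (scale (ComPreLie :: ('k, 'k comprelie) operad_data))"
    by (simp add: ComPreLie_def comprelie_vector_space)
  show "comprelie_class (p + p') = comprelie_class p + comprelie_class p'"
    for p p' :: "nat tree \<Rightarrow>\<^sub>0 'k"
    by (simp add: plus_comprelie.abs_eq)
  show "comprelie_class (scale free_operad a p) = scale ComPreLie a (comprelie_class p)"
    for a and p :: "nat tree \<Rightarrow>\<^sub>0 'k"
    by (simp add: comprelie_scale.abs_eq ComPreLie_def free_operad_simps)
  show "act ComPreLie n \<sigma> (comprelie_class p) = comprelie_class (act free_operad n \<sigma> p)"
    if H: "\<sigma> permutes {1..n}" "p \<in> ops free_operad n" for n \<sigma> and p :: "nat tree \<Rightarrow>\<^sub>0 'k"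
  proof -
    obtain v where v: "comprelie_rep n (comprelie_class p) = v" "v \<in> ops free_operad n"
      "operad_ideal free_operad comprelie_rels n (v - p)"
      using comprelie_class_ops[OF H(2)] .
    have "act free_operad n \<sigma> v - act free_operad n \<sigma> p = act free_operad n \<sigma> (v - p)"
      by (simp add: free_operad_simps relabel_def lin_ext_diff)
    then show ?thesis
      using comprelie_class_eq_iff_ideal[OF F.act_closed[OF that(1) v(2)] F.act_closed[OF that]]
        ideal(5)[OF v(3) that(1)] by (simp add: ComPreLie_def v(1))
  qed
  show "pcomp ComPreLie m n i (comprelie_class p) (comprelie_class q) =
      comprelie_class (pcomp free_operad m n i p q)"
    if H: "i \<in> {1..m}" "p \<in> ops free_operad m" "q \<in> ops free_operad n"
    for m n i and p q :: "nat tree \<Rightarrow>\<^sub>0 'k"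
  proof -
    obtain v where v: "comprelie_rep m (comprelie_class p) = v" "v \<in> ops free_operad m"
      "operad_ideal free_operad comprelie_rels m (v - p)"
      using comprelie_class_ops[OF H(2)] .
    obtain w where w: "comprelie_rep n (comprelie_class q) = w" "w \<in> ops free_operad n"
      "operad_ideal free_operad comprelie_rels n (w - q)"
      using comprelie_class_ops[OF H(3)] .
    \<comment> \<open>The arguments are replaced one at a time, so that each term has one factor in
      the ideal.\<close>
    have "pcomp free_operad m n i v w - pcomp free_operad m n i p q =
        pcomp free_operad m n i (v - p) w + pcomp free_operad m n i p (w - q)"
      by (simp add: free_operad_simps bilin_ext_diff_left bilin_ext_diff_right)
    moreover have "operad_ideal free_operad comprelie_rels (m + n - 1) \<dots>"
      by (intro ideal(3) ideal(6) ideal(7) v w that)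
    ultimately show ?thesis
      using comprelie_class_eq_iff_ideal[OF F.pcomp_closed[OF that(1) v(2) w(2)] F.pcomp_closed[OF that]]
      by (simp add: ComPreLie_def v(1) w(1))
  qed
qed (simp_all add: ComPreLie_def)

section \<open>Forests of rooted hypertrees as sets of arcs\<close>

text \<open>
  An edge with parent vertex \<open>p\<close> and set \<open>B\<close> of children is encoded by the arc \<open>(p, B)\<close>; the
  function \<open>d\<close> is the depth.
\<close>

locale arc_forest =
  fixes S :: "'a rooted_hypergraph" and A :: "('a \<times> 'a set) set" and d :: "'a \<Rightarrow> nat"
  assumes finite_verts: "finite (verts S)" and verts_nonempty: "verts S \<noteq> {}"
    and roots_verts: "roots S \<subseteq> verts S"
    and edges_arcs: "edges S = (\<lambda>(p, B). insert p B) ` A"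
    and arc_verts: "(p, B) \<in> A \<Longrightarrow> p \<in> verts S" "(p, B) \<in> A \<Longrightarrow> B \<subseteq> verts S"
    and arc_nonempty: "(p, B) \<in> A \<Longrightarrow> B \<noteq> {}"
    and depth_arc: "(p, B) \<in> A \<Longrightarrow> b \<in> B \<Longrightarrow> d b = Suc (d p)"
    and depth_root: "r \<in> roots S \<Longrightarrow> d r = 0"
    and arc_ex: "v \<in> verts S \<Longrightarrow> v \<notin> roots S \<Longrightarrow> \<exists>p B. (p, B) \<in> A \<and> v \<in> B"
    and arc_unique: "(p, B) \<in> A \<Longrightarrow> (q, C) \<in> A \<Longrightarrow> v \<in> B \<Longrightarrow> v \<in> C \<Longrightarrow> p = q \<and> B = C"

definition child_rel :: "('a \<times> 'a set) set \<Rightarrow> 'a rel" where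
  "child_rel A = {(p, b). \<exists>B. (p, B) \<in> A \<and> b \<in> B}"

context arc_forest
begin

lemma child_vert: "(p, B) \<in> A \<Longrightarrow> b \<in> B \<Longrightarrow> b \<in> verts S"
  using arc_verts(2) by blast

lemma finite_arcs: "finite A"
proof (rule finite_subset)
  show "A \<subseteq> verts S \<times> Pow (verts S)" using arc_verts(1) child_vert by auto
qed (simp add: finite_verts)

lemma parent_notin: "(p, B) \<in> A \<Longrightarrow> p \<notin> B"
  using depth_arc by fastforce

lemma arc_not_root: "(p, B) \<in> A \<Longrightarrow> b \<in> B \<Longrightarrow> b \<notin> roots S"
  using depth_arc depth_root by fastforce

lemma depth_0: "v \<in> verts S \<Longrightarrow> d v = 0 \<longleftrightarrow> v \<in> roots S"
  using arc_ex depth_arc depth_root by fastforce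

lemma reach_root: "v \<in> verts S \<Longrightarrow> \<exists>r\<in>roots S. (r, v) \<in> child_rel A ^^ d v"
proof (induction "d v" arbitrary: v)
  case 0
  then show ?case using depth_0 by (metis relpow_0_I)
next
  case (Suc n)
  then obtain p B where B: "(p, B) \<in> A" "v \<in> B" using depth_0 arc_ex by (metis nat.distinct(1))
  then have "d p = n" using depth_arc Suc(2) by fastforce
  then obtain r where "r \<in> roots S" "(r, p) \<in> child_rel A ^^ n" using Suc(1) arc_verts(1) B by blast
  moreover have "(p, v) \<in> child_rel A" using B by (auto simp: child_rel_def)
  ultimately show ?case using Suc(2) by (metis relpow_Suc_I)
qed

lemma roots_nonempty: "roots S \<noteq> {}"
  using reach_root verts_nonempty by blast

lemma child_rel_adjacency: "child_rel A \<subseteq> adjacency (edges S)"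
  by (fastforce simp: child_rel_def adjacency_def edges_arcs)

lemma relpow_child_rel: "(u, v) \<in> child_rel A ^^ n \<Longrightarrow> (u, v) \<in> adjacency (edges S) ^^ n"
  using child_rel_adjacency by (induction n arbitrary: v) auto

lemma depth_adjacency: "(u, v) \<in> adjacency (edges S) \<Longrightarrow> d v \<le> Suc (d u)"
  by (auto simp: adjacency_def edges_arcs) (metis depth_arc le_Suc_eq le_refl)+

text \<open>A path of parents from a root has length d v, and no path from a root is shorter because
  the depth grows by at most one along an edge.\<close>

lemma root_dist_depth:
  assumes "v \<in> verts S"
  shows "root_dist S v = d v"
  unfolding root_dist_def
proof (rule Least_equality)
  show "\<exists>r\<in>roots S. (r, v) \<in> adjacency (edges S) ^^ d v"
    using reach_root[OF assms] relpow_child_rel by blast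
next
  have "(u, w) \<in> adjacency (edges S) ^^ n \<Longrightarrow> d w \<le> d u + n" for n u w
  proof (induction n arbitrary: w)
    case (Suc n)
    then show ?case using depth_adjacency by fastforce
  qed auto
  then show "d v \<le> n" if "\<exists>r\<in>roots S. (r, v) \<in> adjacency (edges S) ^^ n" for n
    using that depth_root by fastforce
qed

lemma parent_of_iff: "parent_of S v e \<longleftrightarrow> (\<exists>B. (v, B) \<in> A \<and> e = insert v B)"
proof
  assume *: "parent_of S v e"
  then obtain p B where B: "(p, B) \<in> A" "e = insert p B" by (auto simp: parent_of_def edges_arcs)
  have "v = p"
  proof (rule ccontr)
    assume "v \<noteq> p"
    then have "v \<in> B" "root_dist S v < root_dist S p" using * B by (auto simp: parent_of_def)
    then show False using B arc_verts[OF B(1)] depth_arc[OF B(1)] by (auto simp: root_dist_depth)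
  qed
  then show "\<exists>B. (v, B) \<in> A \<and> e = insert v B" using B by blast
next
  assume "\<exists>B. (v, B) \<in> A \<and> e = insert v B"
  then obtain B where B: "(v, B) \<in> A" "e = insert v B" by blast
  moreover have "root_dist S w = Suc (root_dist S v)" if "w \<in> B" for w
    using that arc_verts[OF B(1)] depth_arc[OF B(1)] by (auto simp: root_dist_depth)
  ultimately show "parent_of S v e" by (force simp: parent_of_def edges_arcs)
qed

lemma incoming_arcs: "incoming S v = {insert v B |B. (v, B) \<in> A}"
  by (auto simp: incoming_def parent_of_iff)

lemma child_via_iff: "child_via S v e \<longleftrightarrow> (\<exists>p B. (p, B) \<in> A \<and> v \<in> B \<and> e = insert p B)"
  unfolding child_via_def parent_of_iff by (auto dest: parent_notin)

end

text \<open>Defined from S alone; \<open>arcs_eq\<close> shows that every arc structure on S is this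
  one.\<close>

definition arcs :: "'a rooted_hypergraph \<Rightarrow> ('a \<times> 'a set) set" where
  "arcs S = {(p, e - {p}) |p e. parent_of S p e}"

lemma (in arc_forest) arcs_eq: "arcs S = A"
proof -
  have eq: "B - {p} = B" if "(p, B) \<in> A" for p B using parent_notin[OF that] by simp
  show ?thesis
  proof
    show "arcs S \<subseteq> A" by (auto simp: arcs_def parent_of_iff eq)
    show "A \<subseteq> arcs S"
    proof
      fix a assume a: "a \<in> A"
      obtain p B where pB: "a = (p, B)" by (cases a)
      then have "parent_of S p (insert p B)" "insert p B - {p} = B"
        using a parent_notin by (auto simp: parent_of_iff)
      then show "a \<in> arcs S" unfolding arcs_def pB by blast
    qed
  qed
qed

text \<open>At a deepest vertex of the cycle both neighbouring edges have this vertex as a child,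
  since the parent of an edge is less deep than its other vertices. A vertex is a child via one edge
  only, so the two edges coincide.\<close>

lemma (in arc_forest) no_cycle:
  assumes "E \<subseteq> edges S"
  shows "\<not> hyper_cycle V E vs es"
proof
  assume cyc: "hyper_cycle V E vs es"
  let ?n = "length vs"
  have n: "?n \<ge> 2" "length es = ?n" and dist: "distinct vs" "distinct es" and es: "set es \<subseteq> E"
    and inc: "\<And>i. i < ?n \<Longrightarrow> vs ! i \<in> es ! (Suc i mod ?n) \<and> vs ! (Suc i mod ?n) \<in> es ! (Suc i mod ?n)"
    using cyc by (auto simp: hyper_cycle_def)
  define M where "M = Max ((\<lambda>i. d (vs ! i)) ` {..<?n})"
  have "(\<lambda>i. d (vs ! i)) ` {..<?n} \<noteq> {}" using n(1) by (cases vs) auto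
  then have "M \<in> (\<lambda>i. d (vs ! i)) ` {..<?n}" unfolding M_def by (intro Max_in) auto
  then obtain k where k: "k < ?n" "d (vs ! k) = M" by auto
  then have max: "d (vs ! i) \<le> d (vs ! k)" if "i < ?n" for i
    using that by (auto simp: M_def)
  note k = k(1)
  \<comment> \<open>The cyclic predecessor of k; adding the length before subtracting 1 avoids
    truncation at k = 0.\<close>
  define j where "j = (k + ?n - 1) mod ?n"
  define l where "l = Suc k mod ?n"
  have jl: "j < ?n" "l < ?n" unfolding j_def l_def using n(1) by (intro mod_less_divisor; linarith)+
  have jk: "Suc j mod ?n = k"
  proof -
    have "Suc j mod ?n = Suc (k + ?n - 1) mod ?n" unfolding j_def by (rule mod_Suc_eq)
    also have "Suc (k + ?n - 1) = k + ?n" using n(1) by linarith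
    finally show ?thesis using k by simp
  qed
  have neq: "j \<noteq> k" "l \<noteq> k"
  proof -
    show "l \<noteq> k"
    proof (cases "Suc k = ?n")
      case True
      then show ?thesis using n(1) by (simp add: l_def)
    next
      case False
      then show ?thesis using k by (simp add: l_def)
    qed
    then show "j \<noteq> k" using jk by (auto simp: l_def)
  qed
  \<comment> \<open>If the vertex with index k were the parent of e, the other cycle vertex on e
    would be deeper than the maximum.\<close>
  have child: "\<exists>p B. (p, B) \<in> A \<and> vs ! k \<in> B \<and> e = insert p B"
    if H: "e \<in> edges S" "vs ! k \<in> e" "vs ! i \<in> e" "i < ?n" "i \<noteq> k" for e i
  proof -
    obtain p B where B: "(p, B) \<in> A" "e = insert p B" using H by (auto simp: edges_arcs)
    have "vs ! i \<noteq> vs ! k" using H dist k by (simp add: nth_eq_iff_index_eq)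
    then have "vs ! k \<noteq> p" using H(3) B depth_arc[OF B(1), of "vs ! i"] max[OF H(4)] by auto
    then show ?thesis using B H(2) by blast
  qed
  have "es ! k \<in> edges S" "es ! l \<in> edges S"
    using es assms n(2) k jl(2) nth_mem by (metis subsetD)+
  then have "\<exists>p B. (p, B) \<in> A \<and> vs ! k \<in> B \<and> es ! k = insert p B"
    "\<exists>p B. (p, B) \<in> A \<and> vs ! k \<in> B \<and> es ! l = insert p B"
    using child[OF _ _ _ jl(1) neq(1)] child[OF _ _ _ jl(2) neq(2)]
      inc[OF jl(1), unfolded jk] inc[OF k, folded l_def] by blast+
  then have "es ! k = es ! l" using arc_unique by metis
  then show False using dist(2) n(2) k jl(2) neq(2) by (simp add: nth_eq_iff_index_eq)
qed

section \<open>Arc structures and forests of hypertrees\<close>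

lemma adjacency_mono: "E \<subseteq> F \<Longrightarrow> adjacency E \<subseteq> adjacency F"
  by (auto simp: adjacency_def)

lemma adjacency_sym: "sym ((adjacency E)\<^sup>*)"
  by (rule sym_rtrancl) (auto simp: adjacency_def sym_def)

text \<open>The hypertree of a root r consists of the vertices that are reachable from r through
  children. Following parents backwards is deterministic, so these vertex sets are disjoint for
  different roots.\<close>

lemma (in arc_forest) in_forests: "S \<in> forests (verts S)"
proof -
  define D where "D r = {v. (r, v) \<in> (child_rel A)\<^sup>*}" for r
  define H where "H r = \<lparr>verts = D r, edges = {insert p B |p B. (p, B) \<in> A \<and> p \<in> D r}, roots = {r}\<rparr>" for r
  have closed: "b \<in> D r" if "(p, B) \<in> A" "p \<in> D r" "b \<in> B" for p B b r
    using that by (auto simp: D_def child_rel_def intro: rtrancl_into_rtrancl)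
  have self: "r \<in> D r" for r by (simp add: D_def)
  have D_verts: "D r \<subseteq> verts S" if "r \<in> roots S" for r
  proof
    fix v assume "v \<in> D r"
    then have "(r, v) \<in> (child_rel A)\<^sup>*" by (simp add: D_def)
    then show "v \<in> verts S"
      by (induction rule: rtrancl_induct) (use that roots_verts child_vert in \<open>auto simp: child_rel_def\<close>)
  qed
  have incr: "x = y \<or> d x < d y" if "(x, y) \<in> (child_rel A)\<^sup>*" for x y
    using that by (induction rule: rtrancl_induct) (auto simp: child_rel_def dest: depth_arc)
  have uniq: "r = r'" if "(r, v) \<in> (child_rel A)\<^sup>*" "(r', v) \<in> (child_rel A)\<^sup>*"
    "r \<in> roots S" "r' \<in> roots S" for r r' v
    using that(1,2)
  proof (induction rule: rtrancl_induct)
    case base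
    then show ?case using incr depth_root that by fastforce
  next
    case (step y z)
    from step.prems show ?case
    proof (cases rule: rtranclE)
      case base
      then have "d r' = Suc (d y)" using step.hyps(2) depth_arc by (auto simp: child_rel_def)
      then show ?thesis using depth_root that by simp
    next
      case (step y')
      then have "y' = y" using \<open>(y, z) \<in> child_rel A\<close> arc_unique by (fastforce simp: child_rel_def)
      then show ?thesis using step \<open>(r', y) \<in> (child_rel A)\<^sup>* \<Longrightarrow> r = r'\<close> by blast
    qed
  qed
  have cover: "\<exists>r\<in>roots S. v \<in> D r" if "v \<in> verts S" for v
    using reach_root[OF that] by (auto simp: D_def dest: relpow_imp_rtrancl)
  have tree: "rooted_hypertree (H r)" if r: "r \<in> roots S" for r
    unfolding rooted_hypertree_def
  proof (intro conjI)
    show "hypergraph (verts (H r)) (edges (H r))"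
      unfolding hypergraph_def
    proof (intro conjI ballI)
      show fin: "finite (verts (H r))" using D_verts[OF r] finite_verts by (simp add: H_def finite_subset)
      fix e assume "e \<in> edges (H r)"
      then obtain p B where B: "(p, B) \<in> A" "p \<in> D r" "e = insert p B" by (auto simp: H_def)
      then show e: "e \<subseteq> verts (H r)" using closed by (auto simp: H_def)
      have "finite B" using e fin B by (auto intro: finite_subset)
      then show "2 \<le> card e"
        using B parent_notin[OF B(1)] arc_nonempty[OF B(1)] by (simp add: Suc_le_eq card_gt_0_iff)
    qed
    have "(r, v) \<in> (adjacency (edges (H r)))\<^sup>*" if "v \<in> D r" for v
    proof -
      have "(r, v) \<in> (child_rel A)\<^sup>*" using that by (simp add: D_def)
      then show ?thesis
      proof (induction rule: rtrancl_induct)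
        case (step y z)
        then obtain B where B: "(y, B) \<in> A" "z \<in> B" by (auto simp: child_rel_def)
        have "y \<in> D r" using step by (simp add: D_def)
        then have "insert y B \<in> edges (H r)" using B by (auto simp: H_def)
        then have "(y, z) \<in> adjacency (edges (H r))" using B by (auto simp: adjacency_def)
        then show ?case using step by auto
      qed simp
    qed
    note conn = this
    show "hyper_connected (verts (H r)) (edges (H r))"
      unfolding hyper_connected_def
    proof (intro ballI)
      fix u v assume "u \<in> verts (H r)" "v \<in> verts (H r)"
      then have "u \<in> D r" "v \<in> D r" by (simp_all add: H_def)
      then show "(u, v) \<in> (adjacency (edges (H r)))\<^sup>*"
        using rtrancl_trans[OF symD[OF adjacency_sym conn] conn] by blast
    qed
    have "edges (H r) \<subseteq> edges S" by (auto simp: H_def edges_arcs)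
    then show "\<nexists>vs es. hyper_cycle (verts (H r)) (edges (H r)) vs es" using no_cycle by blast
  qed (use self in \<open>auto simp: H_def\<close>)
  have verts: "verts S = \<Union>(verts ` H ` roots S)"
    using cover D_verts by (auto simp: H_def)
  have edges: "edges S = \<Union>(edges ` H ` roots S)"
  proof
    show "edges S \<subseteq> \<Union>(edges ` H ` roots S)"
    proof
      fix e assume "e \<in> edges S"
      then obtain p B where B: "(p, B) \<in> A" "e = insert p B" by (auto simp: edges_arcs)
      obtain r where r: "r \<in> roots S" "p \<in> D r" using cover arc_verts(1)[OF B(1)] by blast
      then have "e \<in> edges (H r)" using B by (auto simp: H_def)
      then show "e \<in> \<Union>(edges ` H ` roots S)" using r(1) by blast
    qed
    show "\<Union>(edges ` H ` roots S) \<subseteq> edges S" by (auto simp: H_def edges_arcs)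
  qed
  have "S = \<lparr>verts = \<Union>(verts ` H ` roots S), edges = \<Union>(edges ` H ` roots S), roots = \<Union>(roots ` H ` roots S)\<rparr>"
    using verts edges by (intro rooted_hypergraph.equality) (simp_all add: H_def)
  moreover have "disjoint_family_on verts (H ` roots S)"
    unfolding disjoint_family_on_def
  proof (intro ballI impI)
    fix X Y assume "X \<in> H ` roots S" "Y \<in> H ` roots S" "X \<noteq> Y"
    then obtain r r' where r: "r \<in> roots S" "r' \<in> roots S" "X = H r" "Y = H r'" "r \<noteq> r'" by blast
    then have "D r \<inter> D r' = {}" using uniq[OF _ _ r(1,2)] by (auto simp: D_def)
    then show "verts X \<inter> verts Y = {}" by (simp add: r H_def)
  qed
  moreover have "finite (H ` roots S)" using finite_verts roots_verts by (blast intro: finite_subset)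
  ultimately show ?thesis
    unfolding forests_def using tree roots_nonempty
    by (intro CollectI conjI exI[of _ "H ` roots S"]) auto
qed

text \<open>A shortest path avoiding \<open>e\<close> between two vertices of \<open>e\<close> is closed to a cycle by \<open>e\<close>.\<close>

lemma acyclic_bridge:
  assumes hyp: "\<And>e. e \<in> E \<Longrightarrow> e \<subseteq> V" and acyc: "\<nexists>vs es. hyper_cycle V E vs es"
    and e: "e \<in> E" "u \<in> e" "w \<in> e" "u \<noteq> w"
  shows "(u, w) \<notin> (adjacency (E - {e}))\<^sup>*"
proof
  let ?R = "adjacency (E - {e})"
  assume "(u, w) \<in> ?R\<^sup>*"
  then have "\<exists>n. (u, w) \<in> ?R ^^ n" by (simp add: rtrancl_is_UN_relpow)
  then obtain n where n: "(u, w) \<in> ?R ^^ n" and min: "\<And>m. m < n \<Longrightarrow> (u, w) \<notin> ?R ^^ m"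
    using exists_least_iff[of "\<lambda>n. (u, w) \<in> ?R ^^ n"] by blast
  obtain f where f: "f 0 = u" "f n = w" and step: "\<And>i. i < n \<Longrightarrow> (f i, f (Suc i)) \<in> ?R"
    using n by (auto simp: relpow_fun_conv)
  have "\<forall>i<n. \<exists>c. c \<in> E - {e} \<and> f i \<in> c \<and> f (Suc i) \<in> c"
    using step by (fastforce simp: adjacency_def)
  then obtain g where g: "\<And>i. i < n \<Longrightarrow> g i \<in> E - {e} \<and> f i \<in> g i \<and> f (Suc i) \<in> g i" by metis
  \<comment> \<open>A shorter connection between two vertices of the path would shorten the whole
    path. The case m = 0 makes the vertices distinct, the case m = 1 the edges.\<close>
  have shortest: "j - i \<le> m" if "i < j" "j \<le> n" "(f i, f j) \<in> ?R ^^ m" for i j m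
  proof (rule ccontr)
    assume "\<not> j - i \<le> m"
    have "(f 0, f i) \<in> ?R ^^ i"
      unfolding relpow_fun_conv by (rule exI[of _ f]) (use step that in auto)
    moreover have "(f j, f n) \<in> ?R ^^ (n - j)"
      unfolding relpow_fun_conv by (rule exI[of _ "\<lambda>k. f (j + k)"]) (use step that in auto)
    ultimately have "(u, w) \<in> ?R ^^ (i + m + (n - j))"
      using that(3) unfolding f relpow_add by blast
    then show False using min[of "i + m + (n - j)"] \<open>\<not> j - i \<le> m\<close> that by linarith
  qed
  have fneq: "f i \<noteq> f j" if "i < j" "j \<le> n" for i j
    using shortest[OF that, of 0] that by auto
  have gneq: "g i \<noteq> g j" if "i < j" "j < n" for i j
  proof
    assume "g i = g j"
    then have "(f i, f (Suc j)) \<in> ?R ^^ 1"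
      using g[of i] g[of j] that by (auto simp: adjacency_def)
    then show False using shortest[of i "Suc j" 1] that by auto
  qed
  have n0: "n > 0" using f e(4) by (cases n) auto
  \<comment> \<open>In \<open>hyper_cycle\<close> the edge with index 0 joins the last vertex to the
    first one; hence e comes first.\<close>
  let ?vs = "map f [0..<Suc n]" and ?es = "e # map g [0..<n]"
  have "hyper_cycle V E ?vs ?es"
    unfolding hyper_cycle_def
  proof (intro conjI allI impI)
    show "set ?vs \<subseteq> V"
    proof -
      have "f i \<in> V" if "i \<le> n" for i
      proof (cases "i < n")
        case True
        then show ?thesis using g hyp by blast
      next
        case False
        then show ?thesis using that f(2) e hyp by auto
      qed
      then show ?thesis by auto
    qed
    show "set ?es \<subseteq> E" using g e by auto
    have "inj_on f {0..<Suc n}" unfolding inj_on_def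
      by (metis atLeastLessThan_iff fneq less_Suc_eq_le linorder_neqE_nat)
    then show "distinct ?vs" by (simp only: distinct_map distinct_upt set_upt simp_thms)
    have "inj_on g {0..<n}" unfolding inj_on_def
      by (metis atLeastLessThan_iff gneq linorder_neqE_nat)
    moreover have "e \<notin> g ` {0..<n}" using g by fastforce
    ultimately show "distinct ?es" by (simp add: distinct_map)
    fix i assume i: "i < length ?vs"
    have "?vs ! i \<in> ?es ! (Suc i mod length ?vs) \<and> ?vs ! (Suc i mod length ?vs) \<in> ?es ! (Suc i mod length ?vs)"
    proof (cases "i = n")
      case True
      then show ?thesis using e f n0 by (simp add: nth_append)
    next
      case False
      then have i: "i < n" "Suc i mod length ?vs = Suc i" using i by auto
      have nth: "?vs ! j = f j" if "j \<le> n" for j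
        using that nth_map_upt[of j "Suc n" 0 f] by simp
      have "?vs ! i = f i" "?vs ! Suc i = f (Suc i)" "?es ! Suc i = g i"
        using i(1) nth[of i] nth[of "Suc i"] by simp_all
      then show ?thesis unfolding i(2) using g[OF i(1)] by simp
    qed
    then show "?vs ! i \<in> ?es ! (Suc i mod length ?vs)"
      "?vs ! (Suc i mod length ?vs) \<in> ?es ! (Suc i mod length ?vs)" by auto
  qed (use n0 in auto)
  then show False using acyc by blast
qed

text \<open>With d the distance to the root, an edge has only one vertex of least distance, and all
  others are one level further: two vertices on the lowest level of an edge are joined through the
  root without this edge, against \<open>acyclic_bridge\<close>. A similar detour shows that a
  vertex is a child via one edge only.\<close>

lemma hypertree_arc_forest:
  assumes "rooted_hypertree H"
  shows "\<exists>A d. arc_forest H A d"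
proof -
  let ?V = "verts H" and ?E = "edges H"
  obtain r where r: "r \<in> ?V" "roots H = {r}" using assms by (auto simp: rooted_hypertree_def)
  have hyp: "finite ?V" "\<And>e. e \<in> ?E \<Longrightarrow> e \<subseteq> ?V" "\<And>e. e \<in> ?E \<Longrightarrow> card e \<ge> 2"
    and conn: "hyper_connected ?V ?E" and acyc: "\<nexists>vs es. hyper_cycle ?V ?E vs es"
    using assms by (auto simp: rooted_hypertree_def hypergraph_def)
  note bridge = acyclic_bridge[OF hyp(2) acyc]
  define d where "d v = (LEAST n. (r, v) \<in> adjacency ?E ^^ n)" for v
  have d: "(r, v) \<in> adjacency ?E ^^ d v" if "v \<in> ?V" for v
  proof -
    have "(r, v) \<in> (adjacency ?E)\<^sup>*" using conn r that by (auto simp: hyper_connected_def)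
    then show ?thesis unfolding d_def by (auto simp: rtrancl_is_UN_relpow intro: LeastI)
  qed
  have d_le: "d v \<le> n" if "(r, v) \<in> adjacency ?E ^^ n" for v n
    using that unfolding d_def by (rule Least_le)
  have d_step: "d v \<le> Suc (d u)" if "u \<in> e" "v \<in> e" "e \<in> ?E" for u v e
  proof -
    have "(r, u) \<in> adjacency ?E ^^ d u" using that hyp(2) d by blast
    then have "(r, v) \<in> adjacency ?E ^^ Suc (d u)"
      using that by (intro relpow_Suc_I) (auto simp: adjacency_def)
    then show ?thesis by (rule d_le)
  qed
  have d_root: "d r = 0" using d_le[of r 0] by simp
  have d_pred: "\<exists>e\<in>?E. \<exists>u\<in>e. v \<in> e \<and> d v = Suc (d u)" if v: "v \<in> ?V" "v \<noteq> r" for v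
  proof (cases "d v")
    case 0
    then show ?thesis using d[OF v(1)] v(2) by simp
  next
    case (Suc n)
    then obtain u where u: "(r, u) \<in> adjacency ?E ^^ n" "(u, v) \<in> adjacency ?E"
      using d[OF v(1)] by auto
    then obtain e where e: "e \<in> ?E" "u \<in> e" "v \<in> e" by (auto simp: adjacency_def)
    then show ?thesis using d_le[OF u(1)] d_step[OF e(2,3,1)] Suc by (intro bexI[of _ e] bexI[of _ u]) auto
  qed
  \<comment> \<open>A shortest path to v moves one level at a time, so each of its edges contains a
    step between consecutive levels up to d v.\<close>
  have path: "(r, v) \<in> (adjacency {e \<in> ?E. \<exists>x\<in>e. \<exists>y\<in>e. d y = Suc (d x) \<and> d y \<le> d v})\<^sup>*" if "v \<in> ?V" for v
    using that
  proof (induction "d v" arbitrary: v rule: less_induct)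
    case less
    show ?case
    proof (cases "v = r")
      case False
      then obtain e u where e: "e \<in> ?E" "u \<in> e" "v \<in> e" "d v = Suc (d u)" using d_pred less.prems by blast
      have "{e \<in> ?E. \<exists>x\<in>e. \<exists>y\<in>e. d y = Suc (d x) \<and> d y \<le> d u}
          \<subseteq> {e \<in> ?E. \<exists>x\<in>e. \<exists>y\<in>e. d y = Suc (d x) \<and> d y \<le> d v}"
      proof
        fix c assume "c \<in> {e \<in> ?E. \<exists>x\<in>e. \<exists>y\<in>e. d y = Suc (d x) \<and> d y \<le> d u}"
        then obtain x y where "c \<in> ?E" "x \<in> c" "y \<in> c" "d y = Suc (d x)" "d y \<le> d v"
          using e(4) by auto
        then show "c \<in> {e \<in> ?E. \<exists>x\<in>e. \<exists>y\<in>e. d y = Suc (d x) \<and> d y \<le> d v}" by blast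
      qed
      then have "adjacency {e \<in> ?E. \<exists>x\<in>e. \<exists>y\<in>e. d y = Suc (d x) \<and> d y \<le> d u}
          \<subseteq> adjacency {e \<in> ?E. \<exists>x\<in>e. \<exists>y\<in>e. d y = Suc (d x) \<and> d y \<le> d v}"
        by (rule adjacency_mono)
      moreover have "(r, u) \<in> (adjacency {e \<in> ?E. \<exists>x\<in>e. \<exists>y\<in>e. d y = Suc (d x) \<and> d y \<le> d u})\<^sup>*"
        using less.hyps[of u] e hyp(2) by auto
      moreover have "(u, v) \<in> adjacency {e \<in> ?E. \<exists>x\<in>e. \<exists>y\<in>e. d y = Suc (d x) \<and> d y \<le> d v}"
        using e unfolding adjacency_def by blast
      ultimately show ?thesis by (meson rtrancl.rtrancl_into_rtrancl rtrancl_mono subsetD)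
    qed simp
  qed
  \<comment> \<open>An edge whose steps between consecutive levels all end deeper than v cannot
    occur on such a path.\<close>
  have avoid: "(r, v) \<in> (adjacency (?E - {e}))\<^sup>*"
    if "v \<in> ?V" "\<And>x y. x \<in> e \<Longrightarrow> y \<in> e \<Longrightarrow> d y = Suc (d x) \<Longrightarrow> d v < d y" for v e
  proof -
    have "{e \<in> ?E. \<exists>x\<in>e. \<exists>y\<in>e. d y = Suc (d x) \<and> d y \<le> d v} \<subseteq> ?E - {e}"
    proof
      fix c assume "c \<in> {e \<in> ?E. \<exists>x\<in>e. \<exists>y\<in>e. d y = Suc (d x) \<and> d y \<le> d v}"
      then obtain x y where "c \<in> ?E" "x \<in> c" "y \<in> c" "d y = Suc (d x)" "d y \<le> d v" by blast
      then show "c \<in> ?E - {e}" using that(2)[of x y] by auto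
    qed
    then show ?thesis using path[OF that(1)] rtrancl_mono[OF adjacency_mono] by blast
  qed
  have avoid2: "(u, v) \<in> (adjacency (?E - {e}))\<^sup>*"
    if "u \<in> ?V" "v \<in> ?V" "\<And>x y. x \<in> e \<Longrightarrow> y \<in> e \<Longrightarrow> d y = Suc (d x) \<Longrightarrow> d v < d y \<and> d u < d y" for u v e
    using avoid[OF that(1), of e] avoid[OF that(2), of e] that(3) adjacency_sym[of "?E - {e}"]
    by (meson rtrancl_trans symD)
  define A where "A = {(p, B). insert p B \<in> ?E \<and> p \<notin> B \<and> B \<noteq> {} \<and> (\<forall>b\<in>B. d b = Suc (d p))}"
  have edge: "\<exists>p B. e = insert p B \<and> (p, B) \<in> A" if e: "e \<in> ?E" for e
  proof -
    have "e \<noteq> {}" using hyp(3)[OF e] by auto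
    then obtain p where p: "p \<in> e" and min: "\<And>b. b \<in> e \<Longrightarrow> d p \<le> d b"
      using ex_has_least_nat[of "\<lambda>b. b \<in> e" _ d] by blast
    have "d b = Suc (d p)" if "b \<in> e - {p}" for b
    proof (rule ccontr)
      assume "d b \<noteq> Suc (d p)"
      then have "d b = d p" using d_step[OF p _ e, of b] min[of b] that by simp
      then have "(p, b) \<in> (adjacency (?E - {e}))\<^sup>*"
        using hyp(2)[OF e] p that min by (intro avoid2) (auto simp: less_Suc_eq_le)
      then show False using bridge e p that by blast
    qed
    moreover have "e - {p} \<noteq> {}" using hyp(3)[OF e] p
      by (metis One_nat_def Suc_1 card.empty card.insert_remove card_1_singleton_iff finite.emptyI
          insert_Diff not_less_eq_eq order_refl)
    ultimately show ?thesis using p e by (intro exI[of _ p] exI[of _ "e - {p}"]) (auto simp: A_def insert_absorb)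
  qed
  have "arc_forest H A d"
  proof
    show "?V \<noteq> {}" using r by auto
    show "?E = (\<lambda>(p, B). insert p B) ` A"
      using edge by (force simp: A_def)
    show "p \<in> ?V" "B \<subseteq> ?V" "B \<noteq> {}" if "(p, B) \<in> A" for p B
      using that hyp(2) by (auto simp: A_def)
    show "d b = Suc (d p)" if "(p, B) \<in> A" "b \<in> B" for p B b
      using that by (auto simp: A_def)
    show "\<exists>p B. (p, B) \<in> A \<and> v \<in> B" if v: "v \<in> ?V" "v \<notin> roots H" for v
    proof -
      obtain e u where e: "e \<in> ?E" "u \<in> e" "v \<in> e" "d v = Suc (d u)" using d_pred v r by blast
      obtain p B where B: "e = insert p B" "(p, B) \<in> A" using edge[OF e(1)] by blast
      have "v \<noteq> p" using B e by (auto simp: A_def)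
      then show ?thesis using B e by blast
    qed
    show "p = q \<and> B = C" if *: "(p, B) \<in> A" "(q, C) \<in> A" "v \<in> B" "v \<in> C" for p B q C v
    proof (cases "insert p B = insert q C")
      case True
      have "p = q"
      proof (rule ccontr)
        assume "p \<noteq> q"
        then have "p \<in> C" "q \<in> B" using True by (metis insertE insertI1)+
        then have "d p = Suc (d q)" "d q = Suc (d p)"
          using *(1,2) unfolding A_def by blast+
        then show False by simp
      qed
      then show ?thesis using True * by (auto simp: A_def)
    next
      case False
      \<comment> \<open>The parents lie on the same level. They are joined around the edge of q, and
        the other edge leads from p to v, so q and v are joined without the edge that contains
        both.\<close>
      have "d v = Suc (d p)" "d v = Suc (d q)" using * unfolding A_def by blast+
      then have dpq: "d p = d q" by simp
      have "insert q C \<subseteq> ?V" "insert p B \<subseteq> ?V" using * hyp(2) unfolding A_def by blast+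
      moreover have "d p < d y \<and> d q < d y" if "x \<in> insert q C" "d y = Suc (d x)" for x y
      proof -
        have "d x = d q \<or> d x = Suc (d q)" using that(1) *(2) unfolding A_def by blast
        then show ?thesis using that(2) dpq by linarith
      qed
      ultimately have "(q, p) \<in> (adjacency (?E - {insert q C}))\<^sup>*"
        by (intro avoid2) auto
      moreover have "(p, v) \<in> adjacency (?E - {insert q C})"
        using False * unfolding A_def adjacency_def by blast
      ultimately have "(q, v) \<in> (adjacency (?E - {insert q C}))\<^sup>*" by (rule rtrancl_into_rtrancl)
      then show ?thesis using bridge[of "insert q C" q v] * unfolding A_def by blast
    qed
  qed (use hyp r d_root in auto)
  then show ?thesis by blast
qed

text \<open>The vertex sets of the hypertrees are disjoint, so their arcs can be united and the
  depth of a vertex taken in its own hypertree.\<close>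

lemma forests_arc_forest:
  assumes "S \<in> forests L"
  shows "\<exists>d. arc_forest S (arcs S) d"
proof -
  obtain F where F: "finite F" "F \<noteq> {}" "\<And>H. H \<in> F \<Longrightarrow> rooted_hypertree H" "disjoint_family_on verts F"
    and S: "S = \<lparr>verts = \<Union>(verts ` F), edges = \<Union>(edges ` F), roots = \<Union>(roots ` F)\<rparr>"
    using assms by (auto simp: forests_def)
  have "\<forall>H\<in>F. \<exists>A d. arc_forest H A d" using F(3) hypertree_arc_forest by blast
  then obtain A d where af: "\<And>H. H \<in> F \<Longrightarrow> arc_forest H (A H) (d H)" by metis
  define h where "h v = (THE H. H \<in> F \<and> v \<in> verts H)" for v
  have disj: "H = H'" if "H \<in> F" "H' \<in> F" "v \<in> verts H" "v \<in> verts H'" for H H' v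
    using that F(4) by (auto simp: disjoint_family_on_def)
  have h: "h v = H" if "H \<in> F" "v \<in> verts H" for v H
    unfolding h_def using that disj by blast
  have "arc_forest S (\<Union>H\<in>F. A H) (\<lambda>v. d (h v) v)"
  proof
    show "finite (verts S)" using F(1) arc_forest.finite_verts[OF af] by (simp add: S)
    show "verts S \<noteq> {}" using F(2) arc_forest.verts_nonempty[OF af] by (auto simp: S)
    show "roots S \<subseteq> verts S" using arc_forest.roots_verts[OF af] by (auto simp: S)
    show "edges S = (\<lambda>(p, B). insert p B) ` (\<Union>H\<in>F. A H)"
      using arc_forest.edges_arcs[OF af] by (auto simp: S image_UN)
    show "p \<in> verts S" "B \<subseteq> verts S" "B \<noteq> {}" if "(p, B) \<in> (\<Union>H\<in>F. A H)" for p B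
      using that arc_forest.arc_verts[OF af] arc_forest.arc_nonempty[OF af] by (auto simp: S; blast)+
    show "d (h b) b = Suc (d (h p) p)" if B: "(p, B) \<in> (\<Union>H\<in>F. A H)" "b \<in> B" for p B b
    proof -
      obtain H where H: "H \<in> F" "(p, B) \<in> A H" using B by blast
      then have "h p = H" "h b = H" using h arc_forest.arc_verts[OF af] B(2) by blast+
      then show ?thesis using arc_forest.depth_arc[OF af[OF H(1)] H(2)] B by simp
    qed
    show "d (h r) r = 0" if r: "r \<in> roots S" for r
    proof -
      obtain H where H: "H \<in> F" "r \<in> roots H" using r by (auto simp: S)
      then have "h r = H" using h arc_forest.roots_verts[OF af] by blast
      then show ?thesis using arc_forest.depth_root[OF af] H by simp
    qed
    show "\<exists>p B. (p, B) \<in> (\<Union>H\<in>F. A H) \<and> v \<in> B" if v: "v \<in> verts S" "v \<notin> roots S" for v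
    proof -
      obtain H where H: "H \<in> F" "v \<in> verts H" using v by (auto simp: S)
      then have "v \<notin> roots H" using v by (auto simp: S)
      then show ?thesis using arc_forest.arc_ex[OF af] H by blast
    qed
    show "p = q \<and> B = C" if *: "(p, B) \<in> (\<Union>H\<in>F. A H)" "(q, C) \<in> (\<Union>H\<in>F. A H)" "v \<in> B" "v \<in> C" for p B q C v
    proof -
      obtain H H' where H: "H \<in> F" "(p, B) \<in> A H" "H' \<in> F" "(q, C) \<in> A H'" using * by blast
      then have "H = H'" using disj arc_forest.arc_verts(2)[OF af] * by blast
      then show ?thesis using arc_forest.arc_unique[OF af] H * by blast
    qed
  qed
  then show ?thesis using arc_forest.arcs_eq by metis
qed

lemma forests_verts: "S \<in> forests L \<Longrightarrow> verts S = L"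
  by (simp add: forests_def)

lemma forests_finite: "S \<in> forests L \<Longrightarrow> finite L"
  using forests_arc_forest arc_forest.finite_verts forests_verts by metis

section \<open>Joining and attaching forests\<close>

definition point :: "'a \<Rightarrow> 'a rooted_hypergraph" where
  "point a = \<lparr>verts = {a}, edges = {}, roots = {a}\<rparr>"

definition join :: "'a rooted_hypergraph \<Rightarrow> 'a rooted_hypergraph \<Rightarrow> 'a rooted_hypergraph" where
  "join S T = \<lparr>verts = verts S \<union> verts T, edges = edges S \<union> edges T, roots = roots S \<union> roots T\<rparr>"

definition attach :: "'a \<Rightarrow> 'a rooted_hypergraph \<Rightarrow> 'a rooted_hypergraph \<Rightarrow> 'a rooted_hypergraph" where
  "attach v S T = \<lparr>verts = verts S \<union> verts T,
     edges = insert (insert v (roots T)) (edges S \<union> edges T), roots = roots S\<rparr>"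

lemma arc_forest_point: "arc_forest (point a) {} (\<lambda>_. 0)"
  by unfold_locales (auto simp: point_def)

lemma arc_forest_join:
  assumes "arc_forest S A d" "arc_forest T B e" "verts S \<inter> verts T = {}"
  shows "arc_forest (join S T) (A \<union> B) (\<lambda>v. if v \<in> verts S then d v else e v)"
proof -
  interpret S: arc_forest S A d by fact
  interpret T: arc_forest T B e by fact
  have disj: "v \<in> verts T \<Longrightarrow> v \<notin> verts S" for v using assms(3) by blast
  note vs = S.arc_verts T.arc_verts S.roots_verts T.roots_verts
  show ?thesis
  proof
    show "edges (join S T) = (\<lambda>(p, B). insert p B) ` (A \<union> B)"
      by (simp add: join_def S.edges_arcs T.edges_arcs image_Un)
    show "p \<in> verts (join S T)" if "(p, C) \<in> A \<union> B" for p C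
      using that S.arc_verts(1) T.arc_verts(1) by (auto simp: join_def)
    show "C \<subseteq> verts (join S T)" if "(p, C) \<in> A \<union> B" for p C
      using that S.child_vert T.child_vert by (auto simp: join_def)
    show "C \<noteq> {}" if "(p, C) \<in> A \<union> B" for p C
      using that S.arc_nonempty T.arc_nonempty by blast
    show "(if b \<in> verts S then d b else e b) = Suc (if p \<in> verts S then d p else e p)"
      if "(p, C) \<in> A \<union> B" "b \<in> C" for p C b
      using that(1)
    proof
      assume C: "(p, C) \<in> A"
      then have "p \<in> verts S" "b \<in> verts S" using S.arc_verts(1) S.child_vert that(2) by blast+
      then show ?thesis using S.depth_arc[OF C that(2)] by simp
    next
      assume C: "(p, C) \<in> B"
      then have "p \<notin> verts S" "b \<notin> verts S" using T.arc_verts(1) T.child_vert that(2) disj by blast+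
      then show ?thesis using T.depth_arc[OF C that(2)] by simp
    qed
    show "(if r \<in> verts S then d r else e r) = 0" if "r \<in> roots (join S T)" for r
      using that vs disj S.depth_root T.depth_root by (auto simp: join_def)
    show "\<exists>p C. (p, C) \<in> A \<union> B \<and> v \<in> C" if "v \<in> verts (join S T)" "v \<notin> roots (join S T)" for v
      using that S.arc_ex T.arc_ex by (auto simp: join_def) blast+
    show "p = q \<and> C = D" if "(p, C) \<in> A \<union> B" "(q, D) \<in> A \<union> B" "v \<in> C" "v \<in> D" for p C q D v
    proof (cases "v \<in> verts S")
      case True
      then have "(p, C) \<in> A" "(q, D) \<in> A" using that T.child_vert disj by blast+
      then show ?thesis using S.arc_unique that(3,4) by blast
    next
      case False
      then have "(p, C) \<in> B" "(q, D) \<in> B" using that S.child_vert by blast+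
      then show ?thesis using T.arc_unique that(3,4) by blast
    qed
  qed (use S.finite_verts T.finite_verts S.verts_nonempty vs in \<open>auto simp: join_def\<close>)
qed

text \<open>The roots of T become children of w, which shifts all depths in T by
  \<open>Suc (d w)\<close>.\<close>

lemma arc_forest_attach:
  assumes "arc_forest S A d" "arc_forest T B e" "verts S \<inter> verts T = {}" "w \<in> verts S"
  shows "arc_forest (attach w S T) (insert (w, roots T) (A \<union> B))
    (\<lambda>v. if v \<in> verts S then d v else e v + Suc (d w))"
proof -
  interpret S: arc_forest S A d by fact
  interpret T: arc_forest T B e by fact
  have disj: "v \<in> verts T \<Longrightarrow> v \<notin> verts S" for v using assms(3) by blast
  note vs = S.arc_verts T.arc_verts S.roots_verts T.roots_verts
  show ?thesis
  proof
    show "edges (attach w S T) = (\<lambda>(p, B). insert p B) ` insert (w, roots T) (A \<union> B)"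
      by (simp add: attach_def S.edges_arcs T.edges_arcs image_Un)
    show "p \<in> verts (attach w S T)" if "(p, C) \<in> insert (w, roots T) (A \<union> B)" for p C
      using that S.arc_verts(1) T.arc_verts(1) assms(4) by (auto simp: attach_def)
    show "C \<subseteq> verts (attach w S T)" if "(p, C) \<in> insert (w, roots T) (A \<union> B)" for p C
      using that S.child_vert T.child_vert T.roots_verts by (auto simp: attach_def)
    show "C \<noteq> {}" if "(p, C) \<in> insert (w, roots T) (A \<union> B)" for p C
      using that S.arc_nonempty T.arc_nonempty T.roots_nonempty by blast
    show "(if b \<in> verts S then d b else e b + Suc (d w)) = Suc (if p \<in> verts S then d p else e p + Suc (d w))"
      if pC: "(p, C) \<in> insert (w, roots T) (A \<union> B)" "b \<in> C" for p C b
    proof -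
      consider "(p, C) = (w, roots T)" | "(p, C) \<in> A" | "(p, C) \<in> B" using pC by blast
      then show ?thesis
      proof cases
        case 1
        then have "b \<notin> verts S" "e b = 0" using pC(2) disj T.roots_verts T.depth_root by auto
        then show ?thesis using 1 assms(4) by simp
      next
        case C: 2
        then have "p \<in> verts S" "b \<in> verts S" using S.arc_verts(1) S.child_vert pC(2) by blast+
        then show ?thesis using S.depth_arc[OF C pC(2)] by simp
      next
        case C: 3
        then have "p \<notin> verts S" "b \<notin> verts S" using T.arc_verts(1) T.child_vert pC(2) disj by blast+
        then show ?thesis using T.depth_arc[OF C pC(2)] by simp
      qed
    qed
    show "(if r \<in> verts S then d r else e r + Suc (d w)) = 0" if "r \<in> roots (attach w S T)" for r
      using that vs S.depth_root by (auto simp: attach_def)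
    show "\<exists>p C. (p, C) \<in> insert (w, roots T) (A \<union> B) \<and> v \<in> C"
      if "v \<in> verts (attach w S T)" "v \<notin> roots (attach w S T)" for v
      using that S.arc_ex T.arc_ex by (auto simp: attach_def) blast+
    show "p = q \<and> C = D"
      if pC: "(p, C) \<in> insert (w, roots T) (A \<union> B)" "(q, D) \<in> insert (w, roots T) (A \<union> B)" "v \<in> C" "v \<in> D"
      for p C q D v
    proof -
      have root: "v \<in> verts T" "v \<in> roots T" if "(p, C) = (w, roots T)" "v \<in> C" for p C
        using that T.roots_verts by auto
      consider "v \<in> verts S" | "v \<notin> verts S" "v \<in> roots T" | "v \<notin> verts S" "v \<notin> roots T" by blast
      then show ?thesis
      proof cases
        case 1
        then have "(p, C) \<in> A" "(q, D) \<in> A" using pC T.child_vert disj root by blast+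
        then show ?thesis using S.arc_unique pC(3,4) by blast
      next
        case 2
        then have "(p, C) = (w, roots T)" "(q, D) = (w, roots T)"
          using pC S.child_vert T.arc_not_root by blast+
        then show ?thesis by simp
      next
        case 3
        then have "(p, C) \<in> B" "(q, D) \<in> B" using pC S.child_vert root by blast+
        then show ?thesis using T.arc_unique pC(3,4) by blast
      qed
    qed
  qed (use S.finite_verts T.finite_verts S.verts_nonempty vs in \<open>auto simp: attach_def\<close>)
qed

lemma forestsE:
  assumes "S \<in> forests L"
  obtains d where "arc_forest S (arcs S) d" "verts S = L"
  using forests_arc_forest[OF assms] forests_verts[OF assms] by blast

lemma join_verts [simp]: "verts (join S T) = verts S \<union> verts T"
  and join_roots [simp]: "roots (join S T) = roots S \<union> roots T"
  and attach_verts [simp]: "verts (attach v S T) = verts S \<union> verts T"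
  and attach_roots [simp]: "roots (attach v S T) = roots S"
  by (simp_all add: join_def attach_def)

lemma forests_point: "point a \<in> forests {a}"
  using arc_forest.in_forests[OF arc_forest_point, of a] by (simp add: point_def)

lemma forests_join:
  assumes "S \<in> forests L" "T \<in> forests M" "L \<inter> M = {}"
  shows "join S T \<in> forests (L \<union> M)" "arcs (join S T) = arcs S \<union> arcs T"
proof -
  obtain d e where *: "arc_forest S (arcs S) d" "verts S = L" "arc_forest T (arcs T) e" "verts T = M"
    using assms by (auto elim!: forestsE)
  note af = arc_forest_join[OF *(1,3), unfolded *(2,4), OF assms(3)]
  show "join S T \<in> forests (L \<union> M)" using arc_forest.in_forests[OF af] * by simp
  show "arcs (join S T) = arcs S \<union> arcs T" by (rule arc_forest.arcs_eq[OF af])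
qed

lemma forests_attach:
  assumes "S \<in> forests L" "T \<in> forests M" "L \<inter> M = {}" "v \<in> L"
  shows "attach v S T \<in> forests (L \<union> M)" "arcs (attach v S T) = insert (v, roots T) (arcs S \<union> arcs T)"
proof -
  obtain d e where *: "arc_forest S (arcs S) d" "verts S = L" "arc_forest T (arcs T) e" "verts T = M"
    using assms by (auto elim!: forestsE)
  note af = arc_forest_attach[OF *(1,3), unfolded *(2,4), OF assms(3,4)]
  show "attach v S T \<in> forests (L \<union> M)" using arc_forest.in_forests[OF af] * by simp
  show "arcs (attach v S T) = insert (v, roots T) (arcs S \<union> arcs T)" by (rule arc_forest.arcs_eq[OF af])
qed

section \<open>Insertion into joined and attached forests\<close>

lemma forest_incoming:
  assumes "S \<in> forests L"
  shows "incoming S v = {insert v B |B. (v, B) \<in> arcs S}"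
proof -
  obtain d where "arc_forest S (arcs S) d" "verts S = L" using forestsE[OF assms] .
  then interpret arc_forest S "arcs S" d by simp
  show ?thesis by (rule incoming_arcs)
qed

lemma forest_child_via:
  assumes "S \<in> forests L"
  shows "child_via S v e \<longleftrightarrow> (\<exists>p B. (p, B) \<in> arcs S \<and> v \<in> B \<and> e = insert p B)"
proof -
  obtain d where "arc_forest S (arcs S) d" "verts S = L" using forestsE[OF assms] .
  then interpret arc_forest S "arcs S" d by simp
  show ?thesis by (rule child_via_iff)
qed

lemma forest_arcs_verts:
  assumes "S \<in> forests L" "(p, B) \<in> arcs S"
  shows "p \<in> L" "B \<subseteq> L" "B \<noteq> {}" "p \<notin> B"
proof -
  obtain d where "arc_forest S (arcs S) d" "verts S = L" using forestsE[OF assms(1)] .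
  then interpret arc_forest S "arcs S" d by simp
  show "p \<in> L" "B \<subseteq> L" "B \<noteq> {}" "p \<notin> B"
    using assms(2) arc_verts arc_nonempty parent_notin \<open>verts S = L\<close> by auto
qed

lemma forest_edges_verts:
  assumes "S \<in> forests L" "e \<in> edges S"
  shows "e \<subseteq> L" "e \<noteq> {}"
proof -
  obtain d where "arc_forest S (arcs S) d" using forestsE[OF assms(1)] .
  then obtain p B where "(p, B) \<in> arcs S" "e = insert p B"
    using assms(2) by (auto simp: arc_forest.edges_arcs)
  then show "e \<subseteq> L" "e \<noteq> {}" using forest_arcs_verts[OF assms(1)] by auto
qed

lemma forest_roots:
  assumes "S \<in> forests L"
  shows "roots S \<subseteq> L" "roots S \<noteq> {}" "finite L" "L \<noteq> {}"
proof -
  obtain d where "arc_forest S (arcs S) d" "verts S = L" using forestsE[OF assms] .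
  then interpret arc_forest S "arcs S" d by simp
  show "roots S \<subseteq> L" "roots S \<noteq> {}" "finite L" "L \<noteq> {}"
    using roots_verts roots_nonempty finite_verts verts_nonempty \<open>verts S = L\<close> by auto
qed

lemma forest_root_not_child:
  assumes "S \<in> forests L" "v \<in> roots S"
  shows "\<not> child_via S v e"
proof -
  obtain d where "arc_forest S (arcs S) d" using forestsE[OF assms(1)] .
  then interpret arc_forest S "arcs S" d .
  show ?thesis using arc_not_root assms(2) by (auto simp: child_via_iff)
qed

lemma insert_along_verts: "verts (insert_along i S f T) = (verts S - {i}) \<union> verts T"
  by (simp add: insert_along_def)

text \<open>No edge of T contains i, so joining T changes neither the incoming edges of i nor the
  edge in which i is a child.\<close>

lemma insert_along_join:
  assumes S: "S \<in> forests A" and T: "T \<in> forests B" and disj: "A \<inter> B = {}" and i: "i \<in> A"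
  shows "incoming (join S T) i = incoming S i"
    "insert_along i (join S T) f U = join (insert_along i S f U) T"
proof -
  note J = forests_join[OF S T disj]
  have iB: "i \<notin> B" using i disj by blast
  have not: "(i, C) \<notin> arcs T" "(p, C) \<in> arcs T \<Longrightarrow> i \<notin> C" for p C
    using forest_arcs_verts[OF T] iB by blast+
  show inc: "incoming (join S T) i = incoming S i"
    unfolding forest_incoming[OF J(1)] forest_incoming[OF S] J(2) using not by blast
  have child: "child_via (join S T) i e = child_via S i e" for e
    unfolding forest_child_via[OF J(1)] forest_child_via[OF S] J(2) using not by blast
  have "i \<notin> roots T" using forest_roots[OF T] iB by blast
  moreover have "i \<notin> e" if "e \<in> edges T" for e using forest_edges_verts[OF T that] iB by blast
  ultimately show "insert_along i (join S T) f U = join (insert_along i S f U) T"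
    unfolding insert_along_def inc child using forests_verts[OF T] iB by (auto simp: join_def)
qed

lemma insert_along_attach:
  assumes S: "S \<in> forests A" and T: "T \<in> forests B" and disj: "A \<inter> B = {}"
    and v: "v \<in> A" "v \<noteq> i" and i: "i \<in> A"
  shows "incoming (attach v S T) i = incoming S i"
    "insert_along i (attach v S T) f U = attach v (insert_along i S f U) T"
proof -
  note J = forests_attach[OF S T disj v(1)]
  have iB: "i \<notin> B" using i disj by blast
  have not: "(i, C) \<notin> arcs T" "(p, C) \<in> arcs T \<Longrightarrow> i \<notin> C" for p C
    using forest_arcs_verts[OF T] iB by blast+
  have iR: "i \<notin> roots T" using forest_roots[OF T] iB by blast
  show inc: "incoming (attach v S T) i = incoming S i"
    unfolding forest_incoming[OF J(1)] forest_incoming[OF S] J(2) using not v by blast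
  have child: "child_via (attach v S T) i e = child_via S i e" for e
    unfolding forest_child_via[OF J(1)] forest_child_via[OF S] J(2) using not iR by blast
  have "i \<notin> e" if "e \<in> edges T" for e using forest_edges_verts[OF T that] iB by blast
  then show "insert_along i (attach v S T) f U = attach v (insert_along i S f U) T"
    unfolding insert_along_def inc child using forests_verts[OF T] iB iR v by (auto simp: attach_def)
qed

text \<open>The edge attached at i is one more incoming edge of i. Its new parent is the value of
  the choice function at this edge, so w ranges independently of the parents of the other
  edges.\<close>

lemma insert_along_attach_self:
  assumes S: "S \<in> forests A" and T: "T \<in> forests B" and disj: "A \<inter> B = {}" and i: "i \<in> A"
  shows "incoming (attach i S T) i = insert (insert i (roots T)) (incoming S i)"
    "insert i (roots T) \<notin> incoming S i"
    "insert_along i (attach i S T) (f(insert i (roots T) := w)) U = attach w (insert_along i S f U) T"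
proof -
  note J = forests_attach[OF S T disj i]
  have iB: "i \<notin> B" using i disj by blast
  have not: "(i, C) \<notin> arcs T" "(p, C) \<in> arcs T \<Longrightarrow> i \<notin> C" for p C
    using forest_arcs_verts[OF T] iB by blast+
  have R: "roots T \<subseteq> B" "roots T \<noteq> {}" "i \<notin> roots T" using forest_roots[OF T] iB by auto
  show inc: "incoming (attach i S T) i = insert (insert i (roots T)) (incoming S i)"
    unfolding forest_incoming[OF J(1)] forest_incoming[OF S] J(2) using not by blast
  \<comment> \<open>The new edge contains roots of T, which no edge of S does.\<close>
  show new: "insert i (roots T) \<notin> incoming S i"
  proof
    assume "insert i (roots T) \<in> incoming S i"
    then obtain B' where "insert i (roots T) = insert i B'" "(i, B') \<in> arcs S"
      by (auto simp: forest_incoming[OF S])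
    then have "roots T \<subseteq> insert i B'" "B' \<subseteq> A" using forest_arcs_verts(2)[OF S] by auto
    then have "roots T \<subseteq> A" using i by blast
    then show False using R disj by blast
  qed
  have child: "child_via (attach i S T) i e = child_via S i e" for e
    unfolding forest_child_via[OF J(1)] forest_child_via[OF S] J(2) using not R by blast
  have eT: "i \<notin> e" if "e \<in> edges T" for e using forest_edges_verts[OF T that] iB by blast
  have "{e - {i} \<union> {(f(insert i (roots T) := w)) e} |e. e \<in> insert (insert i (roots T)) (incoming S i)}
    = insert (insert w (roots T)) {e - {i} \<union> {f e} |e. e \<in> incoming S i}"
    (is "?L = ?R")
  proof -
    have "?L = (\<lambda>e. e - {i} \<union> {(f(insert i (roots T) := w)) e}) ` insert (insert i (roots T)) (incoming S i)"
      by (rule Setcompr_eq_image)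
    also have "\<dots> = insert (insert w (roots T)) ((\<lambda>e. e - {i} \<union> {(f(insert i (roots T) := w)) e}) ` incoming S i)"
      using R(3) by simp
    also have "(\<lambda>e. e - {i} \<union> {(f(insert i (roots T) := w)) e}) ` incoming S i =
        (\<lambda>e. e - {i} \<union> {f e}) ` incoming S i"
      using new by (intro image_cong) auto
    finally show ?thesis unfolding Setcompr_eq_image .
  qed
  then show "insert_along i (attach i S T) (f(insert i (roots T) := w)) U = attach w (insert_along i S f U) T"
    unfolding insert_along_def inc child using forests_verts[OF T] iB eT R by (auto simp: attach_def)
qed

text \<open>If i is a root of T, the new edge is the one in which i is a child, and it receives the
  roots of U in place of i. Inserting first changes the roots of T in the same way, so attaching
  afterwards yields the same edge.\<close>

lemma insert_along_attach_right:
  assumes S: "S \<in> forests A" and T: "T \<in> forests B" and disj: "A \<inter> B = {}" and v: "v \<in> A" and i: "i \<in> B"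
  shows "incoming (attach v S T) i = incoming T i"
    "insert_along i (attach v S T) f U = attach v S (insert_along i T f U)"
proof -
  note J = forests_attach[OF S T disj v(1)]
  have iA: "i \<notin> A" using i disj by blast
  have not: "(i, C) \<notin> arcs S" "(p, C) \<in> arcs S \<Longrightarrow> i \<notin> C" for p C
    using forest_arcs_verts[OF S] iA by blast+
  have iv: "i \<noteq> v" using iA v by blast
  have iR: "i \<notin> roots S" using forest_roots[OF S] iA by blast
  show inc: "incoming (attach v S T) i = incoming T i"
    unfolding forest_incoming[OF J(1)] forest_incoming[OF T] J(2) using not iv by blast
  have child: "child_via (attach v S T) i e \<longleftrightarrow> child_via T i e \<or> (i \<in> roots T \<and> e = insert v (roots T))" for e
    unfolding forest_child_via[OF J(1)] forest_child_via[OF T] J(2) using not by blast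
  have eS: "i \<notin> e" if "e \<in> edges S" for e using forest_edges_verts[OF S that] iA by blast
  show "insert_along i (attach v S T) f U = attach v S (insert_along i T f U)"
  proof (cases "i \<in> roots T")
    case True
    have "{e - {i} \<union> roots U |e. child_via T i e \<or> i \<in> roots T \<and> e = insert v (roots T)} =
        {insert v (roots T - {i} \<union> roots U)}"
      using forest_root_not_child[OF T True] True iv by auto
    then show ?thesis
      unfolding insert_along_def inc child using forests_verts[OF S] iA iR eS True
      by (auto simp: attach_def)
  next
    case False
    then show ?thesis
      unfolding insert_along_def inc child using forests_verts[OF S] iA iR iv eS
      by (auto simp: attach_def)
  qed
qed

lemma join_commute: "join S T = join T S"
  by (simp add: join_def Un_commute)

definition graft :: "'a rooted_hypergraph \<Rightarrow> 'a rooted_hypergraph \<Rightarrow> ('a rooted_hypergraph \<Rightarrow>\<^sub>0 'k::field)" where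
  "graft S T = (\<Sum>v\<in>verts S. basis (attach v S T))"

lemma lin_ext_insertion:
  "lin_ext h (insertion i S U) = (\<Sum>f \<in> incoming S i \<rightarrow>\<^sub>E verts U. h (insert_along i S f U))"
  by (simp add: insertion_def lin_ext_sum)

lemma insertion_join:
  assumes "S \<in> forests A" "T \<in> forests B" "A \<inter> B = {}" "i \<in> A"
  shows "insertion i (join S T) U = lin_ext (\<lambda>S'. basis (join S' T)) (insertion i S U)"
  unfolding lin_ext_insertion by (simp add: insertion_def insert_along_join[OF assms])

text \<open>A vertex of the forest obtained by insertion is either a vertex of S other than i or a
  vertex of U. Attaching T at the former comes from the summands v \<noteq> i of
  \<open>graft S T\<close>, attaching it at the latter from v = i, where the new edge is distributed
  over the vertices of U.\<close>

lemma insertion_graft_left: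
  assumes S: "S \<in> forests A" and T: "T \<in> forests B" and disj: "A \<inter> B = {}" and i: "i \<in> A"
    and U: "finite (verts U)" "(A - {i}) \<inter> verts U = {}"
  shows "lin_ext (\<lambda>R. insertion i R U) (graft S T) =
    (lin_ext (\<lambda>R. graft R T) (insertion i S U) :: 'a rooted_hypergraph \<Rightarrow>\<^sub>0 'k::field)" (is "?L = ?R")
proof -
  have A: "verts S = A" "finite A" using forests_verts[OF S] forests_finite[OF S] by auto
  let ?I = "incoming S i \<rightarrow>\<^sub>E verts U" and ?e = "insert i (roots T)"
  have self: "insertion i (attach i S T) U =
      (\<Sum>f\<in>?I. \<Sum>w\<in>verts U. Poly_Mapping.single (attach w (insert_along i S f U) T) (1::'k))"
  proof -
    note a = insert_along_attach_self[OF S T disj i]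
    have "insertion i (attach i S T) U =
        (\<Sum>(w, f)\<in>verts U \<times> ?I. Poly_Mapping.single (insert_along i (attach i S T) (f(?e := w)) U) (1::'k))"
      unfolding insertion_def a(1) PiE_insert_eq
      \<comment> \<open>A choice function on one more edge is a choice w for this edge together with
        a function on the others.\<close>
      by (subst sum.reindex[OF inj_combinator[OF a(2)]]) (simp add: case_prod_unfold)
    then show ?thesis
      unfolding a(3) by (simp add: sum.cartesian_product[symmetric] sum.swap[of _ ?I])
  qed
  have other: "insertion i (attach v S T) U =
      (\<Sum>f\<in>?I. Poly_Mapping.single (attach v (insert_along i S f U) T) (1::'k))" if "v \<in> A" "v \<noteq> i" for v
    unfolding insertion_def insert_along_attach[OF S T disj that i] ..
  have "?L = (\<Sum>v\<in>A. insertion i (attach v S T) U)"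
    by (simp add: graft_def lin_ext_sum A)
  also have "\<dots> = insertion i (attach i S T) U + (\<Sum>v\<in>A - {i}. insertion i (attach v S T) U)"
    using A i by (simp add: sum.remove)
  also have "(\<Sum>v\<in>A - {i}. insertion i (attach v S T) U) =
      (\<Sum>f\<in>?I. \<Sum>v\<in>A - {i}. Poly_Mapping.single (attach v (insert_along i S f U) T) (1::'k))"
    by (subst sum.swap) (use other in \<open>auto intro: sum.cong\<close>)
  also have "insertion i (attach i S T) U + \<dots> =
      (\<Sum>f\<in>?I. \<Sum>v\<in>verts U \<union> (A - {i}). Poly_Mapping.single (attach v (insert_along i S f U) T) (1::'k))"
    unfolding self sum.distrib[symmetric]
    by (intro sum.cong refl sum.union_disjoint[symmetric]) (use U A in auto)
  also have "\<dots> = ?R"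
    unfolding lin_ext_insertion graft_def insert_along_verts A by (simp add: Un_commute)
  finally show ?thesis .
qed

text \<open>The vertex v of S at which T is attached is untouched by the insertion, so the two sums
  commute.\<close>

lemma insertion_graft_right:
  assumes S: "S \<in> forests A" and T: "T \<in> forests B" and disj: "A \<inter> B = {}" and i: "i \<in> B"
  shows "lin_ext (\<lambda>R. insertion i R U) (graft S T) =
    (lin_ext (\<lambda>R. graft S R) (insertion i T U) :: 'a rooted_hypergraph \<Rightarrow>\<^sub>0 'k::field)" (is "?L = ?R")
proof -
  have A: "verts S = A" using forests_verts[OF S] .
  let ?I = "incoming T i \<rightarrow>\<^sub>E verts U"
  have other: "insertion i (attach v S T) U =
      (\<Sum>f\<in>?I. Poly_Mapping.single (attach v S (insert_along i T f U)) (1::'k))" if "v \<in> A" for v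
    unfolding insertion_def insert_along_attach_right[OF S T disj that i] ..
  have "?L = (\<Sum>v\<in>A. insertion i (attach v S T) U)"
    by (simp add: graft_def lin_ext_sum A)
  also have "\<dots> = (\<Sum>v\<in>A. \<Sum>f\<in>?I. Poly_Mapping.single (attach v S (insert_along i T f U)) (1::'k))"
    using other by (intro sum.cong) auto
  also have "\<dots> = ?R"
    unfolding lin_ext_insertion graft_def A by (rule sum.swap)
  finally show ?thesis .
qed

section \<open>From trees to forests of rooted hypertrees\<close>

fun gen_forests :: "gen \<Rightarrow> ('a rooted_hypergraph \<Rightarrow>\<^sub>0 'k) \<Rightarrow> ('a rooted_hypergraph \<Rightarrow>\<^sub>0 'k) \<Rightarrow>
    ('a rooted_hypergraph \<Rightarrow>\<^sub>0 'k::field)" where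
  "gen_forests Gen_x u v = bilin_ext graft u v"
| "gen_forests Gen_y u v = bilin_ext graft v u"
| "gen_forests Gen_c u v = bilin_ext (\<lambda>S T. basis (join S T)) u v"

lemma gen_forests_swap: "gen_forests (gen_swap g) v u = gen_forests g u v"
proof (cases g)
  case Gen_c
  then show ?thesis by (simp, subst bilin_ext_flip) (simp add: join_commute)
qed simp_all

primrec monomial_forests :: "'a monomial \<Rightarrow> ('a rooted_hypergraph \<Rightarrow>\<^sub>0 'k::field)" where
  "monomial_forests (Input a) = basis (point a)"
| "monomial_forests (App g s t) = gen_forests g (monomial_forests s) (monomial_forests t)"

lift_definition tree_forests :: "'a tree \<Rightarrow> ('a rooted_hypergraph \<Rightarrow>\<^sub>0 'k::field)" is monomial_forests
  subgoal for s t by (induction rule: sym_equiv.induct) (simp_all add: gen_forests_swap)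
  done

lemma tree_forests_input [simp]: "tree_forests (tree_input a) = basis (point a)"
  by transfer simp

lemma tree_forests_app [simp]:
  "tree_forests (tree_app g s t) = gen_forests g (tree_forests s) (tree_forests t)"
  by transfer simp

text \<open>A product with y is a product with x in the opposite order.\<close>

lemma tree_induct_xc [case_names input x c]:
  assumes "\<And>a. P (tree_input a)" "\<And>s t. P s \<Longrightarrow> P t \<Longrightarrow> P (tree_app Gen_x s t)"
    "\<And>s t. P s \<Longrightarrow> P t \<Longrightarrow> P (tree_app Gen_c s t)"
  shows "P t"
proof (induction t rule: tree_induct)
  case (app g s t)
  then show ?case
    using assms tree_app_swap[of Gen_y s t] by (cases g) auto
qed (rule assms(1))

lemma supported_graft:
  assumes "S \<in> forests A" "T \<in> forests B" "A \<inter> B = {}"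
  shows "graft S T \<in> supported (forests (A \<union> B))"
  unfolding graft_def
  by (rule pm.subspace_sum[OF subspace_supported])
    (use forests_attach(1)[OF assms] forests_verts[OF assms(1)] in auto)

lemma supported_gen_forests:
  assumes "u \<in> supported (forests A)" "v \<in> supported (forests B)" "A \<inter> B = {}"
  shows "gen_forests g u v \<in> supported (forests (A \<union> B))"
proof (cases g)
  case Gen_x
  then show ?thesis using assms by (auto intro!: supported_bilin_ext supported_graft)
next
  case Gen_y
  have "B \<inter> A = {}" using assms(3) by blast
  then have "bilin_ext graft v u \<in> supported (forests (B \<union> A))"
    using assms by (auto intro!: supported_bilin_ext supported_graft)
  then show ?thesis using Gen_y by (simp add: Un_commute)
next
  case Gen_c
  then show ?thesis using assms forests_join(1) by (fastforce intro!: supported_bilin_ext)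
qed

lemma tree_forests_supported:
  "\<lbrakk>t \<in> linear_trees A; finite A\<rbrakk> \<Longrightarrow> tree_forests t \<in> supported (forests A)"
proof (induction t arbitrary: A rule: tree_induct)
  case (input a)
  then have "A = {a}" by (rule linear_trees_inputD)
  then show ?case using forests_point[of a] by simp
next
  case (app g s t)
  obtain B C where "s \<in> linear_trees B" "t \<in> linear_trees C" "A = B \<union> C" "B \<inter> C = {}"
    using linear_trees_appD[OF app.prems] .
  then show ?case using app by (auto intro!: supported_gen_forests)
qed

lemma forest_relabel_simps:
  "forest_relabel f (point a) = point (f a)"
  "forest_relabel f (join S T) = join (forest_relabel f S) (forest_relabel f T)"
  "forest_relabel f (attach v S T) = attach (f v) (forest_relabel f S) (forest_relabel f T)"
  by (simp_all add: forest_relabel_def point_def join_def attach_def image_Un)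

text \<open>Injectivity keeps the vertices apart, so that the sum over the vertices in
  \<open>graft\<close> can be reindexed.\<close>

lemma tree_forests_relabel:
  "\<lbrakk>t \<in> linear_trees A; finite A; inj_on f A\<rbrakk> \<Longrightarrow>
    (tree_forests (tree_relabel f t) :: 'b rooted_hypergraph \<Rightarrow>\<^sub>0 'k::field) =
      lin_ext (\<lambda>S. basis (forest_relabel f S)) (tree_forests t)"
proof (induction t arbitrary: A rule: tree_induct_xc)
  case (input a)
  show ?case by (simp add: forest_relabel_simps)
next
  case (x s t)
  obtain B C where BC: "s \<in> linear_trees B" "t \<in> linear_trees C" "A = B \<union> C" "B \<inter> C = {}"
    using linear_trees_appD[OF x.prems(1,2)] .
  have fin: "finite B" "finite C" "inj_on f B" "inj_on f C"
    using x.prems(2,3) BC by (auto simp: inj_on_Un)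
  have "graft (forest_relabel f S) (forest_relabel f T) =
      (lin_ext (\<lambda>S. basis (forest_relabel f S)) (graft S T) :: _ \<Rightarrow>\<^sub>0 'k)"
    if "S \<in> Poly_Mapping.keys (tree_forests s :: _ \<Rightarrow>\<^sub>0 'k)" for S T
  proof -
    have "verts S = B"
      using that tree_forests_supported[OF BC(1) fin(1)] forests_verts by (auto simp: supported_def)
    then show ?thesis
      using fin(3) by (simp add: graft_def lin_ext_sum forest_relabel_simps sum.reindex)
        (simp add: forest_relabel_def sum.reindex)
  qed
  then show ?case
    using x.IH(1)[OF BC(1) fin(1,3)] x.IH(2)[OF BC(2) fin(2,4)]
    by (simp add: bilin_ext_left lin_ext_lin_ext) (intro lin_ext_cong; simp)
next
  case (c s t)
  obtain B C where BC: "s \<in> linear_trees B" "t \<in> linear_trees C" "A = B \<union> C" "B \<inter> C = {}"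
    using linear_trees_appD[OF c.prems(1,2)] .
  have fin: "finite B" "finite C" "inj_on f B" "inj_on f C"
    using c.prems(2,3) BC by (auto simp: inj_on_Un)
  show ?case
    using c.IH(1)[OF BC(1) fin(1,3)] c.IH(2)[OF BC(2) fin(2,4)]
    by (simp add: bilin_ext_left lin_ext_lin_ext forest_relabel_simps)
qed

section \<open>Insertion and substitution\<close>

lemma insertion_point: "insertion i (point i) = (\<lambda>T. basis T)"
proof
  fix T
  have inc: "incoming (point i) i = {}" "child_via (point i) i e = False" for e
    by (auto simp: incoming_def parent_of_def point_def child_via_def)
  have "insert_along i (point i) f T = T" for f
    unfolding insert_along_def inc by (simp add: point_def)
  then show "insertion i (point i) T = basis T" by (simp add: insertion_def inc)
qed

text \<open>Reduces the compatibility of insertion with a product to basis elements when the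
  insertion takes place in the left factor; the next lemma is the case of the right factor.\<close>

lemma bilin_ext_exchange_left:
  assumes "\<And>a b c. a \<in> Poly_Mapping.keys u \<Longrightarrow> b \<in> Poly_Mapping.keys v \<Longrightarrow> c \<in> Poly_Mapping.keys w \<Longrightarrow>
    lin_ext (\<lambda>r. h r b) (k a c) = lin_ext (\<lambda>r. k' r c) (h' a b)"
  shows "bilin_ext h (bilin_ext k u w) v = bilin_ext k' (bilin_ext h' u v) w"
proof -
  have "bilin_ext h (bilin_ext k u w) v =
      lin_ext (\<lambda>a. lin_ext (\<lambda>c. lin_ext (\<lambda>b. lin_ext (\<lambda>r. h r b) (k a c)) v) w) u"
    by (simp add: bilin_ext_left lin_ext_lin_ext lin_ext_swap[of _ v])
  also have "\<dots> = lin_ext (\<lambda>a. lin_ext (\<lambda>b. lin_ext (\<lambda>c. lin_ext (\<lambda>r. h r b) (k a c)) w) v) u"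
    by (simp add: lin_ext_swap[of _ v w])
  also have "\<dots> = lin_ext (\<lambda>a. lin_ext (\<lambda>b. lin_ext (\<lambda>c. lin_ext (\<lambda>r. k' r c) (h' a b)) w) v) u"
    using assms by (intro lin_ext_cong) auto
  also have "\<dots> = bilin_ext k' (bilin_ext h' u v) w"
    by (simp add: bilin_ext_left lin_ext_lin_ext lin_ext_swap[of _ w])
  finally show ?thesis .
qed

lemma bilin_ext_exchange_right:
  assumes "\<And>a b c. a \<in> Poly_Mapping.keys u \<Longrightarrow> b \<in> Poly_Mapping.keys v \<Longrightarrow> c \<in> Poly_Mapping.keys w \<Longrightarrow>
    lin_ext (\<lambda>r. h a r) (k b c) = lin_ext (\<lambda>r. k' r c) (h' a b)"
  shows "bilin_ext h u (bilin_ext k v w) = bilin_ext k' (bilin_ext h' u v) w"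
proof -
  have "bilin_ext h u (bilin_ext k v w) =
      lin_ext (\<lambda>a. lin_ext (\<lambda>b. lin_ext (\<lambda>c. lin_ext (\<lambda>r. h a r) (k b c)) w) v) u"
    by (simp add: bilin_ext_left lin_ext_lin_ext)
  also have "\<dots> = lin_ext (\<lambda>a. lin_ext (\<lambda>b. lin_ext (\<lambda>c. lin_ext (\<lambda>r. k' r c) (h' a b)) w) v) u"
    using assms by (intro lin_ext_cong) auto
  also have "\<dots> = bilin_ext k' (bilin_ext h' u v) w"
    by (simp add: bilin_ext_left lin_ext_lin_ext lin_ext_swap[of _ w])
  finally show ?thesis .
qed

text \<open>As s has distinct labels, i lies in exactly one factor of a product, and the other
  factor is not changed by the substitution. The insertion moves into the factor that contains
  i.\<close>

lemma tree_forests_substitute: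
  "\<lbrakk>s \<in> linear_trees A; t \<in> linear_trees B; finite A; finite B; i \<in> A; (A - {i}) \<inter> B = {}\<rbrakk> \<Longrightarrow>
    (tree_forests (tree_substitute i s t) :: 'a rooted_hypergraph \<Rightarrow>\<^sub>0 'k::field) =
      bilin_ext (insertion i) (tree_forests s) (tree_forests t)"
proof (induction s arbitrary: A rule: tree_induct_xc)
  case (input a)
  then show ?case using linear_trees_inputD[OF input(1,3)] by (simp add: bilin_ext_single_left insertion_point)
next
  case (x s1 s2)
  let ?\<psi> = "tree_forests :: 'a tree \<Rightarrow> 'a rooted_hypergraph \<Rightarrow>\<^sub>0 'k"
  obtain A1 A2 where A: "s1 \<in> linear_trees A1" "s2 \<in> linear_trees A2" "A = A1 \<union> A2" "A1 \<inter> A2 = {}"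
    using linear_trees_appD[OF x.prems(1,3)] .
  have fin: "finite A1" "finite A2" using x.prems A by auto
  have keys: "S \<in> Poly_Mapping.keys (?\<psi> s1) \<Longrightarrow> S \<in> forests A1"
    "T \<in> Poly_Mapping.keys (?\<psi> s2) \<Longrightarrow> T \<in> forests A2"
    "U \<in> Poly_Mapping.keys (?\<psi> t) \<Longrightarrow> U \<in> forests B" for S T U
    using tree_forests_supported[OF A(1) fin(1)] tree_forests_supported[OF A(2) fin(2)]
      tree_forests_supported[OF x.prems(2,4)] by (auto simp: supported_def)
  show ?case
  proof (cases "i \<in> A1")
    case True
    have s2: "tree_substitute i s2 t = s2"
      using A fin True by (intro tree_substitute_fresh) (auto simp: linear_trees_def)
    have disj: "(A1 - {i}) \<inter> B = {}" using x.prems(6) A by blast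
    have "bilin_ext graft (bilin_ext (insertion i) (?\<psi> s1) (?\<psi> t)) (?\<psi> s2) =
        bilin_ext (insertion i) (bilin_ext graft (?\<psi> s1) (?\<psi> s2)) (?\<psi> t)"
    proof (rule bilin_ext_exchange_left)
      fix S T U assume "S \<in> Poly_Mapping.keys (?\<psi> s1)" "T \<in> Poly_Mapping.keys (?\<psi> s2)" "U \<in> Poly_Mapping.keys (?\<psi> t)"
      then have *: "S \<in> forests A1" "T \<in> forests A2" "verts U = B" using keys forests_verts by blast+
      show "lin_ext (\<lambda>r. graft r T) (insertion i S U) = lin_ext (\<lambda>r. insertion i r U) (graft S T)"
        using x.prems(4) disj by (intro insertion_graft_left[symmetric, OF *(1,2) A(4) True]) (simp_all add: *)
    qed
    then show ?thesis using x.IH(1)[OF A(1) x.prems(2) fin(1) x.prems(4) True disj] by (simp add: s2)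
  next
    case False
    have s1: "tree_substitute i s1 t = s1"
      using A fin False by (intro tree_substitute_fresh) (auto simp: linear_trees_def)
    have i: "i \<in> A2" using False x.prems(5) A by blast
    have disj: "(A2 - {i}) \<inter> B = {}" using x.prems(6) A by blast
    have "bilin_ext graft (?\<psi> s1) (bilin_ext (insertion i) (?\<psi> s2) (?\<psi> t)) =
        bilin_ext (insertion i) (bilin_ext graft (?\<psi> s1) (?\<psi> s2)) (?\<psi> t)"
      by (rule bilin_ext_exchange_right) (rule insertion_graft_right[symmetric, OF keys(1,2) A(4) i])
    then show ?thesis using x.IH(2)[OF A(2) x.prems(2) fin(2) x.prems(4) i disj] by (simp add: s1)
  qed
next
  case (c s1 s2)
  let ?\<psi> = "tree_forests :: 'a tree \<Rightarrow> 'a rooted_hypergraph \<Rightarrow>\<^sub>0 'k"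
  let ?join = "\<lambda>S T. Poly_Mapping.single (join S T) (1::'k)"
  obtain A1 A2 where A: "s1 \<in> linear_trees A1" "s2 \<in> linear_trees A2" "A = A1 \<union> A2" "A1 \<inter> A2 = {}"
    using linear_trees_appD[OF c.prems(1,3)] .
  have fin: "finite A1" "finite A2" using c.prems A by auto
  have keys: "S \<in> Poly_Mapping.keys (?\<psi> s1) \<Longrightarrow> S \<in> forests A1"
    "T \<in> Poly_Mapping.keys (?\<psi> s2) \<Longrightarrow> T \<in> forests A2" for S T
    using tree_forests_supported[OF A(1) fin(1)] tree_forests_supported[OF A(2) fin(2)]
    by (auto simp: supported_def)
  show ?case
  proof (cases "i \<in> A1")
    case True
    have s2: "tree_substitute i s2 t = s2"
      using A fin True by (intro tree_substitute_fresh) (auto simp: linear_trees_def)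
    have disj: "(A1 - {i}) \<inter> B = {}" using c.prems(6) A by blast
    have "bilin_ext ?join (bilin_ext (insertion i) (?\<psi> s1) (?\<psi> t)) (?\<psi> s2) =
        bilin_ext (insertion i) (bilin_ext ?join (?\<psi> s1) (?\<psi> s2)) (?\<psi> t)"
    proof (rule bilin_ext_exchange_left)
      fix S T U assume *: "S \<in> Poly_Mapping.keys (?\<psi> s1)" "T \<in> Poly_Mapping.keys (?\<psi> s2)"
      show "lin_ext (\<lambda>r. ?join r T) (insertion i S U) = lin_ext (\<lambda>r. insertion i r U) (?join S T)"
        using insertion_join[OF keys(1)[OF *(1)] keys(2)[OF *(2)] A(4) True, of U, where 'b = 'k] by simp
    qed
    then show ?thesis using c.IH(1)[OF A(1) c.prems(2) fin(1) c.prems(4) True disj] by (simp add: s2)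
  next
    case False
    have s1: "tree_substitute i s1 t = s1"
      using A fin False by (intro tree_substitute_fresh) (auto simp: linear_trees_def)
    have i: "i \<in> A2" using False c.prems(5) A by blast
    have disj: "(A2 - {i}) \<inter> B = {}" "A2 \<inter> A1 = {}" using c.prems(6) A by auto
    have "bilin_ext ?join (?\<psi> s1) (bilin_ext (insertion i) (?\<psi> s2) (?\<psi> t)) =
        bilin_ext (insertion i) (bilin_ext ?join (?\<psi> s1) (?\<psi> s2)) (?\<psi> t)"
    proof (rule bilin_ext_exchange_right)
      fix S T U assume *: "S \<in> Poly_Mapping.keys (?\<psi> s1)" "T \<in> Poly_Mapping.keys (?\<psi> s2)"
      show "lin_ext (\<lambda>r. ?join S r) (insertion i T U) = lin_ext (\<lambda>r. insertion i r U) (?join S T)"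
        using insertion_join[OF keys(2)[OF *(2)] keys(1)[OF *(1)] disj(2) i, of U, where 'b = 'k]
        by (simp add: join_commute[of S])
    qed
    then show ?thesis using c.IH(2)[OF A(2) c.prems(2) fin(2) c.prems(4) i disj(1)] by (simp add: s1)
  qed
qed

section \<open>The homomorphism from the free operad\<close>

lemma FH_simps:
  "scale FH = pm_scale"
  "ops FH n = supported (forests {1..n})"
  "act FH n \<sigma> = lin_ext (\<lambda>S. basis (forest_relabel (inv \<sigma>) S))"
  "pcomp FH m n i = bilin_ext (\<lambda>S T.
     insertion i (forest_relabel (outer_label i n) S) (forest_relabel (inner_label i) T))"
  "ident FH = basis (point 1)"
  by (simp_all add: FH_def supported_def FH_space_def point_def)

lemma tree_forests_act:
  assumes "\<sigma> permutes {1..n}" "u \<in> ops free_operad n"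
  shows "act FH n \<sigma> (lin_ext tree_forests u) = lin_ext tree_forests (act free_operad n \<sigma> u)"
  unfolding FH_simps free_operad_simps relabel_def lin_ext_lin_ext lin_ext_single pm.scale_one
proof (rule lin_ext_cong)
  fix t assume "t \<in> Poly_Mapping.keys u"
  then have "t \<in> linear_trees {1..n}"
    using assms(2) by (auto simp: free_operad_simps supported_def trees_linear_trees)
  then show "lin_ext (\<lambda>S. basis (forest_relabel (inv \<sigma>) S)) (tree_forests t) =
      tree_forests (tree_relabel (inv \<sigma>) t)"
    using permutes_inj_on[OF permutes_inv[OF assms(1)]] by (subst tree_forests_relabel) auto
qed

lemma tree_forests_pcomp:
  fixes u v :: "nat tree \<Rightarrow>\<^sub>0 'k::field"
  assumes "i \<in> {1..m}" "u \<in> ops free_operad m" "v \<in> ops free_operad n"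
  shows "pcomp FH m n i (lin_ext tree_forests u) (lin_ext tree_forests v) =
    lin_ext tree_forests (pcomp free_operad m n i u v)"
proof -
  have *: "bilin_ext (\<lambda>S T. insertion i (forest_relabel (outer_label i n) S) (forest_relabel (inner_label i) T))
      (tree_forests s) (tree_forests t) = (tree_forests (tree_pcomp n i s t) :: _ \<Rightarrow>\<^sub>0 'k)"
    if st: "s \<in> trees m" "t \<in> trees n" for s t
  proof -
    have n: "n \<ge> 1" using st(2) by (rule trees_nonempty)
    have inj: "inj_on (outer_label i n) {1..m}" "inj_on (inner_label i) {1..n}"
      using n assms(1) by (auto simp: inj_on_def outer_label_def inner_label_def)
    have lin: "s \<in> linear_trees {1..m}" "t \<in> linear_trees {1..n}" using st by (auto simp: trees_linear_trees)
    have disj: "(outer_label i n ` {1..m} - {i}) \<inter> inner_label i ` {1..n} = {}"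
      using n assms(1) by (auto simp: outer_label_def inner_label_def split: if_splits)
    have mem: "i \<in> outer_label i n ` {1..m}"
      using assms(1) by (auto simp: outer_label_def image_iff intro!: bexI[of _ i])
    have "(tree_forests (tree_pcomp n i s t) :: _ \<Rightarrow>\<^sub>0 'k) = bilin_ext (insertion i)
        (tree_forests (tree_relabel (outer_label i n) s)) (tree_forests (tree_relabel (inner_label i) t))"
      by (rule tree_forests_substitute[OF linear_trees_relabel[OF lin(1) inj(1)]
          linear_trees_relabel[OF lin(2) inj(2)] _ _ mem disj]) simp_all
    also have "\<dots> = bilin_ext (\<lambda>S T. insertion i (forest_relabel (outer_label i n) S) (forest_relabel (inner_label i) T))
      (tree_forests s) (tree_forests t)"
      by (simp add: bilin_ext_left lin_ext_lin_ext
          tree_forests_relabel[OF lin(1) finite_atLeastAtMost inj(1)]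
          tree_forests_relabel[OF lin(2) finite_atLeastAtMost inj(2)])
    finally show ?thesis ..
  qed
  show ?thesis
    unfolding FH_simps free_operad_simps bilin_ext_lin_ext_left bilin_ext_lin_ext_right
    unfolding bilin_ext_left[of "\<lambda>s t. basis (f s t)" for f] lin_ext_lin_ext lin_ext_single pm.scale_one
    by (subst lin_ext_swap[of _ u], intro lin_ext_cong *)
      (use assms in \<open>auto simp: free_operad_simps supported_def\<close>)
qed

text \<open>Evaluated on single vertices, the associator of x leaves the tree with 2 and 3 attached
  to 1 by separate edges, which is symmetric in 2 and 3. The other relations say that 3 is attached
  to 1 or to 2, and that disjoint union is associative.\<close>

lemma tree_forests_rel:
  assumes "is_rel r"
  shows "lin_ext tree_forests (r (tree_input 1) (tree_input 2) (tree_input (3::nat))) = 0"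
proof -
  have *: "attach 2 (attach 1 (point 1) (point 2)) (point (3::nat)) = attach 1 (point 1) (attach 2 (point 2) (point 3))"
    "attach 3 (attach 1 (point 1) (point 3)) (point (2::nat)) = attach 1 (point 1) (attach 3 (point 3) (point 2))"
    "attach 1 (attach 1 (point 1) (point 2)) (point (3::nat)) = attach 1 (attach 1 (point 1) (point 3)) (point 2)"
    "attach 1 (join (point 1) (point 2)) (point (3::nat)) = join (attach 1 (point 1) (point 3)) (point 2)"
    "attach 2 (join (point 1) (point 2)) (point (3::nat)) = join (point 1) (attach 2 (point 2) (point 3))"
    "join (join (point 1) (point 2)) (point (3::nat)) = join (point 1) (join (point 2) (point 3))"
    by (auto simp: attach_def join_def point_def)
  have v: "verts (point a) = {a}" for a :: nat by (simp add: point_def)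
  show ?thesis
    using assms unfolding is_rel_def
    by (auto simp: prelie_rel_def leibniz_rel_def assoc_rel_def lin_ext_diff bilin_ext_single_left
        graft_def lin_ext_sum v * simp del: One_nat_def)
qed

lemma tree_forests_ideal:
  "operad_ideal free_operad comprelie_rels n u \<Longrightarrow> lin_ext tree_forests u = 0"
proof (induction rule: operad_ideal.induct)
  case (1 p n)
  then show ?case using tree_forests_rel by (auto simp: comprelie_rels_eq split: if_splits)
next
  case (5 n p \<sigma>)
  then have "p \<in> ops free_operad n" using comprelie_ideal_at_supported by (auto simp: free_operad_simps)
  from tree_forests_act[OF 5(2) this, symmetric] show ?case by (simp add: 5(3) FH_simps(3))
next
  case (6 m p q n i)
  then have "p \<in> ops free_operad m" using comprelie_ideal_at_supported by (auto simp: free_operad_simps)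
  from tree_forests_pcomp[OF 6(3) this 6(2), symmetric] show ?case by (simp add: 6(4) FH_simps(4))
next
  case (7 p m n q i)
  then have "q \<in> ops free_operad n" using comprelie_ideal_at_supported by (auto simp: free_operad_simps)
  from tree_forests_pcomp[OF 7(3,1) this, symmetric] show ?case by (simp add: 7(4) FH_simps(4))
qed (simp_all add: lin_ext_add lin_ext_scale free_operad_simps)

section \<open>Decomposition of forests and surjectivity\<close>

text \<open>Only arcs that lie in C as a whole are kept. The roots are passed separately, since a
  part cut off from a forest may have roots that are not roots of S.\<close>

definition restrict_forest :: "'a rooted_hypergraph \<Rightarrow> 'a set \<Rightarrow> 'a set \<Rightarrow> 'a rooted_hypergraph" where
  "restrict_forest S C R =
    \<lparr>verts = C, edges = {insert p B |p B. (p, B) \<in> arcs S \<and> p \<in> C \<and> B \<subseteq> C}, roots = R\<rparr>"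

context arc_forest
begin

text \<open>All new roots have the same depth k, so d v - k is a depth function for the restriction;
  the bound k \<le> d v keeps the subtraction exact.\<close>

lemma restrict_in_forests:
  assumes C: "C \<subseteq> verts S" "C \<noteq> {}" and R: "R \<subseteq> C"
    and k: "\<And>r. r \<in> R \<Longrightarrow> d r = k" "\<And>v. v \<in> C \<Longrightarrow> k \<le> d v"
    and ex: "\<And>v. v \<in> C \<Longrightarrow> v \<notin> R \<Longrightarrow> \<exists>p B. (p, B) \<in> A \<and> p \<in> C \<and> B \<subseteq> C \<and> v \<in> B"
  shows "restrict_forest S C R \<in> forests C"
proof -
  have "arc_forest (restrict_forest S C R) {(p, B). (p, B) \<in> A \<and> p \<in> C \<and> B \<subseteq> C} (\<lambda>v. d v - k)"
  proof
    show "finite (verts (restrict_forest S C R))"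
      using C(1) finite_verts by (simp add: restrict_forest_def finite_subset)
    show "edges (restrict_forest S C R) = (\<lambda>(p, B). insert p B) ` {(p, B). (p, B) \<in> A \<and> p \<in> C \<and> B \<subseteq> C}"
      unfolding restrict_forest_def arcs_eq by (simp add: image_def) blast
    show "d b - k = Suc (d p - k)" if "(p, B) \<in> {(p, B). (p, B) \<in> A \<and> p \<in> C \<and> B \<subseteq> C}" "b \<in> B" for p B b
      using that depth_arc[of p B b] k(2)[of p] by auto
    show "p = q \<and> B = B'" if "(p, B) \<in> {(p, B). (p, B) \<in> A \<and> p \<in> C \<and> B \<subseteq> C}"
      "(q, B') \<in> {(p, B). (p, B) \<in> A \<and> p \<in> C \<and> B \<subseteq> C}" "v \<in> B" "v \<in> B'" for p B q B' v
      using that arc_unique by blast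
    show "\<exists>p B. (p, B) \<in> {(p, B). (p, B) \<in> A \<and> p \<in> C \<and> B \<subseteq> C} \<and> v \<in> B"
      if "v \<in> verts (restrict_forest S C R)" "v \<notin> roots (restrict_forest S C R)" for v
      using that ex by (auto simp: restrict_forest_def)
    show "B \<noteq> {}" if "(p, B) \<in> {(p, B). (p, B) \<in> A \<and> p \<in> C \<and> B \<subseteq> C}" for p B
      using that arc_nonempty by blast
  qed (use C R k in \<open>auto simp: restrict_forest_def\<close>)
  from arc_forest.in_forests[OF this] show ?thesis by (simp add: restrict_forest_def)
qed

definition descendants :: "'a set \<Rightarrow> 'a set" where
  "descendants B = (child_rel A)\<^sup>* `` B"

lemma descendants_self: "B \<subseteq> descendants B"
  by (auto simp: descendants_def)

lemma descendants_closed: "(p, B') \<in> A \<Longrightarrow> p \<in> descendants B \<Longrightarrow> B' \<subseteq> descendants B"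
  by (auto simp: descendants_def child_rel_def intro: rtrancl_into_rtrancl)

lemma descendants_verts:
  assumes "B \<subseteq> verts S"
  shows "descendants B \<subseteq> verts S"
proof
  fix v assume "v \<in> descendants B"
  then obtain b where b: "b \<in> B" "(b, v) \<in> (child_rel A)\<^sup>*" by (auto simp: descendants_def)
  from b(2) show "v \<in> verts S"
    by (induction rule: rtrancl_induct) (use assms b(1) child_vert in \<open>auto simp: child_rel_def\<close>)
qed

lemma descendants_cases:
  assumes "v \<in> descendants B" "v \<notin> B"
  obtains p B' where "(p, B') \<in> A" "p \<in> descendants B" "v \<in> B'"
proof -
  obtain b where b: "b \<in> B" "(b, v) \<in> (child_rel A)\<^sup>*" using assms by (auto simp: descendants_def)
  from b(2) show thesis
  proof (cases rule: rtranclE)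
    case base
    then show ?thesis using b assms by simp
  next
    case (step p)
    then obtain B' where "(p, B') \<in> A" "v \<in> B'" by (auto simp: child_rel_def)
    then show ?thesis using that step b by (auto simp: descendants_def)
  qed
qed

lemma descendants_depth:
  assumes "v \<in> descendants B" "\<And>b. b \<in> B \<Longrightarrow> d b = k"
  shows "k \<le> d v"
proof -
  obtain b where b: "b \<in> B" "(b, v) \<in> (child_rel A)\<^sup>*" using assms by (auto simp: descendants_def)
  from b(2) have "d b \<le> d v"
    by (induction rule: rtrancl_induct) (auto simp: child_rel_def dest: depth_arc)
  then show ?thesis using assms(2) b(1) by simp
qed

lemma descendants_in_forests:
  assumes "B \<subseteq> verts S" "B \<noteq> {}" "\<And>b. b \<in> B \<Longrightarrow> d b = k"
  shows "restrict_forest S (descendants B) B \<in> forests (descendants B)"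
proof (rule restrict_in_forests)
  show "\<exists>p B'. (p, B') \<in> A \<and> p \<in> descendants B \<and> B' \<subseteq> descendants B \<and> v \<in> B'"
    if "v \<in> descendants B" "v \<notin> B" for v
    using descendants_cases[OF that] descendants_closed by metis
  show "k \<le> d v" if "v \<in> descendants B" for v using descendants_depth[OF that assms(3)] .
  show "descendants B \<noteq> {}" using assms(2) descendants_self by blast
qed (use assms descendants_self descendants_verts in auto)

text \<open>Covers two cuts: B a set of roots, which no arc meets, and B the children of a single
  arc. In both cases no other arc leads into the descendants of B from outside.\<close>

lemma complement_in_forests:
  assumes B: "verts S - descendants B \<noteq> {}" "roots S \<inter> descendants B \<subseteq> B"
    and arcs: "\<And>p B'. (p, B') \<in> A \<Longrightarrow> p \<notin> descendants B \<Longrightarrow> B' \<inter> B \<noteq> {} \<Longrightarrow> B' = B"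
  shows "restrict_forest S (verts S - descendants B) (roots S - B) \<in> forests (verts S - descendants B)"
    and "(p, B') \<in> A \<Longrightarrow> p \<notin> descendants B \<Longrightarrow> B' = B \<or> B' \<inter> descendants B = {}"
proof -
  have *: "B' = B \<or> B' \<inter> descendants B = {}" if B': "(p, B') \<in> A" "p \<notin> descendants B" for p B'
  proof (cases "B' \<inter> B = {}")
    case True
    have False if x: "x \<in> B'" "x \<in> descendants B" for x
    proof -
      have "x \<notin> B" using True x(1) by blast
      then obtain q C where "(q, C) \<in> A" "q \<in> descendants B" "x \<in> C" by (rule descendants_cases[OF x(2)])
      then show False using arc_unique[OF B'(1), of q C x] B'(2) x(1) by simp
    qed
    then show ?thesis by blast
  next
    case False
    then show ?thesis using arcs[OF B'] by blast
  qed
  then show "(p, B') \<in> A \<Longrightarrow> p \<notin> descendants B \<Longrightarrow> B' = B \<or> B' \<inter> descendants B = {}" by blast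
  show "restrict_forest S (verts S - descendants B) (roots S - B) \<in> forests (verts S - descendants B)"
  proof (rule restrict_in_forests[where k = 0])
    show "\<exists>p B'. (p, B') \<in> A \<and> p \<in> verts S - descendants B \<and> B' \<subseteq> verts S - descendants B \<and> v \<in> B'"
      if v: "v \<in> verts S - descendants B" "v \<notin> roots S - B" for v
    proof -
      have "v \<notin> roots S" using v descendants_self by blast
      then obtain p B' where B': "(p, B') \<in> A" "v \<in> B'" using arc_ex v by blast
      then have p: "p \<notin> descendants B" using descendants_closed v by blast
      have "B' \<noteq> B" using B' v descendants_self by blast
      then have "B' \<inter> descendants B = {}" using *[OF B'(1) p] by blast
      then show ?thesis using B' p arc_verts[OF B'(1)] by blast
    qed
  qed (use B roots_verts depth_root in auto)
qed

end

text \<open>The roots in B with their descendants form one part; a root is never a child, so no arc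
  connects the two parts.\<close>

lemma forest_split_roots:
  assumes "S \<in> forests L" "B \<subset> roots S" "B \<noteq> {}"
  shows "\<exists>M N S1 S2. L = M \<union> N \<and> M \<inter> N = {} \<and> S1 \<in> forests M \<and> S2 \<in> forests N \<and> S = join S1 S2"
proof -
  obtain d where d: "arc_forest S (arcs S) d" and L: "verts S = L" using forestsE[OF assms(1)] .
  interpret arc_forest S "arcs S" d by fact
  let ?N = "descendants B"
  have depth: "d b = 0" if "b \<in> B" for b using that assms(2) depth_root by blast
  have N: "?N \<subseteq> verts S" "B \<subseteq> verts S" using descendants_verts assms(2) roots_verts by blast+
  have inter: "roots S \<inter> ?N \<subseteq> B"
  proof
    fix r assume r: "r \<in> roots S \<inter> ?N"
    show "r \<in> B"
    proof (rule ccontr)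
      assume "r \<notin> B"
      then obtain p B' where "(p, B') \<in> arcs S" "r \<in> B'" using descendants_cases r by blast
      then show False using arc_not_root r by blast
    qed
  qed
  have no: "B' \<inter> B = {}" if "(p, B') \<in> arcs S" for p B' using arc_not_root[OF that] assms(2) by blast
  have ne: "verts S - ?N \<noteq> {}" using inter assms(2) roots_verts by blast
  have 1: "restrict_forest S (verts S - ?N) (roots S - B) \<in> forests (verts S - ?N)"
    by (rule complement_in_forests(1)[OF ne inter]) (use no in blast)
  have sep: "B' \<inter> ?N = {}" if "(p, B') \<in> arcs S" "p \<notin> ?N" for p B'
    using complement_in_forests(2)[OF ne inter _ that] no arc_nonempty[OF that(1)] no[OF that(1)] by blast
  have 2: "restrict_forest S ?N B \<in> forests ?N"
    by (rule descendants_in_forests[OF N(2) assms(3) depth])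
  have "edges S = {insert p B' |p B'. (p, B') \<in> arcs S}" by (auto simp: edges_arcs)
  also have "\<dots> = {insert p B' |p B'. (p, B') \<in> arcs S \<and> p \<in> verts S - ?N \<and> B' \<subseteq> verts S - ?N} \<union>
      {insert p B' |p B'. (p, B') \<in> arcs S \<and> p \<in> ?N \<and> B' \<subseteq> ?N}" (is "?L = ?R")
  proof
    show "?L \<subseteq> ?R"
    proof
      fix e assume "e \<in> ?L"
      then obtain p B' where e: "e = insert p B'" "(p, B') \<in> arcs S" by blast
      show "e \<in> ?R"
      proof (cases "p \<in> ?N")
        case True
        then show ?thesis using e descendants_closed[OF e(2) True] by blast
      next
        case False
        then show ?thesis using e sep[OF e(2) False] arc_verts[OF e(2)] by blast
      qed
    qed
  qed blast
  finally have "S = join (restrict_forest S (verts S - ?N) (roots S - B)) (restrict_forest S ?N B)"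
    using N assms(2) by (intro rooted_hypergraph.equality) (auto simp: join_def restrict_forest_def)
  then show ?thesis using 1 2 N(1) L by (metis Diff_disjoint Diff_partition Int_commute Un_commute)
qed

text \<open>Cuts the edge between q and its children B. All of B has depth \<open>Suc (d q)\<close>,
  so B becomes the root set of the part below, while q and the roots of S stay in the other
  part.\<close>

lemma forest_split_arc:
  assumes "S \<in> forests L" "(q, B) \<in> arcs S"
  shows "\<exists>M N S1 S2. L = M \<union> N \<and> M \<inter> N = {} \<and> q \<in> M \<and> S1 \<in> forests M \<and> S2 \<in> forests N \<and> S = attach q S1 S2"
proof -
  obtain d where d: "arc_forest S (arcs S) d" and L: "verts S = L" using forestsE[OF assms(1)] .
  interpret arc_forest S "arcs S" d by fact
  let ?N = "descendants B"
  have depth: "d b = Suc (d q)" if "b \<in> B" for b using that assms(2) depth_arc by blast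
  have N: "?N \<subseteq> verts S" "B \<subseteq> verts S" using descendants_verts arc_verts(2)[OF assms(2)] by blast+
  have deep: "Suc (d q) \<le> d v" if "v \<in> ?N" for v using descendants_depth[OF that depth] .
  have rN: "roots S \<inter> ?N = {}" using deep depth_root by fastforce
  then have inter: "roots S \<inter> ?N \<subseteq> B" by simp
  have qN: "q \<notin> ?N" using deep[of q] by auto
  have q: "q \<in> verts S" using arc_verts(1)[OF assms(2)] .
  have same: "p = q \<and> B' = B" if "(p, B') \<in> arcs S" "B' \<inter> B \<noteq> {}" for p B'
    using that arc_unique[OF that(1) assms(2)] by blast
  have ne: "verts S - ?N \<noteq> {}" using qN q by blast
  have 1: "restrict_forest S (verts S - ?N) (roots S - B) \<in> forests (verts S - ?N)"
    by (rule complement_in_forests(1)[OF ne inter]) (use same in blast)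
  have sep: "p = q \<and> B' = B \<or> B' \<inter> ?N = {}" if "(p, B') \<in> arcs S" "p \<notin> ?N" for p B'
    using complement_in_forests(2)[OF ne inter _ that] same arc_nonempty[OF that(1)] same[OF that(1)] by blast
  have 2: "restrict_forest S ?N B \<in> forests ?N"
    by (rule descendants_in_forests[OF N(2) arc_nonempty[OF assms(2)] depth])
  have "edges S = {insert p B' |p B'. (p, B') \<in> arcs S}" by (auto simp: edges_arcs)
  also have "\<dots> = insert (insert q B)
     ({insert p B' |p B'. (p, B') \<in> arcs S \<and> p \<in> verts S - ?N \<and> B' \<subseteq> verts S - ?N} \<union>
      {insert p B' |p B'. (p, B') \<in> arcs S \<and> p \<in> ?N \<and> B' \<subseteq> ?N})" (is "?L = ?R")
  proof
    show "?L \<subseteq> ?R"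
    proof
      fix e assume "e \<in> ?L"
      then obtain p B' where e: "e = insert p B'" "(p, B') \<in> arcs S" by blast
      show "e \<in> ?R"
      proof (cases "p \<in> ?N")
        case True
        then show ?thesis using e descendants_closed[OF e(2) True] by blast
      next
        case False
        then show ?thesis using e sep[OF e(2) False] arc_verts[OF e(2)] by blast
      qed
    qed
    show "?R \<subseteq> ?L" using assms(2) by blast
  qed
  finally have "S = attach q (restrict_forest S (verts S - ?N) (roots S - B)) (restrict_forest S ?N B)"
    using N rN descendants_self[of B]
    by (intro rooted_hypergraph.equality) (auto simp: attach_def restrict_forest_def)
  then show ?thesis using 1 2 N(1) L q qN
    by (metis Diff_disjoint Diff_partition DiffI Int_commute Un_commute)
qed

definition forests_image :: "'a set \<Rightarrow> ('a rooted_hypergraph \<Rightarrow>\<^sub>0 'k::field) set" where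
  "forests_image A = lin_ext tree_forests ` supported (linear_trees A)"

lemma subspace_forests_image: "pm.subspace (forests_image A :: ('a rooted_hypergraph \<Rightarrow>\<^sub>0 'k::field) set)"
  unfolding pm.subspace_def forests_image_def
proof (intro conjI ballI allI)
  show "0 \<in> lin_ext tree_forests ` supported (linear_trees A)"
    using pm.subspace_0[OF subspace_supported] by (metis image_eqI lin_ext_0)
next
  fix x y :: "'a rooted_hypergraph \<Rightarrow>\<^sub>0 'k"
  assume "x \<in> lin_ext tree_forests ` supported (linear_trees A)"
    "y \<in> lin_ext tree_forests ` supported (linear_trees A)"
  then show "x + y \<in> lin_ext tree_forests ` supported (linear_trees A)"
    by (auto simp: lin_ext_add[symmetric] intro!: imageI pm.subspace_add[OF subspace_supported])
next
  fix c and x :: "'a rooted_hypergraph \<Rightarrow>\<^sub>0 'k"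
  assume "x \<in> lin_ext tree_forests ` supported (linear_trees A)"
  then show "pm_scale c x \<in> lin_ext tree_forests ` supported (linear_trees A)"
    by (auto simp: lin_ext_scale[symmetric] intro!: imageI pm.subspace_scale[OF subspace_supported])
qed

lemma lin_ext_tree_forests_app:
  "lin_ext tree_forests (bilin_ext (\<lambda>s t. basis (tree_app g s t)) u v) =
    gen_forests g (lin_ext tree_forests u) (lin_ext tree_forests v)"
proof (cases g)
  case Gen_x
  then show ?thesis by (simp add: bilin_ext_left lin_ext_lin_ext lin_ext_swap[of _ v])
next
  case Gen_y
  then show ?thesis by (simp add: bilin_ext_left lin_ext_lin_ext lin_ext_swap[of _ u])
next
  case Gen_c
  then show ?thesis by (simp add: bilin_ext_left lin_ext_lin_ext lin_ext_swap[of _ v])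
qed

lemma forests_image_gen:
  assumes "u \<in> forests_image A" "v \<in> forests_image B" "A \<inter> B = {}" "finite A" "finite B"
  shows "gen_forests g u v \<in> forests_image (A \<union> B)"
proof -
  obtain u' v' where u': "u' \<in> supported (linear_trees A)" "u = lin_ext tree_forests u'"
    and v': "v' \<in> supported (linear_trees B)" "v = lin_ext tree_forests v'"
    using assms by (auto simp: forests_image_def)
  have "bilin_ext (\<lambda>s t. basis (tree_app g s t)) u' v' \<in> supported (linear_trees (A \<union> B))"
    using u' v' assms by (intro supported_bilin_ext[of _ "linear_trees A" _ "linear_trees B"])
      (auto intro: linear_trees_app)
  then show ?thesis unfolding forests_image_def u' v' lin_ext_tree_forests_app[symmetric] by blast
qed

lemma forest_without_root_arcs:
  assumes "S \<in> forests L" "roots S = {r}" "\<And>B. (r, B) \<notin> arcs S"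
  shows "S = point r" "L = {r}"
proof -
  obtain d where d: "arc_forest S (arcs S) d" and L: "verts S = L" using forestsE[OF assms(1)] .
  interpret arc_forest S "arcs S" d by fact
  have "v = r" if v: "v \<in> verts S" for v
  proof -
    have "(r, v) \<in> (child_rel (arcs S))\<^sup>*"
      using reach_root[OF v] assms(2) by (auto dest: relpow_imp_rtrancl)
    then show ?thesis
      by (cases rule: converse_rtranclE) (use assms(3) in \<open>auto simp: child_rel_def\<close>)
  qed
  then have V: "verts S = {r}" using roots_verts assms(2) by blast
  have "(p, B) \<notin> arcs S" for p B using arc_verts(1)[of p B] assms(3)[of B] V by auto
  then have "arcs S = {}" by auto
  then have "edges S = {}" using edges_arcs by simp
  then show "S = point r" "L = {r}" using V assms(2) L by (auto simp: point_def)
qed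

text \<open>If the only root r has an incoming edge, S is the summand v = r of
  \<open>graft S1 S2\<close>, where S1 and S2 have fewer vertices. In the other summands S2 hangs at
  another vertex, which leaves one edge less at the root and the same number of vertices; they are
  subtracted.\<close>

lemma forest_in_image:
  "S \<in> forests L \<Longrightarrow> Poly_Mapping.single S (1::'k::field) \<in> forests_image L"
proof (induction "(card L, card {a \<in> arcs S. fst a \<in> roots S})" arbitrary: L S
    rule: wf_induct_rule[OF wf_lex_prod[OF wf_less_than wf_less_than]])
  case less: (1 L S)
  have L: "finite L" "roots S \<noteq> {}" using forest_roots[OF less.prems] by auto
  have IH: "Poly_Mapping.single T (1::'k) \<in> forests_image M"
    if "T \<in> forests M" "M \<subset> L" for T M
    by (rule less.hyps[OF _ that(1)]) (use psubset_card_mono[OF L(1) that(2)] in simp)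
  show ?case
  proof (cases "\<exists>r. roots S = {r}")
    case False
    obtain r where r: "r \<in> roots S" using L(2) by blast
    have "{r} \<subset> roots S" using r False by blast
    then obtain M N S1 S2 where *: "L = M \<union> N" "M \<inter> N = {}" "S1 \<in> forests M" "S2 \<in> forests N" "S = join S1 S2"
      using forest_split_roots[OF less.prems, of "{r}"] by blast
    have "M \<subset> L" "N \<subset> L" using * forest_roots(4) by blast+
    then have "gen_forests Gen_c (Poly_Mapping.single S1 (1::'k)) (basis S2) \<in> forests_image (M \<union> N)"
      using * L by (intro forests_image_gen IH) auto
    then show ?thesis using * by (simp add: bilin_ext_single_left)
  next
    case True
    then obtain r where r: "roots S = {r}" by blast
    show ?thesis
    proof (cases "\<exists>B. (r, B) \<in> arcs S")
      case False
      then have "S = point r" "L = {r}" using forest_without_root_arcs[OF less.prems r] by auto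
      moreover have "Poly_Mapping.single (point r) (1::'k) = lin_ext tree_forests (basis (tree_input r))"
        by simp
      moreover have "Poly_Mapping.single (tree_input r) (1::'k) \<in> supported (linear_trees {r})"
        by (simp add: linear_trees_def)
      ultimately show ?thesis unfolding forests_image_def by blast
    next
      case True
      then obtain B where B: "(r, B) \<in> arcs S" by blast
      obtain M N S1 S2 where *: "L = M \<union> N" "M \<inter> N = {}" "r \<in> M" "S1 \<in> forests M" "S2 \<in> forests N" "S = attach r S1 S2"
        using forest_split_arc[OF less.prems B] by blast
      have sub: "M \<subset> L" "N \<subset> L" using * forest_roots(4) by blast+
      have fin: "finite M" "finite N" using * L by auto
      have "gen_forests Gen_x (Poly_Mapping.single S1 (1::'k)) (basis S2) \<in> forests_image (M \<union> N)"
        using * fin sub by (intro forests_image_gen IH) auto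
      then have g1: "graft S1 S2 \<in> (forests_image L :: (_ \<Rightarrow>\<^sub>0 'k) set)" using * by (simp add: bilin_ext_single_left)
      have g2: "graft S1 S2 = Poly_Mapping.single S (1::'k) + (\<Sum>v\<in>M - {r}. basis (attach v S1 S2))"
        unfolding graft_def forests_verts[OF *(4)] *(6) using fin(1) *(3) by (rule sum.remove)
      have g3: "Poly_Mapping.single (attach v S1 S2) (1::'k) \<in> forests_image L" if v: "v \<in> M - {r}" for v
      proof (rule less.hyps)
        have rS1: "roots S1 = {r}" using r * by simp
        have arcs: "arcs (attach v S1 S2) = insert (v, roots S2) (arcs S1 \<union> arcs S2)"
          "arcs S = insert (r, roots S2) (arcs S1 \<union> arcs S2)"
          using forests_attach(2)[OF *(4,5,2)] v * by auto
        show "attach v S1 S2 \<in> forests L" using forests_attach(1)[OF *(4,5,2)] v * by auto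
        obtain d where "arc_forest S (arcs S) d" using forestsE[OF less.prems] .
        then have "finite (arcs S)" by (rule arc_forest.finite_arcs)
        then have fin': "finite {a \<in> arcs S1. fst a = r}" by (simp add: arcs)
        have "(r, C) \<notin> arcs S2" for C using forest_arcs_verts(1)[OF *(5)] *(2,3) by blast
        then have eq: "{a \<in> arcs (attach v S1 S2). fst a \<in> roots (attach v S1 S2)} = {a \<in> arcs S1. fst a = r}"
          "{a \<in> arcs S. fst a \<in> roots S} = insert (r, roots S2) {a \<in> arcs S1. fst a = r}"
          using v rS1 r arcs by auto
        have "(r, roots S2) \<notin> arcs S1"
          using forest_arcs_verts(2)[OF *(4)] forest_roots(1,2)[OF *(5)] *(2) by blast
        then show "((card L, card {a \<in> arcs (attach v S1 S2). fst a \<in> roots (attach v S1 S2)}),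
            (card L, card {a \<in> arcs S. fst a \<in> roots S})) \<in> less_than <*lex*> less_than"
          unfolding eq using fin' by simp
      qed
      have "(\<Sum>v\<in>M - {r}. Poly_Mapping.single (attach v S1 S2) (1::'k)) \<in> forests_image L"
        by (rule pm.subspace_sum[OF subspace_forests_image g3])
      from pm.subspace_diff[OF subspace_forests_image g1 this] show ?thesis by (simp add: g2)
    qed
  qed
qed

lemma forests_image_eq:
  assumes "finite L"
  shows "forests_image L = (supported (forests L) :: ('a rooted_hypergraph \<Rightarrow>\<^sub>0 'k::field) set)"
proof
  show "forests_image L \<subseteq> (supported (forests L) :: ('a rooted_hypergraph \<Rightarrow>\<^sub>0 'k) set)"
    unfolding forests_image_def using tree_forests_supported[OF _ assms]
    by (auto intro: supported_lin_ext)
  show "(supported (forests L) :: ('a rooted_hypergraph \<Rightarrow>\<^sub>0 'k) set) \<subseteq> forests_image L"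
    using supported_in_subspace[OF subspace_forests_image _ forest_in_image] by blast
qed

lemma vector_space_FH: "vector_space (scale FH)"
  by (simp add: FH_simps vector_space_pm_scale)

lemma tree_forests_surj:
  "lin_ext tree_forests ` ops free_operad n = (ops FH n :: (nat rooted_hypergraph \<Rightarrow>\<^sub>0 'k::field) set)"
  using forests_image_eq[of "{1..n}", where 'k = 'k]
  by (simp add: forests_image_def free_operad_simps FH_simps trees_linear_trees)

lemma tree_forests_hom:
  "operad_hom free_operad (FH :: ('k::field, nat rooted_hypergraph \<Rightarrow>\<^sub>0 'k) operad_data)
    (\<lambda>_. lin_ext tree_forests)"
  by (rule operad_image[OF operad_free_operad vector_space_FH tree_forests_surj])
    (auto simp: tree_forests_act tree_forests_pcomp lin_ext_add lin_ext_scale simp del: One_nat_def atLeastAtMost_iff,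
     auto simp: FH_simps free_operad_simps lin_ext_scale)

section \<open>Symmetric braces in a ComPreLie algebra\<close>

text \<open>Only additivity of the products is asked for, not linearity: the sums in grafting have
  coefficients 1. The values of the single vertices are given by \<iota>.\<close>

locale comprelie_algebra =
  fixes tri :: "'q::ab_group_add \<Rightarrow> 'q \<Rightarrow> 'q" (infixl "\<lhd>" 70)
    and mul :: "'q \<Rightarrow> 'q \<Rightarrow> 'q" (infixl "\<odot>" 70)
    and \<iota> :: "'a \<Rightarrow> 'q"
  assumes tri_add_left: "(a + b) \<lhd> c = a \<lhd> c + b \<lhd> c"
    and tri_add_right: "a \<lhd> (b + c) = a \<lhd> b + a \<lhd> c"
    and mul_add_left: "(a + b) \<odot> c = a \<odot> c + b \<odot> c"
    and mul_commute: "a \<odot> b = b \<odot> a"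
    and mul_assoc: "(a \<odot> b) \<odot> c = a \<odot> (b \<odot> c)"
    and prelie: "(a \<lhd> b) \<lhd> c - a \<lhd> (b \<lhd> c) = (a \<lhd> c) \<lhd> b - a \<lhd> (c \<lhd> b)"
    and leibniz: "(a \<odot> b) \<lhd> c = (a \<lhd> c) \<odot> b + a \<odot> (b \<lhd> c)"
begin

lemma additive_tri: "additive (\<lambda>x. x \<lhd> c)" "additive (\<lambda>x. c \<lhd> x)" "additive (\<lambda>x. x \<odot> c)"
  by (simp_all add: additive_def tri_add_left tri_add_right mul_add_left)

lemmas tri_diff_left = additive.diff[OF additive_tri(1)]
lemmas tri_sum_left = additive.sum[OF additive_tri(1)]
lemmas mul_sum_left = additive.sum[OF additive_tri(3)]

text \<open>
  The symmetric braces of Oudom and Guin: \<open>brace a bs\<close> attaches every element of \<open>bs\<close> to the root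
  of \<open>a\<close> only, so the terms of the pre-Lie product in which \<open>b\<close> is attached to one of the other
  elements have to be subtracted.
\<close>

function brace :: "'q \<Rightarrow> 'q list \<Rightarrow> 'q" where
  "brace a [] = a"
| "brace a (b # bs) = brace a bs \<lhd> b - (\<Sum>j<length bs. brace a (bs[j := bs ! j \<lhd> b]))"
  by pat_completeness auto
termination by (relation "measure (\<lambda>(a, bs). length bs)") auto

text \<open>The recursion modifies one entry of the tail. If this is the entry being split,
  additivity of \<lhd> comes first. In \<open>brace_swap\<close> the lemma merges the terms in which
  a single entry receives both b and c.\<close>

lemma brace_add:
  "i < length xs \<Longrightarrow> brace a (xs[i := u + v]) = brace a (xs[i := u]) + brace a (xs[i := v])"
proof (induction "length xs" arbitrary: xs i u v)
  case (Suc n)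
  then obtain x bs where xs: "xs = x # bs" "length bs = n" by (metis length_Suc_conv)
  show ?case
  proof (cases i)
    case 0
    have "brace a (bs[j := bs ! j \<lhd> (u + v)]) = brace a (bs[j := bs ! j \<lhd> u]) + brace a (bs[j := bs ! j \<lhd> v])"
      if "j < n" for j
      using Suc.hyps(1)[of bs j] xs that by (simp add: tri_add_right)
    then show ?thesis using xs 0 by (simp add: tri_add_right sum.distrib)
  next
    case (Suc k)
    then have k: "k < n" using Suc.prems xs by simp
    let ?G = "\<lambda>w j. brace a (bs[k := w, j := bs[k := w] ! j \<lhd> x])"
    have G: "?G (u + v) j = ?G u j + ?G v j" if j: "j < n" for j
    proof (cases "j = k")
      case True
      then show ?thesis using k xs Suc.hyps(1)[of bs k] by (simp add: tri_add_left)
    next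
      case False
      have "?G w j = brace a (bs[j := bs ! j \<lhd> x, k := w])" for w
        using False by (simp add: list_update_swap)
      then show ?thesis using Suc.hyps(1)[of "bs[j := bs ! j \<lhd> x]" k] k xs by simp
    qed
    have "brace a (bs[k := u + v]) = brace a (bs[k := u]) + brace a (bs[k := v])"
      using Suc.hyps(1)[of bs k] k xs by simp
    then show ?thesis using xs Suc G by (simp add: sum.distrib tri_add_left)
  qed
qed simp

text \<open>Both sides are expanded. The terms in which b and c act on the whole brace agree by the
  pre-Lie identity. The terms with b and c attached to different entries are symmetric, and those
  with both in the same entry are again compared by the pre-Lie identity, inside this entry.\<close>

lemma brace_swap: "brace a (b # c # bs) = brace a (c # b # bs)"
proof -
  define n where "n = length bs"
  define F where "F = brace a"
  \<comment> \<open>First b is attached to the entry j, then c to the entry k of the new list; for j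
    = k the entry is multiplied by b and then by c.\<close>
  define H where "H b c j k = F (bs[j := bs ! j \<lhd> b, k := bs[j := bs ! j \<lhd> b] ! k \<lhd> c])" for b c j k
  have expand: "F (b # c # bs) =
      (F bs \<lhd> c \<lhd> b - F bs \<lhd> (c \<lhd> b))
      - ((\<Sum>j<n. F (bs[j := bs ! j \<lhd> c]) \<lhd> b) + (\<Sum>j<n. F (bs[j := bs ! j \<lhd> b]) \<lhd> c))
      + ((\<Sum>j<n. F (bs[j := bs ! j \<lhd> (c \<lhd> b)])) + (\<Sum>j<n. \<Sum>k<n. H b c j k))" for b c
  proof -
    have "F (b # c # bs) = F (c # bs) \<lhd> b - (F ((c \<lhd> b) # bs) + (\<Sum>j<n. F (c # bs[j := bs ! j \<lhd> b])))"
      unfolding F_def n_def by (subst brace.simps) (simp only: length_Cons sum.lessThan_Suc_shift, simp)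
    moreover have "F (c # bs) = F bs \<lhd> c - (\<Sum>j<n. F (bs[j := bs ! j \<lhd> c]))" for c
      by (simp add: F_def n_def)
    moreover have "F (c # bs[j := bs ! j \<lhd> b]) = F (bs[j := bs ! j \<lhd> b]) \<lhd> c - (\<Sum>k<n. H b c j k)" for j
      by (simp add: F_def n_def H_def)
    ultimately show ?thesis
      by (simp add: tri_diff_left tri_sum_left sum_subtractf algebra_simps)
  qed
  \<comment> \<open>After exchanging j and k in the second sum only the diagonal is left.\<close>
  have "(\<Sum>j<n. \<Sum>k<n. H b c j k) - (\<Sum>j<n. \<Sum>k<n. H c b j k) = (\<Sum>j<n. \<Sum>k<n. H b c j k - H c b k j)"
    by (subst (2) sum.swap) (simp add: sum_subtractf)
  also have "\<dots> = (\<Sum>j<n. H b c j j - H c b j j)"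
  proof (rule sum.cong[OF refl])
    fix j assume j: "j \<in> {..<n}"
    define X where "X = H b c j j - H c b j j"
    have "H b c j k - H c b k j = (if k = j then X else 0)" for k
      by (auto simp: X_def H_def list_update_swap)
    then show "(\<Sum>k<n. H b c j k - H c b k j) = H b c j j - H c b j j"
      using j by (simp add: X_def[symmetric])
  qed
  also have "\<dots> = (\<Sum>j<n. F (bs[j := bs ! j \<lhd> (b \<lhd> c)]) - F (bs[j := bs ! j \<lhd> (c \<lhd> b)]))"
  proof (rule sum.cong[OF refl])
    fix j assume j: "j \<in> {..<n}"
    have "(bs ! j \<lhd> b) \<lhd> c + bs ! j \<lhd> (c \<lhd> b) = (bs ! j \<lhd> c) \<lhd> b + bs ! j \<lhd> (b \<lhd> c)"
      using prelie[of "bs ! j" b c] by (simp add: algebra_simps)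
    then have "H b c j j + F (bs[j := bs ! j \<lhd> (c \<lhd> b)]) = H c b j j + F (bs[j := bs ! j \<lhd> (b \<lhd> c)])"
      using j by (simp add: H_def F_def n_def brace_add[symmetric])
    then show "H b c j j - H c b j j = F (bs[j := bs ! j \<lhd> (b \<lhd> c)]) - F (bs[j := bs ! j \<lhd> (c \<lhd> b)])"
      by (simp add: algebra_simps)
  qed
  finally have "(\<Sum>j<n. F (bs[j := bs ! j \<lhd> (c \<lhd> b)])) + (\<Sum>j<n. \<Sum>k<n. H b c j k) =
      (\<Sum>j<n. F (bs[j := bs ! j \<lhd> (b \<lhd> c)])) + (\<Sum>j<n. \<Sum>k<n. H c b j k)"
    by (simp add: sum_subtractf algebra_simps)
  moreover have "F bs \<lhd> c \<lhd> b - F bs \<lhd> (c \<lhd> b) = F bs \<lhd> b \<lhd> c - F bs \<lhd> (b \<lhd> c)"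
    by (rule prelie)
  ultimately have "F (b # c # bs) = F (c # b # bs)"
    unfolding expand by (simp add: add.commute)
  then show ?thesis by (simp only: F_def)
qed

definition mbrace :: "'q \<Rightarrow> 'q multiset \<Rightarrow> 'q" where
  "mbrace a M = brace a (SOME xs. mset xs = M)"

text \<open>By induction the brace of b # bs depends on bs only as a multiset. If the heads b and c
  differ, the lists can be rearranged to begin with b, c and with c, b, followed by the same tail,
  and \<open>brace_swap\<close> applies.\<close>

lemma brace_mset: "mset xs = mset ys \<Longrightarrow> brace a xs = brace a ys"
proof (induction "length xs" arbitrary: xs ys)
  case (Suc n)
  have mb: "brace a zs = mbrace a (mset zs)" if "length zs = n" for zs
  proof -
    have "mset (SOME xs. mset xs = mset zs) = mset zs" by (rule someI) simp
    then show ?thesis unfolding mbrace_def using Suc.hyps(1)[of zs] that by metis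
  qed
  have Cons: "brace a (b # bs) = mbrace a (mset bs) \<lhd> b -
      (\<Sum>m\<in>#mset bs. mbrace a (add_mset (m \<lhd> b) (mset bs - {#m#})))" if "length bs = n" for b bs
  proof -
    have "(\<Sum>j<length bs. brace a (bs[j := bs ! j \<lhd> b])) =
        (\<Sum>j<length bs. mbrace a (add_mset (bs ! j \<lhd> b) (mset bs - {#bs ! j#})))"
      using that by (intro sum.cong refl) (simp add: mb mset_update)
    also have "\<dots> = sum_list (map (\<lambda>m. mbrace a (add_mset (m \<lhd> b) (mset bs - {#m#}))) bs)"
      by (simp add: sum_list_sum_nth atLeast0LessThan)
    finally show ?thesis using that by (simp add: mb sum_mset_sum_list[symmetric])
  qed
  have len: "length ys = length xs" using Suc.prems by (metis size_mset)
  obtain b bs where xs: "xs = b # bs" "length bs = n" using Suc.hyps(2) by (metis length_Suc_conv)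
  obtain c cs where ys: "ys = c # cs" "length cs = n" using Suc.hyps(2) len by (metis length_Suc_conv)
  show ?case
  proof (cases "b = c")
    case True
    then have "mset bs = mset cs" using Suc.prems xs ys by simp
    then show ?thesis using Cons xs ys True by simp
  next
    case False
    have "c \<in># mset bs"
      using Suc.prems xs ys False by (metis insert_noteq_member mset.simps(2))
    then obtain M where M: "mset bs = add_mset c M" by (metis mset_add)
    obtain zs where zs: "mset zs = M" using ex_mset by blast
    have "mset cs = add_mset b M" using Suc.prems xs ys M by (simp add: add_mset_commute)
    moreover have "length (c # zs) = n" using M zs xs by (metis length_Cons mset.simps(2) size_mset)
    ultimately have "brace a (b # bs) = brace a (b # c # zs)" "brace a (c # cs) = brace a (c # b # zs)"
      using Cons[OF xs(2)] Cons[OF ys(2)] Cons[of "c # zs"] Cons[of "b # zs"] M zs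
      by (simp_all del: brace.simps)
    then show ?thesis using brace_swap xs ys by metis
  qed
qed simp

lemma mbrace_mset: "mbrace a (mset xs) = brace a xs"
proof -
  have "mset (SOME ys. mset ys = mset xs) = mset xs" by (rule someI) simp
  then show ?thesis unfolding mbrace_def by (rule brace_mset)
qed

lemma mbrace_empty [simp]: "mbrace a {#} = a"
  using mbrace_mset[of a "[]"] by simp

text \<open>Read the other way round: multiplying a brace by b adds b as a new argument or attaches
  b to one of the old arguments.\<close>

lemma mbrace_add_mset:
  "mbrace a (add_mset b M) = mbrace a M \<lhd> b - (\<Sum>m\<in>#M. mbrace a (add_mset (m \<lhd> b) (M - {#m#})))"
proof -
  obtain bs where bs: "mset bs = M" using ex_mset by blast
  have "(\<Sum>j<length bs. brace a (bs[j := bs ! j \<lhd> b])) =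
      (\<Sum>j<length bs. mbrace a (add_mset (bs ! j \<lhd> b) (mset bs - {#bs ! j#})))"
    by (intro sum.cong refl) (simp add: mbrace_mset[symmetric] mset_update)
  also have "\<dots> = sum_list (map (\<lambda>m. mbrace a (add_mset (m \<lhd> b) (mset bs - {#m#}))) bs)"
    by (simp add: sum_list_sum_nth atLeast0LessThan)
  finally show ?thesis
    using mbrace_mset[of a "b # bs"] mbrace_mset[of a bs] by (simp add: bs sum_mset_sum_list[symmetric])
qed

lemma additive_mbrace: "additive (\<lambda>u. mbrace a (add_mset u M))"
proof
  fix u v
  obtain bs where bs: "mset bs = M" using ex_mset by blast
  \<comment> \<open>A placeholder in the first entry, so that \<open>brace_add\<close> applies at
    index 0.\<close>
  have *: "mbrace a (add_mset w M) = brace a ((0 # bs)[0 := w])" for w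
    using mbrace_mset[of a "w # bs"] by (simp add: bs)
  show "mbrace a (add_mset (u + v) M) = mbrace a (add_mset u M) + mbrace a (add_mset v M)"
    unfolding * by (rule brace_add) simp
qed

lemmas mbrace_sum = additive.sum[OF additive_mbrace]

text \<open>There is no unit for \<open>\<odot>\<close>, so \<open>None\<close> is adjoined as one for the product over a finite set.\<close>

fun option_mul :: "'q option \<Rightarrow> 'q option \<Rightarrow> 'q option" where
  "option_mul None y = y"
| "option_mul (Some x) None = Some x"
| "option_mul (Some x) (Some y) = Some (x \<odot> y)"

sublocale option_mul: comm_monoid_set option_mul None
proof
  show "option_mul (option_mul x y) z = option_mul x (option_mul y z)" for x y z
    by (cases x; cases y; cases z) (simp_all add: mul_assoc)
  show "option_mul x y = option_mul y x" for x y
    by (cases x; cases y) (simp_all add: mul_commute)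
  show "option_mul x None = x" for x by (cases x) simp_all
qed

text \<open>The product of an empty family is \<open>the None\<close>; sets of roots and sets of
  children are nonempty.\<close>

definition mul_prod :: "('b \<Rightarrow> 'q) \<Rightarrow> 'b set \<Rightarrow> 'q" where
  "mul_prod g B = the (option_mul.F (\<lambda>x. Some (g x)) B)"

lemma Some_setprod:
  "finite B \<Longrightarrow> B \<noteq> {} \<Longrightarrow> option_mul.F (\<lambda>x. Some (g x)) B = Some (mul_prod g B)"
proof (induction B rule: finite_ne_induct)
  case (insert x F)
  then have "option_mul.F (\<lambda>x. Some (g x)) (insert x F) = Some (g x \<odot> mul_prod g F)" by simp
  then show ?case by (simp add: mul_prod_def)
qed (simp add: mul_prod_def)

lemma mul_prod_singleton [simp]: "mul_prod g {b} = g b"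
  by (simp add: mul_prod_def)

lemma mul_prod_union:
  assumes "finite B" "finite C" "B \<noteq> {}" "C \<noteq> {}" "B \<inter> C = {}"
  shows "mul_prod g (B \<union> C) = mul_prod g B \<odot> mul_prod g C"
proof -
  have "Some (mul_prod g (B \<union> C)) = option_mul (Some (mul_prod g B)) (Some (mul_prod g C))"
    using assms by (simp add: Some_setprod[symmetric] option_mul.union_disjoint)
  then show ?thesis by simp
qed

lemma mul_prod_insert:
  "finite B \<Longrightarrow> B \<noteq> {} \<Longrightarrow> b \<notin> B \<Longrightarrow> mul_prod g (insert b B) = g b \<odot> mul_prod g B"
  using mul_prod_union[of "{b}" B g] by simp

lemma mul_prod_cong: "(\<And>b. b \<in> B \<Longrightarrow> g b = h b) \<Longrightarrow> mul_prod g B = mul_prod h B"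
  unfolding mul_prod_def by (intro arg_cong[of _ _ the] option_mul.cong) auto

text \<open>By the Leibniz rule, multiplication by t on the right is a derivation of \<odot>: it
  acts on one factor at a time.\<close>

lemma mul_prod_tri:
  "finite B \<Longrightarrow> B \<noteq> {} \<Longrightarrow> mul_prod g B \<lhd> t = (\<Sum>b\<in>B. mul_prod (g(b := g b \<lhd> t)) B)"
proof (induction B rule: finite_ne_induct)
  case (insert x F)
  have eq: "mul_prod (g(b := g b \<lhd> t)) (insert x F) = g x \<odot> mul_prod (g(b := g b \<lhd> t)) F" if "b \<in> F" for b
  proof -
    have "b \<noteq> x" using insert.hyps(3) that by blast
    then show ?thesis using insert.hyps by (simp add: mul_prod_insert)
  qed
  have x: "mul_prod (g(x := g x \<lhd> t)) (insert x F) = (g x \<lhd> t) \<odot> mul_prod g F"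
  proof -
    have "mul_prod (g(x := g x \<lhd> t)) F = mul_prod g F"
      by (rule mul_prod_cong) (use insert.hyps(3) in auto)
    then show ?thesis using insert.hyps by (simp add: mul_prod_insert)
  qed
  have F: "g x \<odot> (mul_prod g F \<lhd> t) = (\<Sum>b\<in>F. mul_prod (g(b := g b \<lhd> t)) (insert x F))"
    unfolding insert.IH by (simp add: eq mul_commute[of "g x"] mul_sum_left)
  have "mul_prod g (insert x F) \<lhd> t = (g x \<lhd> t) \<odot> mul_prod g F + g x \<odot> (mul_prod g F \<lhd> t)"
    using insert.hyps by (simp add: mul_prod_insert leibniz)
  also have "\<dots> = (\<Sum>b\<in>insert x F. mul_prod (g(b := g b \<lhd> t)) (insert x F))"
    unfolding x[symmetric] F using insert.hyps(1,3) by (simp only: sum.insert not_False_eq_True)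
  finally show ?case .
qed simp

lemma mul_prod_sum:
  assumes "finite B" "b \<in> B"
  shows "mul_prod (g(b := \<Sum>x\<in>X. f x)) B = (\<Sum>x\<in>X. mul_prod (g(b := f x)) B)"
\<comment> \<open>The case of a single factor is separate, as the algebra has no empty product that
  could remain.\<close>
proof (cases "B = {b}")
  case False
  have *: "mul_prod (g(b := w)) B = w \<odot> mul_prod g (B - {b})" for w
  proof -
    have "mul_prod (g(b := w)) (insert b (B - {b})) = w \<odot> mul_prod (g(b := w)) (B - {b})"
      using assms False by (subst mul_prod_insert) auto
    moreover have "mul_prod (g(b := w)) (B - {b}) = mul_prod g (B - {b})" by (rule mul_prod_cong) auto
    ultimately show ?thesis using assms by (simp add: insert_absorb)
  qed
  show ?thesis unfolding * by (rule mul_sum_left)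
qed simp

section \<open>Evaluation of forests in a ComPreLie algebra\<close>

text \<open>The value of the hypertree below v: each incoming edge contributes the product of the
  values of its children, and all edges are attached to the label of v. A multiset is needed because
  different edges may have the same value.\<close>

definition node_value :: "('a \<times> 'a set) set \<Rightarrow> 'a \<Rightarrow> 'q" where
  "node_value A = wfrec ((child_rel A)\<inverse>)
    (\<lambda>rec v. mbrace (\<iota> v) (image_mset (mul_prod rec) (mset_set {B. (v, B) \<in> A})))"

definition forest_value :: "'a rooted_hypergraph \<Rightarrow> 'q" where
  "forest_value S = mul_prod (node_value (arcs S)) (roots S)"

lemma node_value_unfold:
  assumes "wf ((child_rel A)\<inverse>)"
  shows "node_value A v = mbrace (\<iota> v) (image_mset (mul_prod (node_value A)) (mset_set {B. (v, B) \<in> A}))"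
proof -
  have "mul_prod (cut (node_value A) ((child_rel A)\<inverse>) v) B = mul_prod (node_value A) B"
    if "(v, B) \<in> A" for B
    using that by (intro mul_prod_cong cut_apply) (auto simp: child_rel_def)
  then have "image_mset (mul_prod (cut (node_value A) ((child_rel A)\<inverse>) v)) (mset_set {B. (v, B) \<in> A}) =
      image_mset (mul_prod (node_value A)) (mset_set {B. (v, B) \<in> A})"
    by (cases "finite {B. (v, B) \<in> A}") (auto intro: image_mset_cong)
  then show ?thesis
    using def_wfrec[OF node_value_def[of A, THEN eq_reflection] assms, of v] by simp
qed

text \<open>The value at v involves only the arcs below v. It carries over from one forest to
  another wherever a set closed under children keeps its arcs, as happens when forests are joined or
  attached.\<close>

lemma node_value_local:
  assumes wf: "wf ((child_rel A)\<inverse>)" "wf ((child_rel A')\<inverse>)"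
    and eq: "\<And>v B. v \<in> C \<Longrightarrow> (v, B) \<in> A' \<longleftrightarrow> (v, B) \<in> A"
    and closed: "\<And>v B. v \<in> C \<Longrightarrow> (v, B) \<in> A \<Longrightarrow> B \<subseteq> C"
  shows "v \<in> C \<Longrightarrow> node_value A' v = node_value A v"
proof (induction v rule: wf_induct_rule[OF wf(1)])
  case (1 v)
  have "mul_prod (node_value A') B = mul_prod (node_value A) B" if "(v, B) \<in> A" for B
    using that closed[OF 1(2) that] by (intro mul_prod_cong 1(1)) (auto simp: child_rel_def)
  then have "image_mset (mul_prod (node_value A')) (mset_set {B. (v, B) \<in> A}) =
      image_mset (mul_prod (node_value A)) (mset_set {B. (v, B) \<in> A})"
    by (cases "finite {B. (v, B) \<in> A}") (auto intro: image_mset_cong)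
  then show ?case
    using eq[OF 1(2)] by (simp add: node_value_unfold[OF wf(1)] node_value_unfold[OF wf(2)])
qed

end

section \<open>Well-foundedness and descendants\<close>

lemma (in arc_forest) wf_child_rel: "wf ((child_rel A)\<inverse>)"
proof (rule finite_acyclic_wf_converse)
  have "child_rel A \<subseteq> verts S \<times> verts S"
    using arc_verts(1) child_vert by (auto simp: child_rel_def)
  then show "finite (child_rel A)" using finite_verts by (blast intro: finite_subset)
  have "child_rel A \<subseteq> measure d" using depth_arc by (auto simp: child_rel_def)
  then show "acyclic (child_rel A)" using wf_measure wf_subset wf_acyclic by blast
qed

lemma forest_wf_child_rel: "S \<in> forests L \<Longrightarrow> wf ((child_rel (arcs S))\<inverse>)"
  using forestsE arc_forest.wf_child_rel by blast

context arc_forest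
begin

text \<open>Both b and c lie on the chain of parents of v, which is unique and meets each depth
  once.\<close>

lemma descendants_depth_eq:
  assumes "v \<in> descendants {b}" "v \<in> descendants {c}" "d b = d c"
  shows "b = c"
proof -
  have deep: "d x \<le> d y" if "(x, y) \<in> (child_rel A)\<^sup>*" for x y
    using that by (induction rule: rtrancl_induct) (auto simp: child_rel_def dest: depth_arc)
  have "(b, v) \<in> (child_rel A)\<^sup>*" "(c, v) \<in> (child_rel A)\<^sup>*" using assms by (auto simp: descendants_def)
  then show ?thesis
  proof (induction rule: rtrancl_induct)
    case base
    then show ?case
    proof (cases rule: rtranclE)
      case (step y)
      then have "d c \<le> d y" "d b = Suc (d y)" using deep depth_arc by (auto simp: child_rel_def)
      then show ?thesis using assms(3) by simp
    qed simp
  next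
    case (step y z)
    from step.prems show ?case
    proof (cases rule: rtranclE)
      case base
      then have "d c = Suc (d y)" "d b \<le> d y"
        using step.hyps deep depth_arc by (auto simp: child_rel_def)
      then show ?thesis using assms(3) by simp
    next
      case (step y')
      then have "y' = y" using \<open>(y, z) \<in> child_rel A\<close> arc_unique unfolding child_rel_def by blast
      then show ?thesis using step(1) \<open>(c, y) \<in> (child_rel A)\<^sup>* \<Longrightarrow> b = c\<close> by simp
    qed
  qed
qed

lemma descendants_single:
  "descendants {w} = insert w (\<Union>B\<in>{B. (w, B) \<in> A}. \<Union>b\<in>B. descendants {b})" (is "?L = ?R")
proof
  show "?L \<subseteq> ?R"
  proof
    fix v assume "v \<in> ?L"
    then have "(w, v) \<in> (child_rel A)\<^sup>*" by (simp add: descendants_def)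
    then show "v \<in> ?R"
      by (cases rule: converse_rtranclE) (auto simp: descendants_def child_rel_def)
  qed
  show "?R \<subseteq> ?L"
    by (auto simp: descendants_def child_rel_def intro: converse_rtrancl_into_rtrancl)
qed

lemma descendants_roots: "verts S = (\<Union>r\<in>roots S. descendants {r})"
proof
  show "verts S \<subseteq> (\<Union>r\<in>roots S. descendants {r})"
    using reach_root by (force simp: descendants_def dest: relpow_imp_rtrancl)
  show "(\<Union>r\<in>roots S. descendants {r}) \<subseteq> verts S"
    using descendants_verts roots_verts by blast
qed

end

context comprelie_algebra
begin

lemma forest_value_point: "forest_value (point a) = \<iota> a"
proof -
  have arcs: "arcs (point a) = {}" by (rule arc_forest.arcs_eq[OF arc_forest_point])
  have "node_value {} a = \<iota> a"
    by (subst node_value_unfold) (simp_all add: child_rel_def)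
  then show ?thesis by (simp add: forest_value_def arcs) (simp add: point_def)
qed

lemma forest_value_join:
  assumes S: "S \<in> forests L" and T: "T \<in> forests M" and disj: "L \<inter> M = {}"
  shows "forest_value (join S T) = forest_value S \<odot> forest_value T"
proof -
  note J = forests_join[OF S T disj]
  note wf = forest_wf_child_rel[OF S] forest_wf_child_rel[OF T] forest_wf_child_rel[OF J(1)]
  have vS: "node_value (arcs (join S T)) v = node_value (arcs S) v" if v: "v \<in> L" for v
  proof (rule node_value_local[OF wf(1,3), of L])
    show "(u, B) \<in> arcs (join S T) \<longleftrightarrow> (u, B) \<in> arcs S" if "u \<in> L" for u B
      using that disj forest_arcs_verts(1)[OF T] unfolding J(2) by blast
  qed (use forest_arcs_verts(2)[OF S] v in auto)
  have vT: "node_value (arcs (join S T)) v = node_value (arcs T) v" if v: "v \<in> M" for v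
  proof (rule node_value_local[OF wf(2,3), of M])
    show "(u, B) \<in> arcs (join S T) \<longleftrightarrow> (u, B) \<in> arcs T" if "u \<in> M" for u B
      using that disj forest_arcs_verts(1)[OF S] unfolding J(2) by blast
  qed (use forest_arcs_verts(2)[OF T] v in auto)
  have "mul_prod (node_value (arcs (join S T))) (roots S) = forest_value S"
    unfolding forest_value_def by (rule mul_prod_cong) (use vS forest_roots[OF S] in auto)
  moreover have "mul_prod (node_value (arcs (join S T))) (roots T) = forest_value T"
    unfolding forest_value_def by (rule mul_prod_cong) (use vT forest_roots[OF T] in auto)
  moreover have "finite (roots S)" "finite (roots T)" "roots S \<inter> roots T = {}"
    using forest_roots[OF S] forest_roots[OF T] disj by (auto intro: finite_subset)
  ultimately show ?thesis
    using forest_roots(2)[OF S] forest_roots(2)[OF T]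
    by (simp add: forest_value_def[of "join S T"] mul_prod_union)
qed

text \<open>Here D b stands for the vertices below b and h v b for the value of b after t has been
  attached at v. Attaching below b changes only the factor of b, and the Leibniz rule sums these
  changes up.\<close>

lemma mul_prod_attach_sum:
  assumes B: "finite B" "B \<noteq> {}" and fin: "\<And>b. b \<in> B \<Longrightarrow> finite (D b)"
    and disj: "\<And>b c. b \<in> B \<Longrightarrow> c \<in> B \<Longrightarrow> b \<noteq> c \<Longrightarrow> D b \<inter> D c = {}"
    and sum: "\<And>b. b \<in> B \<Longrightarrow> (\<Sum>v\<in>D b. h v b) = g b \<lhd> t"
    and other: "\<And>b c v. b \<in> B \<Longrightarrow> c \<in> B \<Longrightarrow> v \<in> D c \<Longrightarrow> v \<notin> D b \<Longrightarrow> h v b = g b"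
  shows "(\<Sum>v\<in>(\<Union>b\<in>B. D b). mul_prod (h v) B) = mul_prod g B \<lhd> t"
proof -
  have "(\<Sum>v\<in>(\<Union>b\<in>B. D b). mul_prod (h v) B) = (\<Sum>b\<in>B. \<Sum>v\<in>D b. mul_prod (h v) B)"
    using B fin disj by (intro sum.UNION_disjoint) auto
  also have "\<dots> = (\<Sum>b\<in>B. \<Sum>v\<in>D b. mul_prod (g(b := h v b)) B)"
  proof (intro sum.cong refl mul_prod_cong)
    fix b v c assume "b \<in> B" "v \<in> D b" "c \<in> B"
    then show "h v c = (g(b := h v b)) c" using disj[of b c] other[of c b v] by auto
  qed
  also have "\<dots> = (\<Sum>b\<in>B. mul_prod (g(b := g b \<lhd> t)) B)"
    using B by (intro sum.cong refl) (simp add: mul_prod_sum[symmetric] sum)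
  also have "\<dots> = mul_prod g B \<lhd> t" using B by (simp add: mul_prod_tri)
  finally show ?thesis .
qed

text \<open>By induction from the leaves, the values at w summed over all attachments below w give
  the old value multiplied by t. For v = w the brace gets the new argument t; for v below an edge of
  w the argument of this edge is changed. The terms of the second kind cancel those subtracted in
  \<open>mbrace_add_mset\<close>.\<close>

lemma forest_value_graft:
  assumes S: "S \<in> forests L" and T: "T \<in> forests M" and LM: "L \<inter> M = {}"
  shows "(\<Sum>v\<in>L. forest_value (attach v S T)) = forest_value S \<lhd> forest_value T"
proof -
  obtain d where d: "arc_forest S (arcs S) d" and L: "verts S = L" using forestsE[OF S] .
  interpret arc_forest S "arcs S" d by fact
  define t where "t = forest_value T"
  define A where "A v = arcs (attach v S T)" for v
  have A: "A v = insert (v, roots T) (arcs S \<union> arcs T)" if "v \<in> L" for v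
    using forests_attach(2)[OF S T LM that] by (simp add: A_def)
  have wf: "wf ((child_rel (A v))\<inverse>)" if "v \<in> L" for v
    using forest_wf_child_rel[OF forests_attach(1)[OF S T LM that]] by (simp add: A_def)
  note S_arcs = forest_arcs_verts[OF S] and T_arcs = forest_arcs_verts[OF T]
  define D where "D w = descendants {w}" for w
  have D_L: "D w \<subseteq> L" if "w \<in> L" for w using descendants_verts[of "{w}"] that by (simp add: D_def L)
  have fin_D: "finite (D w)" if "w \<in> L" for w using D_L[OF that] finite_verts L by (simp add: finite_subset)
  have self: "w \<in> D w" for w using descendants_self[of "{w}"] by (simp add: D_def)
  have other: "node_value (A v) w = node_value (arcs S) w" if "v \<in> L" "w \<in> L" "v \<notin> D w" for v w
  proof (rule node_value_local[OF forest_wf_child_rel[OF S] wf[OF that(1)], of "D w"])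
    show "(u, B) \<in> A v \<longleftrightarrow> (u, B) \<in> arcs S" if "u \<in> D w" for u B
    proof -
      have "u \<in> L" "u \<noteq> v" using that \<open>v \<notin> D w\<close> D_L[OF \<open>w \<in> L\<close>] by auto
      then show ?thesis using T_arcs(1) LM unfolding A[OF \<open>v \<in> L\<close>] by blast
    qed
    show "B \<subseteq> D w" if "u \<in> D w" "(u, B) \<in> arcs S" for u B
      using descendants_closed[OF that(2)] that(1) by (simp add: D_def)
  qed (rule self)
  \<comment> \<open>The copy of T inside the new forest keeps its value.\<close>
  have inT: "mul_prod (node_value (A v)) (roots T) = t" if "v \<in> L" for v
    unfolding t_def forest_value_def
  proof (rule mul_prod_cong)
    fix b assume "b \<in> roots T"
    then have b: "b \<in> M" using forest_roots[OF T] by blast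
    show "node_value (A v) b = node_value (arcs T) b"
    proof (rule node_value_local[OF forest_wf_child_rel[OF T] wf[OF that], of M])
      show "(u, B) \<in> A v \<longleftrightarrow> (u, B) \<in> arcs T" if "u \<in> M" for u B
        using that S_arcs(1) LM \<open>v \<in> L\<close> unfolding A[OF \<open>v \<in> L\<close>] by blast
    qed (use T_arcs b in auto)
  qed
  have main: "(\<Sum>v\<in>D w. node_value (A v) w) = node_value (arcs S) w \<lhd> t" if "w \<in> L" for w
    using that
  proof (induction w rule: wf_induct_rule[OF forest_wf_child_rel[OF S]])
    case (1 w)
    let ?nv = "node_value (arcs S)" and ?K = "{B. (w, B) \<in> arcs S}"
    have K: "finite ?K"
      by (rule finite_subset[of _ "Pow L"]) (use S_arcs(2) finite_verts L in auto)
    have B: "finite B" "B \<noteq> {}" "B \<subseteq> L" "w \<notin> B" if "B \<in> ?K" for B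
      using that S_arcs[of w B] finite_verts L by (auto intro: finite_subset)
    have depth: "d b = Suc (d w)" if "B \<in> ?K" "b \<in> B" for B b using depth_arc that by blast
    have w_notin: "w \<notin> D b" if "B \<in> ?K" "b \<in> B" for B b
      using descendants_depth[of w "{b}" "d b"] depth[OF that] by (auto simp: D_def)
    define U where "U B = (\<Union>b\<in>B. D b)" for B
    have U_L: "U B \<subseteq> L" "finite (U B)" if "B \<in> ?K" for B
    proof -
      show "U B \<subseteq> L" using B(3)[OF that] D_L unfolding U_def by blast
      then show "finite (U B)" using finite_verts L by (simp add: finite_subset)
    qed
    have U_w: "w \<notin> U B" if "B \<in> ?K" for B using w_notin[OF that] by (auto simp: U_def)
    have U_disj: "U B \<inter> U C = {}" if "B \<in> ?K" "C \<in> ?K" "B \<noteq> C" for B C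
    proof (rule ccontr)
      assume "U B \<inter> U C \<noteq> {}"
      then obtain v b c where v: "b \<in> B" "v \<in> D b" "c \<in> C" "v \<in> D c" by (auto simp: U_def)
      then have "b = c" using descendants_depth_eq depth that by (metis D_def)
      then show False using arc_unique v that by blast
    qed
    have D_w: "D w = insert w (\<Union>B\<in>?K. U B)"
      unfolding D_def U_def by (rule descendants_single)
    \<comment> \<open>Isolates the argument of one edge, the only one affected when t is attached
      below this edge.\<close>
    define br where "br B u = mbrace (\<iota> w) (add_mset u (image_mset (mul_prod ?nv) (mset_set (?K - {B}))))" for B u
    have K_split: "image_mset f (mset_set ?K) = add_mset (f B) (image_mset f (mset_set (?K - {B})))"
      if "B \<in> ?K" for f :: "'a set \<Rightarrow> 'q" and B
      using mset_set.remove[OF K that] by simp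
    \<comment> \<open>The case v = w: the roots of T form a further edge at w, and the values below
      the old edges are unchanged.\<close>
    have "node_value (A w) w = mbrace (\<iota> w) (add_mset t (image_mset (mul_prod ?nv) (mset_set ?K)))"
    proof -
      have new: "roots T \<notin> ?K" using B(3)[of "roots T"] forest_roots[OF T] LM by blast
      have "{B. (w, B) \<in> A w} = insert (roots T) ?K"
        using T_arcs(1) LM 1(2) unfolding A[OF 1(2)] by blast
      moreover have "image_mset (mul_prod (node_value (A w))) (mset_set ?K) = image_mset (mul_prod ?nv) (mset_set ?K)"
      proof (intro image_mset_cong mul_prod_cong)
        fix C b assume "C \<in># mset_set ?K" "b \<in> C"
        then have "C \<in> ?K" using K by simp
        then show "node_value (A w) b = ?nv b"
          using B(3)[of C] w_notin[of C b] \<open>b \<in> C\<close> 1(2) by (intro other) auto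
      qed
      ultimately show ?thesis
        using K new by (simp add: node_value_unfold[OF wf[OF 1(2)]] inT[OF 1(2)])
    qed
    also have "\<dots> = ?nv w \<lhd> t - (\<Sum>m\<in>#image_mset (mul_prod ?nv) (mset_set ?K).
        mbrace (\<iota> w) (add_mset (m \<lhd> t) (image_mset (mul_prod ?nv) (mset_set ?K) - {#m#})))"
      by (subst node_value_unfold[OF forest_wf_child_rel[OF S], of w]) (rule mbrace_add_mset)
    also have "(\<Sum>m\<in>#image_mset (mul_prod ?nv) (mset_set ?K).
        mbrace (\<iota> w) (add_mset (m \<lhd> t) (image_mset (mul_prod ?nv) (mset_set ?K) - {#m#}))) =
        (\<Sum>B\<in>?K. mbrace (\<iota> w) (add_mset (mul_prod ?nv B \<lhd> t)
          (image_mset (mul_prod ?nv) (mset_set ?K) - {#mul_prod ?nv B#})))"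
      by (simp add: sum_unfold_sum_mset image_mset.compositionality comp_def)
    also have "\<dots> = (\<Sum>B\<in>?K. br B (mul_prod ?nv B \<lhd> t))"
      unfolding br_def by (intro sum.cong refl) (simp add: K_split)
    finally have top: "node_value (A w) w = ?nv w \<lhd> t - (\<Sum>B\<in>?K. br B (mul_prod ?nv B \<lhd> t))" .
    \<comment> \<open>The case of v below the edge B: the other edges at w keep their values, and
      the multiplication by t is distributed over the children in B.\<close>
    have below: "(\<Sum>v\<in>U B. node_value (A v) w) = br B (mul_prod ?nv B \<lhd> t)" if BK: "B \<in> ?K" for B
    proof -
      have "node_value (A v) w = br B (mul_prod (node_value (A v)) B)" if v: "v \<in> U B" for v
      proof -
        have vL: "v \<in> L" "v \<noteq> w" using v U_L[OF BK] U_w[OF BK] by auto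
        have "{C. (w, C) \<in> A v} = ?K"
          using T_arcs(1) LM 1(2) vL(2) unfolding A[OF vL(1)] by blast
        moreover have "image_mset (mul_prod (node_value (A v))) (mset_set (?K - {B})) =
            image_mset (mul_prod ?nv) (mset_set (?K - {B}))"
        proof (intro image_mset_cong mul_prod_cong)
          fix C b assume "C \<in># mset_set (?K - {B})" "b \<in> C"
          then have C: "C \<in> ?K" "C \<noteq> B" using K by auto
          then have "v \<notin> D b" using U_disj[OF BK C(1)] v \<open>b \<in> C\<close> by (auto simp: U_def)
          then show "node_value (A v) b = ?nv b"
            using B(3)[OF C(1)] \<open>b \<in> C\<close> vL by (intro other) auto
        qed
        ultimately show ?thesis
          by (simp add: node_value_unfold[OF wf[OF vL(1)], of w] K_split[OF BK] br_def)
      qed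
      then have "(\<Sum>v\<in>U B. node_value (A v) w) = br B (\<Sum>v\<in>U B. mul_prod (node_value (A v)) B)"
        by (simp add: br_def mbrace_sum)
      also have "(\<Sum>v\<in>U B. mul_prod (node_value (A v)) B) = mul_prod ?nv B \<lhd> t"
        unfolding U_def
      proof (rule mul_prod_attach_sum)
        show "D b \<inter> D c = {}" if "b \<in> B" "c \<in> B" "b \<noteq> c" for b c
          using that descendants_depth_eq depth[OF BK] by (auto simp: D_def)
        show "(\<Sum>v\<in>D b. node_value (A v) b) = ?nv b \<lhd> t" if "b \<in> B" for b
          using that B(3)[OF BK] BK by (intro 1(1)) (auto simp: child_rel_def)
        show "finite (D b)" if "b \<in> B" for b using that fin_D B(3)[OF BK] by blast
        show "node_value (A v) b = ?nv b" if "b \<in> B" "c \<in> B" "v \<in> D c" "v \<notin> D b" for b c v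
          using that B(3)[OF BK] D_L by (intro other) blast+
      qed (use B[OF BK] in auto)
      finally show ?thesis .
    qed
    have "(\<Sum>v\<in>D w. node_value (A v) w) = node_value (A w) w + (\<Sum>v\<in>(\<Union>B\<in>?K. U B). node_value (A v) w)"
      unfolding D_w using K U_L U_w by (intro sum.insert) auto
    also have "(\<Sum>v\<in>(\<Union>B\<in>?K. U B). node_value (A v) w) = (\<Sum>B\<in>?K. \<Sum>v\<in>U B. node_value (A v) w)"
      using K U_L U_disj by (intro sum.UNION_disjoint) auto
    also have "\<dots> = (\<Sum>B\<in>?K. br B (mul_prod ?nv B \<lhd> t))"
      using below by (intro sum.cong) auto
    finally show ?case by (simp add: top)
  qed
  have "(\<Sum>v\<in>L. forest_value (attach v S T)) = (\<Sum>v\<in>(\<Union>r\<in>roots S. D r). mul_prod (node_value (A v)) (roots S))"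
    using descendants_roots L by (simp add: forest_value_def A_def D_def)
  also have "\<dots> = mul_prod (node_value (arcs S)) (roots S) \<lhd> t"
  proof (rule mul_prod_attach_sum)
    show "D b \<inter> D c = {}" if "b \<in> roots S" "c \<in> roots S" "b \<noteq> c" for b c
      using that descendants_depth_eq depth_root by (auto simp: D_def)
    show "finite (D b)" if "b \<in> roots S" for b using that fin_D roots_verts L by blast
    show "(\<Sum>v\<in>D b. node_value (A v) b) = node_value (arcs S) b \<lhd> t" if "b \<in> roots S" for b
      using that main roots_verts L by blast
    show "node_value (A v) b = node_value (arcs S) b" if "b \<in> roots S" "c \<in> roots S" "v \<in> D c" "v \<notin> D b" for b c v
      using that roots_verts L D_L by (intro other) blast+
  qed (use roots_nonempty roots_verts finite_verts in \<open>auto intro: finite_subset\<close>)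
  finally show ?thesis by (simp add: forest_value_def t_def)
qed

end

section \<open>The algebra of all trees modulo the relations\<close>

definition app_ext :: "gen \<Rightarrow> ('a tree \<Rightarrow>\<^sub>0 'k) \<Rightarrow> ('a tree \<Rightarrow>\<^sub>0 'k) \<Rightarrow> ('a tree \<Rightarrow>\<^sub>0 'k::field)" where
  "app_ext g = bilin_ext (\<lambda>s t. basis (tree_app g s t))"

lemma app_ext_swap: "app_ext g u v = app_ext (gen_swap g) v u"
  unfolding app_ext_def by (subst bilin_ext_flip) (simp add: tree_app_swap[of g])

lemma subspace_rel_span: "pm.subspace rel_span"
  unfolding rel_span_def by (rule pm.subspace_span)

lemma rel_span_app_left:
  assumes "u \<in> rel_span"
  shows "app_ext g u v \<in> rel_span"
proof -
  have "lin_ext (\<lambda>s. basis (tree_app g s t)) u \<in> rel_span" for t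
    using assms unfolding rel_span_def
  proof (induction rule: pm.span_induct_alt)
    case base
    then show ?case by (simp add: pm.span_zero)
  next
    case (step c x y)
    then have "lin_ext (\<lambda>s. basis (tree_app g s t)) x \<in> {w. \<exists>M. rel_context M w}"
      by (auto intro: rel_context.app)
    then show ?case
      unfolding lin_ext_add lin_ext_scale by (intro pm.span_add pm.span_scale pm.span_base step)
  qed
  then show ?thesis
    unfolding app_ext_def bilin_ext_right by (rule subspace_lin_ext[OF subspace_rel_span])
qed

text \<open>The swapped generator moves the argument to the left.\<close>

lemma rel_span_app_right: "v \<in> rel_span \<Longrightarrow> app_ext g u v \<in> rel_span"
  unfolding app_ext_swap[of g] by (rule rel_span_app_left)

lemma rel_span_rel: "is_rel r \<Longrightarrow> r s t u \<in> rel_span"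
  unfolding rel_span_def by (blast intro: pm.span_base rel_context.rel)

text \<open>A quotient by \<open>comprelie_ideal\<close> would not carry these products: a product
  of two trees with labels in common is not linear, so that ideal is not stable under them.\<close>

definition rel_cong :: "(nat tree \<Rightarrow>\<^sub>0 'k::field) \<Rightarrow> (nat tree \<Rightarrow>\<^sub>0 'k) \<Rightarrow> bool" where
  "rel_cong u v \<longleftrightarrow> u - v \<in> rel_span"

lemma rel_cong_refl: "rel_cong u u"
  using pm.subspace_0[OF subspace_rel_span] by (simp add: rel_cong_def)

lemma equivp_rel_cong: "equivp rel_cong"
proof (intro equivpI reflpI sympI transpI)
  fix u v w :: "nat tree \<Rightarrow>\<^sub>0 'k::field"
  show "rel_cong u u" by (rule rel_cong_refl)
  show "rel_cong v u" if "rel_cong u v"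
    using pm.subspace_neg[OF subspace_rel_span, of "u - v"] that by (simp add: rel_cong_def)
  show "rel_cong u w" if "rel_cong u v" "rel_cong v w"
    using pm.subspace_add[OF subspace_rel_span, of "u - v" "v - w"] that by (simp add: rel_cong_def)
qed

quotient_type (overloaded) 'k tree_algebra = "nat tree \<Rightarrow>\<^sub>0 'k::field" / rel_cong
  morphisms rep_tree_algebra tree_class
  by (rule equivp_rel_cong)

instantiation tree_algebra :: (field) ab_group_add
begin

lift_definition zero_tree_algebra :: "'a tree_algebra" is 0 .

lift_definition plus_tree_algebra :: "'a tree_algebra \<Rightarrow> 'a tree_algebra \<Rightarrow> 'a tree_algebra" is "(+)"
  subgoal for u u' v v'
    using pm.subspace_add[OF subspace_rel_span, of "u - u'" "v - v'"]
    by (simp add: rel_cong_def algebra_simps)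
  done

lift_definition uminus_tree_algebra :: "'a tree_algebra \<Rightarrow> 'a tree_algebra" is uminus
  subgoal for u u'
    using pm.subspace_neg[OF subspace_rel_span, of "u - u'"] by (simp add: rel_cong_def algebra_simps)
  done

lift_definition minus_tree_algebra :: "'a tree_algebra \<Rightarrow> 'a tree_algebra \<Rightarrow> 'a tree_algebra" is "(-)"
  subgoal for u u' v v'
    using pm.subspace_diff[OF subspace_rel_span, of "u - u'" "v - v'"]
    by (simp add: rel_cong_def algebra_simps)
  done

instance
proof
  fix a b c :: "'a tree_algebra"
  show "a + b + c = a + (b + c)" by transfer (simp add: add.assoc rel_cong_refl)
  show "a + b = b + a" by transfer (simp add: add.commute rel_cong_refl)
  show "0 + a = a" by transfer (simp add: rel_cong_refl)
  show "- a + a = 0" by transfer (simp add: rel_cong_refl)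
  show "a - b = a + - b" by transfer (simp add: rel_cong_refl)
qed

end

lift_definition class_app :: "gen \<Rightarrow> 'k::field tree_algebra \<Rightarrow> 'k tree_algebra \<Rightarrow> 'k tree_algebra" is app_ext
proof -
  fix g and u u' v v' :: "nat tree \<Rightarrow>\<^sub>0 'k"
  assume "rel_cong u u'" "rel_cong v v'"
  then have "app_ext g (u - u') v + app_ext g u' (v - v') \<in> rel_span"
    by (intro pm.subspace_add[OF subspace_rel_span] rel_span_app_left rel_span_app_right)
      (simp_all add: rel_cong_def)
  then show "rel_cong (app_ext g u v) (app_ext g u' v')"
    by (simp add: rel_cong_def app_ext_def bilin_ext_diff_left bilin_ext_diff_right)
qed

lemma trilinear_rel_span:
  assumes "is_rel r"
  shows "lin_ext (\<lambda>s. lin_ext (\<lambda>t. lin_ext (\<lambda>q. r s t q) w) v) u \<in> rel_span"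
  by (intro subspace_lin_ext subspace_rel_span rel_span_rel assms)

lemma app_ext_app_left:
  "app_ext g (app_ext h u v) w = lin_ext (\<lambda>s. lin_ext (\<lambda>t. lin_ext (\<lambda>q.
     basis (tree_app g (tree_app h s t) q)) w) v) u"
  by (simp add: app_ext_def bilin_ext_left lin_ext_lin_ext)

lemma app_ext_app_right:
  "app_ext g u (app_ext h v w) = lin_ext (\<lambda>s. lin_ext (\<lambda>t. lin_ext (\<lambda>q.
     basis (tree_app g s (tree_app h t q))) w) v) u"
  by (simp add: app_ext_def bilin_ext_left lin_ext_lin_ext)

definition class_label :: "nat \<Rightarrow> 'k::field tree_algebra" where
  "class_label a = tree_class (basis (tree_input a))"

text \<open>Additivity and commutativity already hold for vectors of trees; for the other laws the
  difference of the two sides is the trilinear extension of a relation.\<close>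

interpretation tree_algebra: comprelie_algebra
  "class_app Gen_x :: 'k::field tree_algebra \<Rightarrow> _" "class_app Gen_c" class_label
proof
  fix a b c :: "'k tree_algebra"
  show "class_app Gen_x (a + b) c = class_app Gen_x a c + class_app Gen_x b c"
    by transfer (simp add: app_ext_def bilin_ext_add_left rel_cong_refl)
  show "class_app Gen_x a (b + c) = class_app Gen_x a b + class_app Gen_x a c"
    by transfer (simp add: app_ext_def bilin_ext_add_right rel_cong_refl)
  show "class_app Gen_c (a + b) c = class_app Gen_c a c + class_app Gen_c b c"
    by transfer (simp add: app_ext_def bilin_ext_add_left rel_cong_refl)
  show "class_app Gen_c a b = class_app Gen_c b a"
  proof transfer
    fix a b :: "nat tree \<Rightarrow>\<^sub>0 'k"
    show "rel_cong (app_ext Gen_c a b) (app_ext Gen_c b a)"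
      using app_ext_swap[of Gen_c a b] by (simp add: rel_cong_refl)
  qed
  show "class_app Gen_c (class_app Gen_c a b) c = class_app Gen_c a (class_app Gen_c b c)"
  proof transfer
    fix u v w :: "nat tree \<Rightarrow>\<^sub>0 'k"
    have "is_rel assoc_rel" by (simp add: is_rel_def)
    from trilinear_rel_span[OF this, of w v u]
    show "rel_cong (app_ext Gen_c (app_ext Gen_c u v) w) (app_ext Gen_c u (app_ext Gen_c v w))"
      unfolding rel_cong_def app_ext_app_left app_ext_app_right assoc_rel_def
      by (simp add: lin_ext_fun_diff)
  qed
  show "class_app Gen_x (class_app Gen_x a b) c - class_app Gen_x a (class_app Gen_x b c) =
      class_app Gen_x (class_app Gen_x a c) b - class_app Gen_x a (class_app Gen_x c b)"
  proof transfer
    fix u v w :: "nat tree \<Rightarrow>\<^sub>0 'k"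
    have "is_rel prelie_rel" by (simp add: is_rel_def)
    from trilinear_rel_span[OF this, of w v u]
    show "rel_cong (app_ext Gen_x (app_ext Gen_x u v) w - app_ext Gen_x u (app_ext Gen_x v w))
        (app_ext Gen_x (app_ext Gen_x u w) v - app_ext Gen_x u (app_ext Gen_x w v))"
      unfolding rel_cong_def app_ext_app_left app_ext_app_right prelie_rel_def
      by (simp add: lin_ext_fun_diff lin_ext_swap[of _ v w])
  qed
  show "class_app Gen_x (class_app Gen_c a b) c =
      class_app Gen_c (class_app Gen_x a c) b + class_app Gen_c a (class_app Gen_x b c)"
  proof transfer
    fix u v w :: "nat tree \<Rightarrow>\<^sub>0 'k"
    have "is_rel leibniz_rel" by (simp add: is_rel_def)
    from trilinear_rel_span[OF this, of w v u]
    show "rel_cong (app_ext Gen_x (app_ext Gen_c u v) w)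
        (app_ext Gen_c (app_ext Gen_x u w) v + app_ext Gen_c u (app_ext Gen_x v w))"
      unfolding rel_cong_def app_ext_app_left app_ext_app_right leibniz_rel_def
      by (simp add: lin_ext_fun_diff lin_ext_fun_add lin_ext_swap[of _ v w] diff_diff_eq)
  qed
qed

text \<open>
  With representatives of the values, \<open>lin_ext\<close> can be used and no scalar multiplication on
  \<open>tree_algebra\<close> is needed.
\<close>

definition forest_rep :: "nat rooted_hypergraph \<Rightarrow> (nat tree \<Rightarrow>\<^sub>0 'k::field)" where
  "forest_rep S = rep_tree_algebra (tree_algebra.forest_value S)"

lemma tree_class_eq_iff: "tree_class u = tree_class v \<longleftrightarrow> u - v \<in> rel_span"
  by (simp add: tree_algebra.abs_eq_iff rel_cong_def)

lemma tree_class_forest_rep: "tree_class (forest_rep S) = tree_algebra.forest_value S"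
  unfolding forest_rep_def by (rule Quotient3_abs_rep[OF Quotient3_tree_algebra])

lemma tree_class_add: "tree_class (u + v) = tree_class u + tree_class v"
  by (simp add: plus_tree_algebra.abs_eq)

lemma tree_class_sum: "tree_class (\<Sum>x\<in>X. f x) = (\<Sum>x\<in>X. tree_class (f x))"
proof (induction X rule: infinite_finite_induct)
qed (simp_all add: tree_class_add zero_tree_algebra_def)

lemma forest_rep_graft:
  assumes "S \<in> forests A" "T \<in> forests B" "A \<inter> B = {}"
  shows "lin_ext forest_rep (graft S T) - app_ext Gen_x (forest_rep S) (forest_rep T) \<in> rel_span"
proof -
  have "tree_class (lin_ext forest_rep (graft S T)) = (\<Sum>v\<in>A. tree_algebra.forest_value (attach v S T))"
    by (simp add: graft_def lin_ext_sum tree_class_sum tree_class_forest_rep forests_verts[OF assms(1)])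
  also have "\<dots> = tree_class (app_ext Gen_x (forest_rep S) (forest_rep T))"
    unfolding tree_algebra.forest_value_graft[OF assms]
    by (simp add: tree_class_forest_rep[symmetric] class_app.abs_eq)
  finally show ?thesis by (simp only: tree_class_eq_iff)
qed

lemma forest_rep_join:
  assumes "S \<in> forests A" "T \<in> forests B" "A \<inter> B = {}"
  shows "forest_rep (join S T) - app_ext Gen_c (forest_rep S) (forest_rep T) \<in> rel_span"
  using tree_algebra.forest_value_join[OF assms]
  by (simp add: tree_class_eq_iff[symmetric] tree_class_forest_rep[symmetric] class_app.abs_eq)

text \<open>Thus \<open>forest_rep\<close> inverts the evaluation up to relations. Both maps respect
  the products given by x and c, the second one modulo the relations, so induction on t
  suffices.\<close>

lemma forest_rep_tree_forests:
  "t \<in> linear_trees A \<Longrightarrow> finite A \<Longrightarrow>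
    lin_ext forest_rep (tree_forests t) - Poly_Mapping.single t (1::'k::field) \<in> rel_span"
proof (induction t arbitrary: A rule: tree_induct_xc)
  case (input a)
  have "tree_class (forest_rep (point a)) = tree_class (Poly_Mapping.single (tree_input a) (1::'k))"
    by (simp add: tree_class_forest_rep tree_algebra.forest_value_point class_label_def)
  then show ?case by (simp add: tree_class_eq_iff)
next
  case (x s t)
  let ?F = "lin_ext forest_rep :: _ \<Rightarrow> nat tree \<Rightarrow>\<^sub>0 'k"
  obtain B C where BC: "s \<in> linear_trees B" "t \<in> linear_trees C" "A = B \<union> C" "B \<inter> C = {}"
    using linear_trees_appD[OF x.prems] .
  have fin: "finite B" "finite C" using BC x.prems by auto
  have keys: "S \<in> Poly_Mapping.keys (tree_forests s :: _ \<Rightarrow>\<^sub>0 'k) \<Longrightarrow> S \<in> forests B"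
    "T \<in> Poly_Mapping.keys (tree_forests t :: _ \<Rightarrow>\<^sub>0 'k) \<Longrightarrow> T \<in> forests C" for S T
    using tree_forests_supported[OF BC(1) fin(1)] tree_forests_supported[OF BC(2) fin(2)]
    by (auto simp: supported_def)
  have "?F (bilin_ext graft (tree_forests s) (tree_forests t)) -
      app_ext Gen_x (?F (tree_forests s)) (?F (tree_forests t)) =
    lin_ext (\<lambda>S. lin_ext (\<lambda>T. ?F (graft S T) - app_ext Gen_x (forest_rep S) (forest_rep T)) (tree_forests t))
      (tree_forests s)"
    by (simp add: bilin_ext_left lin_ext_lin_ext lin_ext_fun_diff app_ext_def bilin_ext_lin_ext_left
        bilin_ext_lin_ext_right lin_ext_swap[of _ "tree_forests t"])
  also have "\<dots> \<in> rel_span"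
    by (intro subspace_lin_ext subspace_rel_span forest_rep_graft[OF _ _ BC(4)] keys)
  finally have 1: "?F (tree_forests (tree_app Gen_x s t)) -
      app_ext Gen_x (?F (tree_forests s)) (?F (tree_forests t)) \<in> rel_span" by simp
  have "tree_class (?F (tree_forests s)) = tree_class (Poly_Mapping.single s (1::'k))"
    "tree_class (?F (tree_forests t)) = tree_class (Poly_Mapping.single t (1::'k))"
    using x.IH BC fin by (auto simp: tree_class_eq_iff)
  then have "tree_class (app_ext Gen_x (?F (tree_forests s)) (?F (tree_forests t))) =
      tree_class (Poly_Mapping.single (tree_app Gen_x s t) (1::'k))"
    by (simp add: class_app.abs_eq[symmetric]) (simp add: class_app.abs_eq app_ext_def bilin_ext_single_left)
  then show ?case using 1 by (simp only: tree_class_eq_iff[symmetric])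
next
  case (c s t)
  let ?F = "lin_ext forest_rep :: _ \<Rightarrow> nat tree \<Rightarrow>\<^sub>0 'k"
  obtain B C where BC: "s \<in> linear_trees B" "t \<in> linear_trees C" "A = B \<union> C" "B \<inter> C = {}"
    using linear_trees_appD[OF c.prems] .
  have fin: "finite B" "finite C" using BC c.prems by auto
  have keys: "S \<in> Poly_Mapping.keys (tree_forests s :: _ \<Rightarrow>\<^sub>0 'k) \<Longrightarrow> S \<in> forests B"
    "T \<in> Poly_Mapping.keys (tree_forests t :: _ \<Rightarrow>\<^sub>0 'k) \<Longrightarrow> T \<in> forests C" for S T
    using tree_forests_supported[OF BC(1) fin(1)] tree_forests_supported[OF BC(2) fin(2)]
    by (auto simp: supported_def)
  have "?F (bilin_ext (\<lambda>S T. basis (join S T)) (tree_forests s) (tree_forests t)) -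
      app_ext Gen_c (?F (tree_forests s)) (?F (tree_forests t)) =
    lin_ext (\<lambda>S. lin_ext (\<lambda>T. forest_rep (join S T) - app_ext Gen_c (forest_rep S) (forest_rep T)) (tree_forests t))
      (tree_forests s)"
    by (simp add: bilin_ext_left lin_ext_lin_ext lin_ext_fun_diff app_ext_def bilin_ext_lin_ext_left
        bilin_ext_lin_ext_right lin_ext_swap[of _ "tree_forests t"])
  also have "\<dots> \<in> rel_span"
    by (intro subspace_lin_ext subspace_rel_span forest_rep_join[OF _ _ BC(4)] keys)
  finally have 1: "?F (tree_forests (tree_app Gen_c s t)) -
      app_ext Gen_c (?F (tree_forests s)) (?F (tree_forests t)) \<in> rel_span" by simp
  have "tree_class (?F (tree_forests s)) = tree_class (Poly_Mapping.single s (1::'k))"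
    "tree_class (?F (tree_forests t)) = tree_class (Poly_Mapping.single t (1::'k))"
    using c.IH BC fin by (auto simp: tree_class_eq_iff)
  then have "tree_class (app_ext Gen_c (?F (tree_forests s)) (?F (tree_forests t))) =
      tree_class (Poly_Mapping.single (tree_app Gen_c s t) (1::'k))"
    by (simp add: class_app.abs_eq[symmetric]) (simp add: class_app.abs_eq app_ext_def bilin_ext_single_left)
  then show ?case using 1 by (simp only: tree_class_eq_iff[symmetric])
qed

lemma tree_forests_kernel:
  fixes u :: "nat tree \<Rightarrow>\<^sub>0 'k::field"
  assumes "u \<in> ops free_operad n"
  shows "lin_ext tree_forests u = (0 :: _ \<Rightarrow>\<^sub>0 'k) \<longleftrightarrow> operad_ideal free_operad comprelie_rels n u"
proof
  assume 0: "lin_ext tree_forests u = (0 :: _ \<Rightarrow>\<^sub>0 'k)"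
  have u: "u \<in> supported (trees n)" using assms by (simp add: free_operad_simps)
  have "lin_ext (\<lambda>t. lin_ext forest_rep (tree_forests t :: _ \<Rightarrow>\<^sub>0 'k) - basis t) u \<in> rel_span"
    using u by (intro subspace_lin_ext subspace_rel_span forest_rep_tree_forests[of _ "{1..n}"])
      (auto simp: supported_def trees_linear_trees)
  \<comment> \<open>Since u is sent to 0, only the term - u remains.\<close>
  then have "- u \<in> rel_span"
    by (simp add: lin_ext_fun_diff lin_ext_lin_ext[symmetric] 0)
  from pm.subspace_neg[OF subspace_rel_span this] have "u \<in> rel_span" by simp
  then show "operad_ideal free_operad comprelie_rels n u" using u by (rule rel_span_imp_ideal)
qed (rule tree_forests_ideal)

section \<open>Generators and the isomorphism\<close>

lemma FH_x2_eq: "FH_x2 = lin_ext tree_forests (gen_op Gen_x)"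
  by (simp add: FH_x2_def gen_op_def bilin_ext_single_left graft_def)
    (simp add: point_def attach_def insert_commute)

lemma FH_c2_eq: "FH_c2 = lin_ext tree_forests (gen_op Gen_c)"
  by (simp add: FH_c2_def gen_op_def bilin_ext_single_left) (simp add: point_def join_def insert_commute)

text \<open>A homomorphism in the uniqueness claim is prescribed on x and c; its value on y follows
  through the action of the transposition.\<close>

lemma gen_op_y: "gen_op Gen_y = act free_operad 2 (transpose 1 2) (gen_op Gen_x)"
proof -
  have "inv (transpose 1 (2::nat)) = transpose 1 2" by simp
  moreover have "tree_app Gen_y (tree_input 1) (tree_input (2::nat)) = tree_app Gen_x (tree_input 2) (tree_input 1)"
    using tree_app_swap[of Gen_y] by simp
  ultimately show ?thesis by (simp add: free_operad_simps relabel_def gen_op_def)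
qed

theorem theorem18:
  "\<exists>\<phi>. operad_iso (FH :: ('k::field_char_0, nat rooted_hypergraph \<Rightarrow>\<^sub>0 'k) operad_data) ComPreLie \<phi> \<and>
    \<phi> 2 FH_x2 = comprelie_x \<and> \<phi> 2 FH_c2 = comprelie_c \<and>
    (\<forall>\<psi>. operad_hom FH ComPreLie \<psi> \<and> \<psi> 2 FH_x2 = comprelie_x \<and> \<psi> 2 FH_c2 = comprelie_c \<longrightarrow>
      (\<forall>n. \<forall>p\<in>ops FH n. \<psi> n p = \<phi> n p))"
proof -
  let ?F = "free_operad :: ('k, nat tree \<Rightarrow>\<^sub>0 'k) operad_data"
  interpret F: operad ?F by (rule operad_free_operad)
  interpret \<pi>: operad_hom ?F FH "\<lambda>_. lin_ext tree_forests" by (rule tree_forests_hom)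
  interpret \<rho>: operad_hom ?F ComPreLie "\<lambda>_. comprelie_class" by (rule comprelie_class_hom)
  have gen: "gen_op g \<in> ops ?F 2" for g
  proof -
    have "{1..2} = {1, 2::nat}" by auto
    then show ?thesis by (simp add: gen_op_def free_operad_simps trees_def mset_set.insert)
  qed
  have surj: "comprelie_class ` ops ?F n = ops ComPreLie n" for n
    by (simp add: ComPreLie_def)
  have kernel: "lin_ext tree_forests p = (0 :: _ \<Rightarrow>\<^sub>0 'k) \<longleftrightarrow> comprelie_class p = 0" if "p \<in> ops ?F n" for n p
  proof -
    have "0 \<in> ops ?F n" using pm.subspace_0[OF subspace_supported] by (simp add: free_operad_simps)
    from comprelie_class_eq_iff_ideal[OF that this] tree_forests_kernel[OF that]
    show ?thesis by (simp add: zero_comprelie_def)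
  qed
  obtain \<phi> where iso: "operad_iso FH (ComPreLie :: ('k, 'k comprelie) operad_data) \<phi>"
    and \<phi>: "\<And>n p. p \<in> ops ?F n \<Longrightarrow> \<phi> n (lin_ext tree_forests p) = comprelie_class p"
    using operad_iso_of_same_kernel[OF tree_forests_hom comprelie_class_hom tree_forests_surj surj] kernel
    by blast
  have unique: "\<psi> n p = \<phi> n p"
    if \<psi>: "operad_hom FH (ComPreLie :: ('k, 'k comprelie) operad_data) \<psi>"
      and x: "\<psi> 2 FH_x2 = comprelie_x" and c: "\<psi> 2 FH_c2 = comprelie_c" and p: "p \<in> ops FH n" for \<psi> n p
  proof -
    interpret \<psi>: operad_hom FH "ComPreLie :: ('k, 'k comprelie) operad_data" \<psi> by fact
    \<comment> \<open>The operations on whose images \<psi> and \<phi> agree; they form a suboperad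
      that contains the generators.\<close>
    define G where "G n = {u \<in> ops ?F n. \<psi> n (lin_ext tree_forests u) = comprelie_class u}" for n
    have "supported (trees n) \<subseteq> G n" for n
    proof (rule free_operad_generated)
      show "act_closed G"
        unfolding act_closed_def G_def
        by (auto simp: F.act_closed \<pi>.hom_act \<rho>.hom_act \<pi>.hom_closed \<psi>.hom_act simp del: One_nat_def)
      show "pcomp ?F m n i p q \<in> G (m + n - 1)" if "i \<in> {1..m}" "p \<in> G m" "q \<in> G n" for i m n p q
        using that unfolding G_def
        by (auto simp: F.pcomp_closed \<pi>.hom_pcomp \<rho>.hom_pcomp \<pi>.hom_closed \<psi>.hom_pcomp
            simp del: One_nat_def atLeastAtMost_iff)
      show "ident ?F \<in> G 1"
        using F.ident_closed \<pi>.hom_ident \<rho>.hom_ident \<psi>.hom_ident by (simp add: G_def)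
      have scl: "scale ?F = pm_scale" by (simp add: free_operad_simps)
      show "pm.subspace (G n)" for n
        unfolding pm.subspace_def
      proof (intro conjI ballI allI)
        have zero: "0 \<in> ops ?F n" using pm.subspace_0[OF F.subspace_ops[unfolded scl]] .
        have "\<psi> n 0 = 0"
          using \<psi>.hom_add[OF \<pi>.hom_closed[OF zero] \<pi>.hom_closed[OF zero]] by simp
        then show "0 \<in> G n" using zero by (simp add: G_def zero_comprelie_def)
        show "u + v \<in> G n" if "u \<in> G n" "v \<in> G n" for u v
          using that pm.subspace_add[OF F.subspace_ops[unfolded scl]] unfolding G_def
          by (auto simp: \<pi>.hom_add \<rho>.hom_add \<pi>.hom_closed \<psi>.hom_add)
        show "pm_scale a u \<in> G n" if "u \<in> G n" for a u
          using that pm.subspace_scale[OF F.subspace_ops[unfolded scl]]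
            \<pi>.hom_scale[unfolded scl] \<rho>.hom_scale[unfolded scl] unfolding G_def
          by (auto simp: \<pi>.hom_closed \<psi>.hom_scale)
      qed
      have gx: "gen_op Gen_x \<in> G 2"
        using gen x by (simp add: G_def FH_x2_eq comprelie_x_def)
      moreover have "gen_op Gen_c \<in> G 2"
        using gen c by (simp add: G_def FH_c2_eq comprelie_c_def)
      moreover have "gen_op Gen_y \<in> G 2"
        unfolding gen_op_y
        using \<open>act_closed G\<close> gx permutes_swap_id[of 1 "{1..2::nat}" 2] unfolding act_closed_def by simp
      ultimately show "gen_op g \<in> G 2" for g by (cases g) auto
    qed
    moreover obtain u where u: "u \<in> ops ?F n" "p = lin_ext tree_forests u"
      using p tree_forests_surj[of n, where 'k = 'k] by blast
    ultimately show ?thesis using \<phi> by (auto simp: G_def free_operad_simps)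
  qed
  show ?thesis
    using iso \<phi>[OF gen, of Gen_x] \<phi>[OF gen, of Gen_c] unique
    by (intro exI[of _ \<phi>]) (simp add: FH_x2_eq FH_c2_eq comprelie_x_def comprelie_c_def)
qed

end
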